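(* Let $(M,\Omega)$ be a locally homogeneous multisymplectic manifold and let $G(M,\Omega)$ be the group of diffeomorphisms $\phi\colon M\to M$ with $\phi^*\Omega=\Omega$. Then $G(M,\Omega)$ acts transitively on $M$, in the sense that it acts $r$-transitively for every $r\ge1$.
   Context: All manifolds are real, paracompact, connected and $C^\infty$; $\dim M=n$. A multisymplectic manifold of degree $k\ge 2$ is a pair $(M,\Omega)$ where $\Omega$ is a closed $k$-form on $M$ that is $1$-nondegenerate, i.e. for every $x\in M$ the map $T_xM\to\Lambda^{k-1}(T_x^*M)$, $v\mapsto i(v)\Omega_x$, is injective. A group $G$ of diffeomorphisms of $M$ acts $r$-transitively on $M$ if for any pair of collections $\{x_1,\dots,x_r\}$, $\{y_1,\dots,y_r\}$ of distinct points of $M$ there exists $\phi\in G$ with $\phi(x_i)=y_i$ for all $i$. "Transitively" means $r$-transitively for all $r$. Local Euler-like vector field: let $x\in M$ and let $K$ be a compact set with $x$ in the interior of $K$. A local Euler-like vector field at $x$ with respect to $K$ is a vector field $\Delta^x$ on $M$ such that $\operatorname{supp}\Delta^x=\overline{\{y\in M: \Delta^x(y)\neq 0\}}\subset K$, and such that there is a diffeomorphism $\varphi$ from the interior of $\operatorname{supp}\Delta^x$ onto $\mathbb{R}^n$ with $\varphi(x)=0$ and $\varphi_*\Delta^x=x^i\,\partial/\partial x^i$ (the standard dilation vector field on $\mathbb{R}^n$). Locally homogeneous: a differential form $\Omega$ on $M$ is locally homogeneous at $x\in M$ if for every open set $U$ containing $x$ there exist a compact set $K\subset U$ and a local Euler-like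 vector field $\Delta^x$ at $x$ with respect to $K$ such that $L(\Delta^x)\Omega=f\,\Omega$ on $U$ for some $f\in C^\infty(U)$. $\Omega$ is locally homogeneous if this holds at every $x\in M$. A locally homogeneous multisymplectic manifold is a multisymplectic manifold $(M,\Omega)$ with $\Omega$ locally homogeneous. *)

theory Defs
  imports "HOL-Analysis.Analysis"
begin

section \<open>Smooth maps between open subsets of Euclidean spaces\<close>

text \<open>\<open>k_times_differentiable_on k S f\<close> says that \<open>f\<close> is of class C^k on the open set \<open>S\<close>:
  all iterated directional derivatives up to order \<open>k\<close> exist and are continuous on \<open>S\<close>.\<close>

primrec k_times_differentiable_on ::
  "nat \<Rightarrow> 'e::real_normed_vector set \<Rightarrow> ('e \<Rightarrow> 'f::real_normed_vector) \<Rightarrow> bool" where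
  "k_times_differentiable_on 0 S f \<longleftrightarrow> continuous_on S f"
| "k_times_differentiable_on (Suc k) S f \<longleftrightarrow>
     (\<forall>x\<in>S. f differentiable (at x)) \<and>
     (\<forall>v. k_times_differentiable_on k S (\<lambda>x. frechet_derivative f (at x) v))"

definition smooth_on :: "'e::real_normed_vector set \<Rightarrow> ('e \<Rightarrow> 'f::real_normed_vector) \<Rightarrow> bool" where
  "smooth_on S f \<longleftrightarrow> (\<forall>k. k_times_differentiable_on k S f)"


section \<open>Smooth manifolds\<close>

text \<open>A chart \<open>(U, \<phi>)\<close> is a homeomorphism from an open set \<open>U\<close> onto an open subset of the model
  space. Values of \<open>\<phi>\<close> outside \<open>U\<close> are irrelevant.\<close>

type_synonym ('a, 'e) chart = "'a set \<times> ('a \<Rightarrow> 'e)"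

definition chart_image :: "('a, 'e) chart \<Rightarrow> 'e set" where
  "chart_image c = snd c ` fst c"

definition chart_inv :: "('a, 'e) chart \<Rightarrow> 'e \<Rightarrow> 'a" where
  "chart_inv c = inv_into (fst c) (snd c)"

definition is_chart :: "('a::topological_space, 'e::euclidean_space) chart \<Rightarrow> bool" where
  "is_chart c \<longleftrightarrow> open (fst c) \<and> open (chart_image c) \<and>
     homeomorphism (fst c) (chart_image c) (snd c) (chart_inv c)"

definition compatible_charts ::
  "('a::topological_space, 'e::euclidean_space) chart \<Rightarrow> ('a, 'e) chart \<Rightarrow> bool" where
  "compatible_charts c d \<longleftrightarrow>
     smooth_on (snd c ` (fst c \<inter> fst d)) (snd d \<circ> chart_inv c) \<and>
     smooth_on (snd d ` (fst c \<inter> fst d)) (snd c \<circ> chart_inv d)"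

definition smooth_atlas :: "('a::topological_space, 'e::euclidean_space) chart set \<Rightarrow> bool" where
  "smooth_atlas A \<longleftrightarrow>
     (\<forall>c\<in>A. is_chart c) \<and> (\<Union>c\<in>A. fst c) = UNIV \<and> (\<forall>c\<in>A. \<forall>d\<in>A. compatible_charts c d)"

definition paracompact_space :: "'a::topological_space topology \<Rightarrow> bool" where
  "paracompact_space X \<longleftrightarrow>
     (\<forall>\<U>. (\<forall>U\<in>\<U>. openin X U) \<and> \<Union>\<U> = topspace X \<longrightarrow>
        (\<exists>\<V>. (\<forall>V\<in>\<V>. openin X V) \<and> \<Union>\<V> = topspace X \<and>
             (\<forall>V\<in>\<V>. \<exists>U\<in>\<U>. V \<subseteq> U) \<and> locally_finite_in X \<V>))"

text \<open>A manifold is given by its maximal smooth atlas; the underlying space is the whole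
  (Hausdorff) type, and the dimension is that of the model space.\<close>

definition smooth_manifold :: "('a::t2_space, 'e::euclidean_space) chart set \<Rightarrow> bool" where
  "smooth_manifold M \<longleftrightarrow>
     smooth_atlas M \<and>
     (\<forall>c. is_chart c \<and> (\<forall>d\<in>M. compatible_charts c d) \<longrightarrow> c \<in> M) \<and>
     paracompact_space (euclidean :: 'a topology) \<and>
     connected (UNIV :: 'a set)"

text \<open>The Euclidean space itself. The maps and fields below may be described by any atlas,
  so that this single chart is enough.\<close>

definition standard_atlas :: "('e::euclidean_space, 'e) chart set" where
  "standard_atlas = {(UNIV, \<lambda>x. x)}"

definition charts_at :: "('a, 'e) chart set \<Rightarrow> 'a \<Rightarrow> ('a, 'e) chart set" where
  "charts_at A x = {c \<in> A. x \<in> fst c}"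

text \<open>Smoothness on an open set \<open>S\<close>.\<close>

definition smooth_map ::
  "('a::topological_space, 'e::euclidean_space) chart set \<Rightarrow> 'a set \<Rightarrow>
   ('b::topological_space, 'f::euclidean_space) chart set \<Rightarrow> ('a \<Rightarrow> 'b) \<Rightarrow> bool" where
  "smooth_map A S B f \<longleftrightarrow> continuous_on S f \<and>
     (\<forall>c\<in>A. \<forall>d\<in>B. smooth_on (snd c ` (S \<inter> fst c \<inter> f -` fst d)) (snd d \<circ> f \<circ> chart_inv c))"

text \<open>Diffeomorphism from an open set \<open>S\<close> onto an open set \<open>T\<close>.\<close>

definition diffeomorphism ::
  "('a::topological_space, 'e::euclidean_space) chart set \<Rightarrow> 'a set \<Rightarrow>
   ('b::topological_space, 'f::euclidean_space) chart set \<Rightarrow> 'b set \<Rightarrow> ('a \<Rightarrow> 'b) \<Rightarrow> bool" where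
  "diffeomorphism A S B T f \<longleftrightarrow>
     bij_betw f S T \<and> smooth_map A S B f \<and> smooth_map B T A (inv_into S f)"


section \<open>Tangent vectors\<close>

text \<open>A tangent vector at \<open>x\<close> is the family of its component vectors in all charts around \<open>x\<close>,
  related by the Jacobians of the coordinate changes. Entries at other charts are set to zero, so
  that equality of tangent vectors is equality of functions. The vector space operations are
  pointwise.\<close>

type_synonym ('a, 'e) tangent = "('a, 'e) chart \<Rightarrow> 'e"

definition tangent_space ::
  "('a, 'e::euclidean_space) chart set \<Rightarrow> 'a \<Rightarrow> ('a, 'e) tangent set" where
  "tangent_space A x =
     {v. (\<forall>c\<in>charts_at A x. \<forall>d\<in>charts_at A x.
            v d = frechet_derivative (snd d \<circ> chart_inv c) (at (snd c x)) (v c)) \<and>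
         (\<forall>c. c \<notin> charts_at A x \<longrightarrow> v c = 0)}"

text \<open>The tangent vector at \<open>x\<close> whose component vector in the chart \<open>c\<close> is \<open>u\<close>.\<close>

definition coord_vector ::
  "('a, 'e::euclidean_space) chart set \<Rightarrow> ('a, 'e) chart \<Rightarrow> 'a \<Rightarrow> 'e \<Rightarrow> ('a, 'e) tangent" where
  "coord_vector A c x u =
     (\<lambda>d. if d \<in> charts_at A x
          then frechet_derivative (snd d \<circ> chart_inv c) (at (snd c x)) u else 0)"

text \<open>The differential of \<open>f\<close> at \<open>x\<close>. On tangent vectors at \<open>x\<close> the result does not depend
  on the chart \<open>c\<close>.\<close>

definition tangent_map ::
  "('a, 'e::euclidean_space) chart set \<Rightarrow> ('b, 'f::euclidean_space) chart set \<Rightarrow> ('a \<Rightarrow> 'b) \<Rightarrow>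
   'a \<Rightarrow> ('a, 'e) tangent \<Rightarrow> ('b, 'f) tangent" where
  "tangent_map A B f x v =
     (let c = (SOME c. c \<in> charts_at A x) in
      (\<lambda>d. if d \<in> charts_at B (f x)
           then frechet_derivative (snd d \<circ> f \<circ> chart_inv c) (at (snd c x)) (v c) else 0))"


section \<open>Vector fields\<close>

text \<open>Components of a vector field in the chart \<open>c\<close>, as a function on the image of \<open>c\<close>.\<close>

definition field_rep ::
  "('a, 'e) chart \<Rightarrow> ('a \<Rightarrow> ('a, 'e) tangent) \<Rightarrow> 'e \<Rightarrow> 'e" where
  "field_rep c X y = X (chart_inv c y) c"

definition vector_field ::
  "('a, 'e::euclidean_space) chart set \<Rightarrow> ('a \<Rightarrow> ('a, 'e) tangent) \<Rightarrow> bool" where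
  "vector_field A X \<longleftrightarrow>
     (\<forall>x. X x \<in> tangent_space A x) \<and> (\<forall>c\<in>A. smooth_on (chart_image c) (field_rep c X))"

definition field_support :: "('a::topological_space \<Rightarrow> ('a, 'e::zero) tangent) \<Rightarrow> 'a set" where
  "field_support X = closure {y. X y \<noteq> (\<lambda>_. 0)}"

definition pushforward ::
  "('a, 'e::euclidean_space) chart set \<Rightarrow> ('b, 'f::euclidean_space) chart set \<Rightarrow> 'a set \<Rightarrow>
   ('a \<Rightarrow> 'b) \<Rightarrow> ('a \<Rightarrow> ('a, 'e) tangent) \<Rightarrow> 'b \<Rightarrow> ('b, 'f) tangent" where
  "pushforward A B S f X y = tangent_map A B f (inv_into S f y) (X (inv_into S f y))"

text \<open>The field \<open>x^i d/dx^i\<close>: its component vector at \<open>y\<close> is \<open>y\<close>.\<close>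

definition dilation_field :: "'e::euclidean_space \<Rightarrow> ('e, 'e) tangent" where
  "dilation_field y = coord_vector standard_atlas (UNIV, \<lambda>x. x) y y"


section \<open>Differential forms\<close>

text \<open>The \<open>k\<close>-th exterior power of the dual of \<open>T\<close>: alternating \<open>k\<close>-linear functions,
  with arguments collected in lists and value zero off the lists of length \<open>k\<close> over \<open>T\<close>.\<close>

definition alternating_forms ::
  "nat \<Rightarrow> ('c \<Rightarrow> 'e::real_vector) set \<Rightarrow> (('c \<Rightarrow> 'e) list \<Rightarrow> real) set" where
  "alternating_forms k T =
     {\<omega>. (\<forall>vs. \<not> (length vs = k \<and> set vs \<subseteq> T) \<longrightarrow> \<omega> vs = 0) \<and>
         (\<forall>vs i v w a b. length vs = k \<and> set vs \<subseteq> T \<and> i < k \<and> v \<in> T \<and> w \<in> T \<longrightarrow>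
            \<omega> (vs[i := \<lambda>c. a *\<^sub>R v c + b *\<^sub>R w c]) = a * \<omega> (vs[i := v]) + b * \<omega> (vs[i := w])) \<and>
         (\<forall>vs i j. length vs = k \<and> set vs \<subseteq> T \<and> i < j \<and> j < k \<and> vs ! i = vs ! j \<longrightarrow> \<omega> vs = 0)}"

type_synonym ('a, 'e) form = "'a \<Rightarrow> ('a, 'e) tangent list \<Rightarrow> real"

text \<open>The expression of a form in the chart \<open>c\<close>, as a form on the image of \<open>c\<close>.\<close>

definition form_rep ::
  "('a, 'e::euclidean_space) chart set \<Rightarrow> ('a, 'e) chart \<Rightarrow> ('a, 'e) form \<Rightarrow>
   'e \<Rightarrow> 'e list \<Rightarrow> real" where
  "form_rep A c \<omega> y us =
     \<omega> (chart_inv c y) (map (coord_vector A c (chart_inv c y)) us)"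

definition differential_form ::
  "('a, 'e::euclidean_space) chart set \<Rightarrow> nat \<Rightarrow> ('a, 'e) form \<Rightarrow> bool" where
  "differential_form A k \<omega> \<longleftrightarrow>
     (\<forall>x. \<omega> x \<in> alternating_forms k (tangent_space A x)) \<and>
     (\<forall>c\<in>A. \<forall>us. length us = k \<longrightarrow> smooth_on (chart_image c) (\<lambda>y. form_rep A c \<omega> y us))"

definition interior_product ::
  "('a, 'e) tangent \<Rightarrow> (('a, 'e) tangent list \<Rightarrow> real) \<Rightarrow> ('a, 'e) tangent list \<Rightarrow> real" where
  "interior_product v \<omega> = (\<lambda>vs. \<omega> (v # vs))"

text \<open>Off lists of tangent vectors the value is set to zero, as required of forms.\<close>

definition pullback ::
  "('a, 'e::euclidean_space) chart set \<Rightarrow> ('b, 'f::euclidean_space) chart set \<Rightarrow> ('a \<Rightarrow> 'b) \<Rightarrow>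
   ('b, 'f) form \<Rightarrow> ('a, 'e) form" where
  "pullback A B f \<omega> x vs =
     (if set vs \<subseteq> tangent_space A x then \<omega> (f x) (map (tangent_map A B f x) vs) else 0)"

text \<open>Exterior derivative of a form on an open subset of a Euclidean space, evaluated on
  constant vector fields (whose brackets vanish).\<close>

definition euclidean_exterior_derivative ::
  "('e::euclidean_space \<Rightarrow> 'e list \<Rightarrow> real) \<Rightarrow> 'e \<Rightarrow> 'e list \<Rightarrow> real" where
  "euclidean_exterior_derivative \<eta> y us =
     (\<Sum>i<length us. (-1) ^ i *
        frechet_derivative (\<lambda>z. \<eta> z (take i us @ drop (Suc i) us)) (at y) (us ! i))"

text \<open>Lie derivative of a form along \<open>X\<close> on an open subset of a Euclidean space, evaluated on
  constant vector fields: \<open>(L_X \<eta>)(u_1,...,u_k) = X (\<eta>(u_1,...,u_k)) - (\<Sum>i. \<eta>(...,[X,u_i],...))\<close>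
  with \<open>[X,u_i] = - D X (u_i)\<close>.\<close>

definition euclidean_lie_derivative ::
  "('e::euclidean_space \<Rightarrow> 'e) \<Rightarrow> ('e \<Rightarrow> 'e list \<Rightarrow> real) \<Rightarrow> 'e \<Rightarrow> 'e list \<Rightarrow> real" where
  "euclidean_lie_derivative X \<eta> y us =
     frechet_derivative (\<lambda>z. \<eta> z us) (at y) (X y) +
     (\<Sum>i<length us. \<eta> y (us[i := frechet_derivative X (at y) (us ! i)]))"

definition has_exterior_derivative ::
  "('a, 'e::euclidean_space) chart set \<Rightarrow> nat \<Rightarrow> ('a, 'e) form \<Rightarrow> ('a, 'e) form \<Rightarrow> bool" where
  "has_exterior_derivative A k \<omega> \<eta> \<longleftrightarrow>
     (\<forall>c\<in>A. \<forall>y\<in>chart_image c. \<forall>us. length us = Suc k \<longrightarrow>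
        euclidean_exterior_derivative (form_rep A c \<omega>) y us = form_rep A c \<eta> y us)"

definition has_lie_derivative_on ::
  "('a, 'e::euclidean_space) chart set \<Rightarrow> nat \<Rightarrow> 'a set \<Rightarrow> ('a \<Rightarrow> ('a, 'e) tangent) \<Rightarrow>
   ('a, 'e) form \<Rightarrow> ('a, 'e) form \<Rightarrow> bool" where
  "has_lie_derivative_on A k U X \<omega> \<eta> \<longleftrightarrow>
     (\<forall>c\<in>A. \<forall>y\<in>snd c ` (fst c \<inter> U). \<forall>us. length us = k \<longrightarrow>
        euclidean_lie_derivative (field_rep c X) (form_rep A c \<omega>) y us = form_rep A c \<eta> y us)"

definition closed_form ::
  "('a, 'e::euclidean_space) chart set \<Rightarrow> nat \<Rightarrow> ('a, 'e) form \<Rightarrow> bool" where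
  "closed_form A k \<omega> \<longleftrightarrow> has_exterior_derivative A k \<omega> (\<lambda>_ _. 0)"


section \<open>Locally homogeneous multisymplectic manifolds\<close>

definition one_nondegenerate ::
  "('a, 'e::euclidean_space) chart set \<Rightarrow> ('a, 'e) form \<Rightarrow> bool" where
  "one_nondegenerate M \<Omega> \<longleftrightarrow>
     (\<forall>x. inj_on (\<lambda>v. interior_product v (\<Omega> x)) (tangent_space M x))"

definition multisymplectic_manifold ::
  "('a::t2_space, 'e::euclidean_space) chart set \<Rightarrow> nat \<Rightarrow> ('a, 'e) form \<Rightarrow> bool" where
  "multisymplectic_manifold M k \<Omega> \<longleftrightarrow>
     smooth_manifold M \<and> k \<ge> 2 \<and> differential_form M k \<Omega> \<and> closed_form M k \<Omega> \<and>
     one_nondegenerate M \<Omega>"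

definition local_euler_like ::
  "('a::t2_space, 'e::euclidean_space) chart set \<Rightarrow> 'a \<Rightarrow> 'a set \<Rightarrow>
   ('a \<Rightarrow> ('a, 'e) tangent) \<Rightarrow> bool" where
  "local_euler_like M x K \<Delta> \<longleftrightarrow>
     compact K \<and> x \<in> interior K \<and> vector_field M \<Delta> \<and> field_support \<Delta> \<subseteq> K \<and>
     x \<in> interior (field_support \<Delta>) \<and>
     (\<exists>\<phi> :: 'a \<Rightarrow> 'e.
        diffeomorphism M (interior (field_support \<Delta>)) standard_atlas UNIV \<phi> \<and> \<phi> x = 0 \<and>
        pushforward M standard_atlas (interior (field_support \<Delta>)) \<phi> \<Delta> = dilation_field)"

definition locally_homogeneous_at ::
  "('a::t2_space, 'e::euclidean_space) chart set \<Rightarrow> nat \<Rightarrow> ('a, 'e) form \<Rightarrow> 'a \<Rightarrow> bool" where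
  "locally_homogeneous_at M k \<Omega> x \<longleftrightarrow>
     (\<forall>U. open U \<and> x \<in> U \<longrightarrow>
        (\<exists>K \<Delta> f. K \<subseteq> U \<and> local_euler_like M x K \<Delta> \<and>
           smooth_map M U (standard_atlas :: (real, real) chart set) f \<and>
           has_lie_derivative_on M k U \<Delta> \<Omega> (\<lambda>y vs. f y * \<Omega> y vs)))"

definition locally_homogeneous ::
  "('a::t2_space, 'e::euclidean_space) chart set \<Rightarrow> nat \<Rightarrow> ('a, 'e) form \<Rightarrow> bool" where
  "locally_homogeneous M k \<Omega> \<longleftrightarrow> (\<forall>x. locally_homogeneous_at M k \<Omega> x)"

definition multisymplectic_diffeos ::
  "('a::t2_space, 'e::euclidean_space) chart set \<Rightarrow> ('a, 'e) form \<Rightarrow> ('a \<Rightarrow> 'a) set" where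
  "multisymplectic_diffeos M \<Omega> =
     {\<phi>. diffeomorphism M UNIV M UNIV \<phi> \<and> pullback M M \<phi> \<Omega> = \<Omega>}"

definition acts_transitively :: "nat \<Rightarrow> ('a \<Rightarrow> 'a) set \<Rightarrow> bool" where
  "acts_transitively r G \<longleftrightarrow>
     (\<forall>xs ys. length xs = r \<and> distinct xs \<and> length ys = r \<and> distinct ys \<longrightarrow>
        (\<exists>\<phi>\<in>G. \<forall>i<r. \<phi> (xs ! i) = ys ! i))"

end

theory Submission
  imports Defs
begin

text \<open>The theorem holds because local homogeneity forces \<open>\<Omega>\<close> to be a volume form, and the
  volume-preserving diffeomorphisms of a connected manifold of dimension at least two act
  transitively.

  For the first claim, the Euler-like field at a point comes with a chart onto the whole of
  \<open>\<real>\<^sup>n\<close> in which it is the dilation field. There, the equation \<open>L(\<Delta>)\<Omega> = f \<Omega>\<close> is along each ray the same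
  scalar linear differential equation for all coefficients of \<open>\<Omega>\<close>; hence
  \<open>\<Omega> = g \<Omega>\<^sub>0\<close> with a function \<open>g\<close> and a constant form \<open>\<Omega>\<^sub>0\<close>, and closedness says
  \<open>dg \<and> \<Omega>\<^sub>0 = 0\<close>. If \<open>k < n\<close>, the covectors \<open>a\<close> with \<open>a \<and> \<Omega>\<^sub>0 = 0\<close> have a common kernel vector
  \<open>v\<close>, so \<open>g\<close> does not change in the direction of \<open>v\<close>, and \<open>f\<close> has the constant value \<open>k\<close> on
  the line through \<open>0\<close> spanned by \<open>v\<close> (\<open>factor_constant_on_line\<close>). That line is unbounded in the
  chart but lies in a compact set of the manifold, so it accumulates at the frontier of the
  support of the field, where \<open>f\<close> is \<open>0\<close> by continuity, because \<open>f\<close> vanishes wherever the field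
  does so on an open set. This contradicts \<open>k \<ge> 2\<close>; thus \<open>k = n\<close> (\<open>degree_eq_dimension\<close>).

  For the second claim, a change of one coordinate by an antiderivative of the density turns the
  chart above into one in which \<open>\<Omega>\<close> has constant coefficients (\<open>unimodular_chart\<close>). In such a chart,
  any two nearby points are exchanged by a half turn about their midpoint \<open>m\<close> in a plane. Letting the angle be a
  function of the distance from \<open>m\<close> that falls to \<open>0\<close> keeps the volume, since
  the derivative is a rotation composed with a transvection, and gives compact support
  (\<open>unimodular_half_turn\<close>). Extended by the identity, these maps are automorphisms of \<open>(M, \<Omega>)\<close>
  which move a point within a small neighbourhood and fix everything outside. The complement of a finite set is
  connected because \<open>n \<ge> 2\<close>, so any point of it can be moved to any other with the finite set
  fixed (\<open>move_fixing_finite\<close>); the points are then brought to their targets one after the other.\<close>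

section \<open>Functions of class C^k and smooth functions\<close>

lemma Ck_on_cong:
  assumes "open S" "\<And>x. x \<in> S \<Longrightarrow> f x = g x" "k_times_differentiable_on k S f"
  shows "k_times_differentiable_on k S g"
  using assms(2,3)
proof (induction k arbitrary: f g)
  case 0
  then show ?case by (simp cong: continuous_on_cong)
next
  case (Suc k)
  have D: "(g has_derivative frechet_derivative f (at x)) (at x)" if "x \<in> S" for x
    using Suc.prems that \<open>open S\<close>
    by (auto intro: has_derivative_transform_within_open[OF _ \<open>open S\<close>] simp: frechet_derivative_works)
  have e: "frechet_derivative g (at x) = frechet_derivative f (at x)" if "x \<in> S" for x
    using frechet_derivative_at[OF D[OF that]] by simp
  show ?case
    using D Suc.prems e by (auto intro: Suc.IH simp: differentiable_def)
qed

lemma Ck_on_subset: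
  assumes "k_times_differentiable_on k S f" "T \<subseteq> S"
  shows "k_times_differentiable_on k T f"
  using assms by (induction k arbitrary: f) (auto intro: continuous_on_subset)

lemma Ck_on_local:
  assumes "\<And>x. x \<in> S \<Longrightarrow> \<exists>T. open T \<and> x \<in> T \<and> k_times_differentiable_on k T f"
  shows "k_times_differentiable_on k S f"
  using assms
proof (induction k arbitrary: f)
  case 0
  show ?case
    unfolding k_times_differentiable_on.simps continuous_on_eq_continuous_within
  proof
    fix x assume "x \<in> S"
    then obtain T where T: "open T" "x \<in> T" "continuous_on T f" using 0 by auto
    then have "continuous (at x) f" using continuous_on_eq_continuous_at by blast
    then show "continuous (at x within S) f" by (rule continuous_at_imp_continuous_within)
  qed
next
  case (Suc k)
  show ?case
    unfolding k_times_differentiable_on.simps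
  proof (intro conjI ballI allI)
    fix x assume "x \<in> S"
    then show "f differentiable (at x)"
      using Suc.prems by force
  next
    fix v
    show "k_times_differentiable_on k S (\<lambda>x. frechet_derivative f (at x) v)"
    proof (rule Suc.IH)
      fix x assume "x \<in> S"
      then show "\<exists>T. open T \<and> x \<in> T \<and> k_times_differentiable_on k T (\<lambda>x. frechet_derivative f (at x) v)"
        using Suc.prems[of x] by auto
    qed
  qed
qed

lemma Ck_on_Suc_imp: "k_times_differentiable_on (Suc k) S f \<Longrightarrow> k_times_differentiable_on k S f"
proof (induction k arbitrary: f)
  case 0
  then show ?case
    by (auto intro!: differentiable_imp_continuous_within continuous_at_imp_continuous_on)
next
  case (Suc k)
  then show ?case by (metis k_times_differentiable_on.simps(2))
qed

text \<open>Frechet derivatives that are given by a formula are as good as \<open>frechet_derivative\<close>. All closure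
  properties below are inductions on \<open>k\<close> with this rule as the step.\<close>

lemma Ck_on_SucI:
  assumes "open S" "\<And>x. x \<in> S \<Longrightarrow> (f has_derivative f' x) (at x)"
    "\<And>v. k_times_differentiable_on k S (\<lambda>x. f' x v)"
  shows "k_times_differentiable_on (Suc k) S f"
proof -
  have "frechet_derivative f (at x) = f' x" if "x \<in> S" for x
    using frechet_derivative_at[OF assms(2)[OF that]] by simp
  then show ?thesis
    using assms by (auto simp: differentiable_def intro!: Ck_on_cong[OF assms(1) _ assms(3)])
qed

lemma Ck_on_const: "k_times_differentiable_on k S (\<lambda>x. c)"
  by (induction k arbitrary: c) (auto)

lemma Ck_on_linear:
  assumes "open S" "bounded_linear f"
  shows "k_times_differentiable_on k S f"
proof (cases k)
  case 0
  then show ?thesis using assms by (simp add: linear_continuous_on)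
next
  case (Suc j)
  show ?thesis
    unfolding Suc
    by (rule Ck_on_SucI[OF assms(1) bounded_linear_imp_has_derivative[OF assms(2)] Ck_on_const])
qed

lemma Ck_on_add:
  assumes "open S" "k_times_differentiable_on k S f" "k_times_differentiable_on k S g"
  shows "k_times_differentiable_on k S (\<lambda>x. f x + g x)"
  using assms(2,3)
proof (induction k arbitrary: f g)
  case (Suc k)
  show ?case
  proof (rule Ck_on_SucI[OF assms(1)])
    fix x assume "x \<in> S"
    then show "((\<lambda>x. f x + g x) has_derivative
        (\<lambda>v. frechet_derivative f (at x) v + frechet_derivative g (at x) v)) (at x)"
      using Suc.prems by (intro has_derivative_add) (auto simp: frechet_derivative_works)
  qed (use Suc in auto)
qed (auto intro: continuous_intros)

lemma Ck_on_linear_comp: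
  assumes "open S" "bounded_linear L" "k_times_differentiable_on k S f"
  shows "k_times_differentiable_on k S (\<lambda>x. L (f x))"
  using assms(3)
proof (induction k arbitrary: f)
  case 0
  then show ?case by (auto intro: bounded_linear.continuous_on[OF assms(2)])
next
  case (Suc k)
  show ?case
  proof (rule Ck_on_SucI[OF assms(1)])
    fix x assume "x \<in> S"
    then show "((\<lambda>x. L (f x)) has_derivative (\<lambda>v. L (frechet_derivative f (at x) v))) (at x)"
      using Suc.prems by (intro bounded_linear.has_derivative[OF assms(2)]) (auto simp: frechet_derivative_works)
  qed (use Suc in auto)
qed

lemma Ck_on_sum:
  assumes "open S" "\<And>i. i \<in> I \<Longrightarrow> k_times_differentiable_on k S (f i)"
  shows "k_times_differentiable_on k S (\<lambda>x. \<Sum>i\<in>I. f i x)"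
  using assms(2)
  by (induction I rule: infinite_finite_induct) (auto intro: Ck_on_const Ck_on_add[OF assms(1)])

lemma Ck_on_scaleR:
  assumes "open S" "k_times_differentiable_on k S f" "k_times_differentiable_on k S g"
  shows "k_times_differentiable_on k S (\<lambda>x. f x *\<^sub>R g x)"
  using assms(2,3)
proof (induction k arbitrary: f g)
  case (Suc k)
  show ?case
  proof (rule Ck_on_SucI[OF assms(1)])
    fix x assume "x \<in> S"
    then show "((\<lambda>x. f x *\<^sub>R g x) has_derivative (\<lambda>v. f x *\<^sub>R frechet_derivative g (at x) v
          + frechet_derivative f (at x) v *\<^sub>R g x)) (at x)"
      using Suc.prems by (intro has_derivative_scaleR) (auto simp: frechet_derivative_works)
  next
    fix v
    have "k_times_differentiable_on k S f" "k_times_differentiable_on k S g"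
      using Suc.prems Ck_on_Suc_imp by blast+
    moreover have "k_times_differentiable_on k S (\<lambda>x. frechet_derivative f (at x) v)"
      "k_times_differentiable_on k S (\<lambda>x. frechet_derivative g (at x) v)"
      using Suc.prems by auto
    ultimately show "k_times_differentiable_on k S (\<lambda>x. f x *\<^sub>R frechet_derivative g (at x) v
          + frechet_derivative f (at x) v *\<^sub>R g x)"
      by (intro Ck_on_add[OF assms(1)] Suc.IH)
  qed
qed (auto intro: continuous_intros)

text \<open>Only directional derivatives are known to be of class C^k, so the chain rule is
  expanded over the basis of the intermediate space into a sum of products.\<close>

lemma Ck_on_compose:
  fixes f :: "'a::real_normed_vector \<Rightarrow> 'b::euclidean_space"
  assumes "open S" "open T" "f ` S \<subseteq> T" "k_times_differentiable_on k S f" "k_times_differentiable_on k T g"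
  shows "k_times_differentiable_on k S (\<lambda>x. g (f x))"
  using assms(4,5)
proof (induction k arbitrary: g)
  case 0
  then show ?case using assms(3) by (auto intro: continuous_on_compose2)
next
  case (Suc k)
  let ?f' = "\<lambda>x. frechet_derivative f (at x)" and ?g' = "\<lambda>x. frechet_derivative g (at x)"
  have f: "(f has_derivative ?f' x) (at x)" if "x \<in> S" for x
    using Suc.prems that by (auto simp: frechet_derivative_works)
  have g: "(g has_derivative ?g' (f x)) (at (f x))" if "x \<in> S" for x
    using Suc.prems that assms(3) by (auto simp: frechet_derivative_works)
  have lin: "?g' (f x) w = (\<Sum>b\<in>Basis. (w \<bullet> b) *\<^sub>R ?g' (f x) b)" if "x \<in> S" for x w
  proof -
    have "linear (?g' (f x))" using g[OF that] has_derivative_linear by blast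
    then have "?g' (f x) (\<Sum>b\<in>Basis. (w \<bullet> b) *\<^sub>R b) = (\<Sum>b\<in>Basis. (w \<bullet> b) *\<^sub>R ?g' (f x) b)"
      by (simp add: linear_sum linear_cmul)
    then show ?thesis by (simp add: euclidean_representation)
  qed
  show ?case
  proof (rule Ck_on_SucI[OF assms(1)])
    fix x assume x: "x \<in> S"
    show "((\<lambda>x. g (f x)) has_derivative (\<lambda>v. \<Sum>b\<in>Basis. (?f' x v \<bullet> b) *\<^sub>R ?g' (f x) b)) (at x)"
      using diff_chain_at[OF f[OF x] g[OF x]] unfolding o_def by (subst (asm) lin[OF x])
  next
    fix v
    have "k_times_differentiable_on k S (\<lambda>x. ?g' (f x) b)" for b
      by (rule Suc.IH) (use Suc.prems Ck_on_Suc_imp in auto)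
    moreover have "k_times_differentiable_on k S (\<lambda>x. ?f' x v \<bullet> b)" for b
      using Suc.prems by (auto intro: Ck_on_linear_comp[OF assms(1) bounded_linear_inner_left])
    ultimately show "k_times_differentiable_on k S (\<lambda>x. \<Sum>b\<in>Basis. (?f' x v \<bullet> b) *\<^sub>R ?g' (f x) b)"
      by (intro Ck_on_sum Ck_on_scaleR assms(1))
  qed
qed

lemma smooth_onI: "(\<And>k. k_times_differentiable_on k S f) \<Longrightarrow> smooth_on S f"
  by (simp add: smooth_on_def)

lemma smooth_onD: "smooth_on S f \<Longrightarrow> k_times_differentiable_on k S f"
  by (simp add: smooth_on_def)

lemma smooth_on_cong:
  "open S \<Longrightarrow> (\<And>x. x \<in> S \<Longrightarrow> f x = g x) \<Longrightarrow> smooth_on S f \<Longrightarrow> smooth_on S g"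
  unfolding smooth_on_def using Ck_on_cong by blast

lemma smooth_on_subset: "smooth_on S f \<Longrightarrow> T \<subseteq> S \<Longrightarrow> smooth_on T f"
  unfolding smooth_on_def using Ck_on_subset by blast

lemma smooth_on_local:
  "(\<And>x. x \<in> S \<Longrightarrow> \<exists>T. open T \<and> x \<in> T \<and> smooth_on T f) \<Longrightarrow> smooth_on S f"
  unfolding smooth_on_def by (intro allI Ck_on_local) meson

lemma smooth_on_differentiable: "smooth_on S f \<Longrightarrow> x \<in> S \<Longrightarrow> f differentiable (at x)"
  unfolding smooth_on_def by (metis k_times_differentiable_on.simps(2))

lemma smooth_on_has_derivative:
  "smooth_on S f \<Longrightarrow> x \<in> S \<Longrightarrow> (f has_derivative frechet_derivative f (at x)) (at x)"
  using smooth_on_differentiable frechet_derivative_works by blast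

lemma smooth_on_derivative: "smooth_on S f \<Longrightarrow> smooth_on S (\<lambda>x. frechet_derivative f (at x) v)"
  unfolding smooth_on_def by (metis k_times_differentiable_on.simps(2))

lemma smooth_on_continuous: "smooth_on S f \<Longrightarrow> continuous_on S f"
  unfolding smooth_on_def by (metis k_times_differentiable_on.simps(1))

lemma smooth_on_const: "smooth_on S (\<lambda>x. c)"
  by (auto intro: smooth_onI Ck_on_const)

lemma smooth_on_linear: "open S \<Longrightarrow> bounded_linear f \<Longrightarrow> smooth_on S f"
  by (auto intro: smooth_onI Ck_on_linear)

lemma smooth_on_ident: "open S \<Longrightarrow> smooth_on S (\<lambda>x. x)"
  by (rule smooth_on_linear) (auto intro: bounded_linear_ident)

lemma smooth_on_linear_comp:
  "open S \<Longrightarrow> bounded_linear L \<Longrightarrow> smooth_on S f \<Longrightarrow> smooth_on S (\<lambda>x. L (f x))"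
  unfolding smooth_on_def by (auto intro: Ck_on_linear_comp)

lemma smooth_on_add:
  "open S \<Longrightarrow> smooth_on S f \<Longrightarrow> smooth_on S g \<Longrightarrow> smooth_on S (\<lambda>x. f x + g x)"
  unfolding smooth_on_def by (auto intro: Ck_on_add)

lemma smooth_on_scaleR:
  "open S \<Longrightarrow> smooth_on S f \<Longrightarrow> smooth_on S g \<Longrightarrow> smooth_on S (\<lambda>x. f x *\<^sub>R g x)"
  unfolding smooth_on_def by (auto intro: Ck_on_scaleR)

lemma smooth_on_mult:
  fixes f g :: "_ \<Rightarrow> real"
  shows "open S \<Longrightarrow> smooth_on S f \<Longrightarrow> smooth_on S g \<Longrightarrow> smooth_on S (\<lambda>x. f x * g x)"
  using smooth_on_scaleR[of S f g] by simp

lemma smooth_on_diff: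
  assumes "open S" "smooth_on S f" "smooth_on S g"
  shows "smooth_on S (\<lambda>x. f x - g x)"
  using smooth_on_add[OF assms(1,2) smooth_on_linear_comp[OF assms(1) bounded_linear_minus[OF bounded_linear_ident] assms(3)]]
  by simp

lemma smooth_on_sum:
  "open S \<Longrightarrow> (\<And>i. i \<in> I \<Longrightarrow> smooth_on S (f i)) \<Longrightarrow> smooth_on S (\<lambda>x. \<Sum>i\<in>I. f i x)"
  unfolding smooth_on_def by (auto intro: Ck_on_sum)

lemma smooth_on_compose:
  fixes f :: "'a::real_normed_vector \<Rightarrow> 'b::euclidean_space"
  shows "open S \<Longrightarrow> open T \<Longrightarrow> f ` S \<subseteq> T \<Longrightarrow> smooth_on S f \<Longrightarrow> smooth_on T g
    \<Longrightarrow> smooth_on S (\<lambda>x. g (f x))"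
  unfolding smooth_on_def by (auto intro: Ck_on_compose[of S T])

lemma Ck_on_inverse: "k_times_differentiable_on k (- {0}) (inverse :: real \<Rightarrow> real)"
proof (induction k)
  case (Suc k)
  show ?case
  proof (rule Ck_on_SucI)
    fix x :: real assume "x \<in> - {0}"
    then show "(inverse has_derivative (\<lambda>v. v *\<^sub>R ((- inverse x) *\<^sub>R inverse x))) (at x)"
      by (auto intro!: derivative_eq_intros simp: fun_eq_iff)
  next
    fix v :: real
    show "k_times_differentiable_on k (- {0}) (\<lambda>x. v *\<^sub>R ((- inverse x) *\<^sub>R inverse (x::real)))"
      by (intro Ck_on_scaleR Ck_on_const Ck_on_linear_comp[OF _ bounded_linear_minus[OF bounded_linear_ident]] Suc) auto
  qed auto
qed (auto intro: continuous_intros)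

lemma smooth_on_divide:
  fixes f g :: "'a::real_normed_vector \<Rightarrow> real"
  assumes "open S" "smooth_on S f" "smooth_on S g" "\<And>x. x \<in> S \<Longrightarrow> g x \<noteq> 0"
  shows "smooth_on S (\<lambda>x. f x / g x)"
  unfolding divide_inverse
  by (intro smooth_on_mult assms(1,2) smooth_on_compose[OF assms(1) _ _ assms(3) smooth_onI[OF Ck_on_inverse]])
    (use assms(4) in auto)

text \<open>Linear combinations of sine and cosine are closed under differentiation, whence the
  induction with arbitrary coefficients.\<close>

lemma Ck_on_sin_cos:
  "k_times_differentiable_on k UNIV (\<lambda>x. a * sin x + b * cos (x::real))"
proof (induction k arbitrary: a b)
  case (Suc k)
  show ?case
  proof (rule Ck_on_SucI)
    fix x :: real
    show "((\<lambda>x. a * sin x + b * cos x) has_derivative (\<lambda>v. (- (v * b)) * sin x + (v * a) * cos x)) (at x)"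
      by (auto intro!: derivative_eq_intros simp: fun_eq_iff algebra_simps)
  next
    fix v
    show "k_times_differentiable_on k UNIV (\<lambda>x. (- (v * b)) * sin x + (v * a) * cos (x::real))"
      by (rule Suc)
  qed auto
qed (auto intro!: continuous_intros)

lemma smooth_on_sin: "smooth_on UNIV (sin :: real \<Rightarrow> real)"
  and smooth_on_cos: "smooth_on UNIV (cos :: real \<Rightarrow> real)"
  using smooth_onI[OF Ck_on_sin_cos[of _ 1 0]] smooth_onI[OF Ck_on_sin_cos[of _ 0 1]] by auto

section \<open>A smooth cutoff\<close>

text \<open>The functions \<open>x\<^sup>-\<^sup>m exp (-1/x)\<close>, extended by zero to \<open>x \<le> 0\<close>. The derivative of each of them is a
  linear combination of the next two, so that they can all be shown to be smooth by one induction.\<close>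

definition flat_exp :: "nat \<Rightarrow> real \<Rightarrow> real" where
  "flat_exp m x = (if x > 0 then (1 / x) ^ m * exp (- (1 / x)) else 0)"

lemma flat_exp_tendsto_0: "(flat_exp m \<longlongrightarrow> 0) (at 0)"
proof (rule filterlim_split_at)
  show "(flat_exp m \<longlongrightarrow> 0) (at_left 0)"
    by (rule tendsto_eventually) (auto simp: flat_exp_def eventually_at_filter)
  have "((\<lambda>x. inverse x ^ m / exp (inverse x)) \<longlongrightarrow> 0) (at_right (0::real))"
    by (rule filterlim_compose[OF tendsto_power_div_exp_0 filterlim_inverse_at_top_right])
  moreover have "eventually (\<lambda>x. inverse x ^ m / exp (inverse x) = flat_exp m x) (at_right (0::real))"
    by (auto simp: flat_exp_def eventually_at_filter exp_minus field_simps)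
  ultimately show "(flat_exp m \<longlongrightarrow> 0) (at_right 0)"
    by (rule Lim_transform_eventually)
qed

lemma flat_exp_has_derivative:
  "(flat_exp m has_real_derivative flat_exp (m + 2) x - m * flat_exp (m + 1) x) (at x)"
proof -
  consider "x < 0" | "x = 0" | "x > 0" by linarith
  then show ?thesis
  proof cases
    case 1
    show ?thesis
      by (rule has_field_derivative_transform_within[of "\<lambda>_. 0", where d = "-x"])
        (use 1 in \<open>auto simp: flat_exp_def dist_real_def\<close>)
  next
    case 2
    have "((\<lambda>h. (flat_exp m (0 + h) - flat_exp m 0) / h) \<longlongrightarrow> 0) (at 0)"
      by (rule Lim_transform_eventually[OF flat_exp_tendsto_0[of "Suc m"]])
        (auto simp: flat_exp_def eventually_at_filter)
    then show ?thesis using 2 by (simp add: DERIV_def flat_exp_def)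
  next
    case 3
    have "((\<lambda>x. (1 / x) ^ m * exp (- (1 / x))) has_real_derivative
        flat_exp (m + 2) x - m * flat_exp (m + 1) x) (at x)"
    proof -
      define u where "u = 1 / x"
      have "((\<lambda>x. 1 / x) has_real_derivative - (u * u)) (at x)"
        using 3 by (auto intro!: derivative_eq_intros simp: u_def)
      moreover have "((\<lambda>u. u ^ m * exp (- u)) has_real_derivative
          m * u ^ (m - 1) * exp (- u) - u ^ m * exp (- u)) (at (1 / x))"
        unfolding u_def[symmetric] by (auto intro!: derivative_eq_intros)
      ultimately have "((\<lambda>x. (1 / x) ^ m * exp (- (1 / x))) has_real_derivative
          (m * u ^ (m - 1) * exp (- u) - u ^ m * exp (- u)) * - (u * u)) (at x)"
        using DERIV_chain2[where f = "\<lambda>u. u ^ m * exp (- u)" and g = "\<lambda>x. 1 / x"] by blast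
      moreover have "(m * u ^ (m - 1) * exp (- u) - u ^ m * exp (- u)) * - (u * u)
          = u ^ (m + 2) * exp (- u) - m * (u ^ (m + 1) * exp (- u))"
        by (cases m) (simp_all add: algebra_simps)
      ultimately show ?thesis using 3 by (simp add: flat_exp_def u_def)
    qed
    then show ?thesis using 3
      by (rule has_field_derivative_transform_within[where d = x]) (auto simp: flat_exp_def dist_real_def)
  qed
qed

lemma Ck_on_flat_exp: "k_times_differentiable_on k UNIV (flat_exp m)"
proof (induction k arbitrary: m)
  case 0
  show ?case
    unfolding k_times_differentiable_on.simps
    by (intro continuous_at_imp_continuous_on ballI DERIV_isCont[OF flat_exp_has_derivative])
next
  case (Suc k)
  show ?case
  proof (rule Ck_on_SucI)
    fix x
    show "(flat_exp m has_derivative (\<lambda>v. v *\<^sub>R (flat_exp (m + 2) x + (- real m) *\<^sub>R flat_exp (m + 1) x))) (at x)"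
      by (rule has_derivative_eq_rhs[OF flat_exp_has_derivative[of m x, unfolded has_field_derivative_def]])
        (simp add: fun_eq_iff algebra_simps)
  next
    fix v
    show "k_times_differentiable_on k UNIV
        (\<lambda>x. v *\<^sub>R (flat_exp (m + 2) x + (- real m) *\<^sub>R flat_exp (m + 1) x))"
      by (intro Ck_on_scaleR Ck_on_const Ck_on_add Suc) auto
  qed auto
qed

lemma smooth_cutoff:
  assumes "s0 < (R::real)"
  obtains \<theta> :: "real \<Rightarrow> real" where "smooth_on UNIV \<theta>" "\<theta> s0 = a" "\<And>s. s \<ge> R \<Longrightarrow> \<theta> s = 0"
proof
  let ?t = "\<lambda>s. (a / flat_exp 0 (R - s0)) * flat_exp 0 (R - s)"
  show "smooth_on UNIV ?t"
    by (intro smooth_on_mult smooth_on_const smooth_on_compose[OF _ _ _ _ smooth_onI[OF Ck_on_flat_exp], of UNIV]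
        smooth_on_diff smooth_on_ident) auto
  show "?t s0 = a" "\<And>s. s \<ge> R \<Longrightarrow> ?t s = 0"
    using assms by (auto simp: flat_exp_def)
qed

section \<open>Alternating forms on a Euclidean space\<close>

definition alternating :: "nat \<Rightarrow> ('e::real_vector list \<Rightarrow> real) \<Rightarrow> bool" where
  "alternating k \<omega> \<longleftrightarrow>
     (\<forall>us i v w a b. length us = k \<and> i < k \<longrightarrow>
        \<omega> (us[i := a *\<^sub>R v + b *\<^sub>R w]) = a * \<omega> (us[i := v]) + b * \<omega> (us[i := w])) \<and>
     (\<forall>us i j. length us = k \<and> i < j \<and> j < k \<and> us ! i = us ! j \<longrightarrow> \<omega> us = 0)"

lemma alternating_linear:
  assumes "alternating k \<omega>" "length us = k" "i < k"
  shows "\<omega> (us[i := a *\<^sub>R v + b *\<^sub>R w]) = a * \<omega> (us[i := v]) + b * \<omega> (us[i := w])"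
  using assms unfolding alternating_def by blast

lemma alternating_add:
  assumes "alternating k \<omega>" "length us = k" "i < k"
  shows "\<omega> (us[i := v + w]) = \<omega> (us[i := v]) + \<omega> (us[i := w])"
  using alternating_linear[OF assms, of 1 v 1 w] by simp

lemma alternating_scale:
  assumes "alternating k \<omega>" "length us = k" "i < k"
  shows "\<omega> (us[i := a *\<^sub>R v]) = a * \<omega> (us[i := v])"
  using alternating_linear[OF assms, of a v 0 v] by simp

lemma alternating_repeated:
  assumes "alternating k \<omega>" "length us = k" "i \<noteq> j" "i < k" "j < k" "us ! i = us ! j"
  shows "\<omega> us = 0"
  using assms unfolding alternating_def by (metis linorder_neqE_nat)

lemma alternating_sum:
  assumes "alternating k \<omega>" "length us = k" "i < k" "finite J"
  shows "\<omega> (us[i := \<Sum>j\<in>J. c j *\<^sub>R v j]) = (\<Sum>j\<in>J. c j * \<omega> (us[i := v j]))"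
  using assms(4)
proof induction
  case empty
  show ?case using alternating_scale[OF assms(1-3), of 0 0] by simp
next
  case (insert j J)
  then show ?case by (simp add: alternating_add[OF assms(1-3)] alternating_scale[OF assms(1-3)])
qed

lemma alternating_swap:
  assumes "alternating k \<omega>" "length us = k" "i \<noteq> j" "i < k" "j < k"
  shows "\<omega> (us[i := us ! j, j := us ! i]) = - \<omega> us"
proof -
  let ?s = "us ! i + us ! j"
  have len: "length (us[i := v]) = k" for v using assms by simp
  have self: "us[i := us ! i, j := us ! j] = us" by simp
  have "0 = \<omega> (us[i := ?s, j := ?s])"
    using assms by (intro alternating_repeated[OF assms(1) _ assms(3-5), symmetric]) auto
  also have "\<dots> = \<omega> (us[i := ?s, j := us ! i]) + \<omega> (us[i := ?s, j := us ! j])"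
    by (rule alternating_add[OF assms(1) len assms(5)])
  also have "\<omega> (us[i := ?s, j := us ! i]) = \<omega> (us[i := us ! j, j := us ! i])"
  proof -
    have "\<omega> (us[j := us ! i, i := us ! i]) = 0"
      by (rule alternating_repeated[OF assms(1) _ assms(3-5)]) (use assms in auto)
    moreover have "\<omega> (us[j := us ! i, i := ?s]) = \<omega> (us[j := us ! i, i := us ! i]) + \<omega> (us[j := us ! i, i := us ! j])"
      by (rule alternating_add[OF assms(1) _ assms(4)]) (simp add: assms)
    ultimately show ?thesis
      by (simp only: list_update_swap[OF assms(3)] add_0)
  qed
  also have "\<omega> (us[i := ?s, j := us ! j]) = \<omega> us"
  proof -
    have "\<omega> (us[j := us ! j, i := us ! j]) = 0"
      by (rule alternating_repeated[OF assms(1) _ assms(3-5)]) (use assms in auto)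
    moreover have "\<omega> (us[j := us ! j, i := ?s]) = \<omega> (us[j := us ! j, i := us ! i]) + \<omega> (us[j := us ! j, i := us ! j])"
      by (rule alternating_add[OF assms(1) _ assms(4)]) (simp add: assms)
    ultimately show ?thesis
      using self by (simp only: list_update_swap[OF assms(3)] add_0_right)
  qed
  finally show ?thesis by simp
qed

text \<open>Expanding the arguments one after the other in the standard basis keeps some
  term nonzero.\<close>

lemma alternating_nonzero_on_axes:
  fixes \<omega> :: "'e::euclidean_space list \<Rightarrow> real"
  assumes "alternating k \<omega>" "length us = k" "\<omega> us \<noteq> 0"
  obtains bs where "length bs = k" "set bs \<subseteq> Basis" "distinct bs" "\<omega> bs \<noteq> 0"
proof -
  have "\<exists>bs. length bs = k \<and> (\<forall>i<m. bs ! i \<in> Basis) \<and> \<omega> bs \<noteq> 0" if "m \<le> k" for m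
    using that
  proof (induction m)
    case 0
    then show ?case using assms by auto
  next
    case (Suc m)
    then obtain bs where bs: "length bs = k" "\<forall>i<m. bs ! i \<in> Basis" "\<omega> bs \<noteq> 0" by auto
    have "\<omega> (bs[m := \<Sum>b\<in>Basis. (bs ! m \<bullet> b) *\<^sub>R b]) \<noteq> 0"
      using bs by (simp add: euclidean_representation)
    moreover have "\<omega> (bs[m := \<Sum>b\<in>Basis. (bs ! m \<bullet> b) *\<^sub>R b])
        = (\<Sum>b\<in>Basis. (bs ! m \<bullet> b) * \<omega> (bs[m := b]))" (is "_ = ?S")
      using Suc.prems by (intro alternating_sum[OF assms(1) bs(1)]) auto
    ultimately have "?S \<noteq> 0" by argo
    then obtain b where "b \<in> Basis" "(bs ! m \<bullet> b) * \<omega> (bs[m := b]) \<noteq> 0"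
      by (rule sum.not_neutral_contains_not_neutral)
    then have "b \<in> Basis" "\<omega> (bs[m := b]) \<noteq> 0" by auto
    then show ?case using bs Suc.prems
      by (intro exI[of _ "bs[m := b]"]) (auto simp: nth_list_update)
  qed
  from this[of k] obtain bs where bs: "length bs = k" "\<forall>i<k. bs ! i \<in> Basis" "\<omega> bs \<noteq> 0" by auto
  moreover have "distinct bs"
  proof -
    have False if "i < k" "j < k" "i \<noteq> j" "bs ! i = bs ! j" for i j
      using alternating_repeated[OF assms(1) bs(1) that(3,1,2,4)] bs(3) by simp
    then show ?thesis unfolding distinct_conv_nth bs(1) by blast
  qed
  moreover have "set bs \<subseteq> Basis" using bs by (auto simp: in_set_conv_nth)
  ultimately show ?thesis using that by blast
qed

lemma alternating_degree_le:
  fixes \<omega> :: "'e::euclidean_space list \<Rightarrow> real"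
  assumes "alternating k \<omega>" "length us = k" "\<omega> us \<noteq> 0"
  shows "k \<le> DIM('e)"
proof -
  obtain bs where bs: "length bs = k" "set bs \<subseteq> (Basis :: 'e set)" "distinct bs"
    by (rule alternating_nonzero_on_axes[OF assms])
  show ?thesis using card_mono[OF finite_Basis bs(2)] distinct_card[OF bs(3)] bs(1) by simp
qed

text \<open>The entries of \<open>cs\<close> are brought into place one position at a time, each by a
  transposition, which only changes the sign.\<close>

lemma alternating_nonzero_permuted:
  assumes "alternating k \<omega>" "length bs = k" "distinct bs" "\<omega> bs \<noteq> 0"
    and "distinct cs" "set cs = set bs"
  shows "\<omega> cs \<noteq> 0"
proof -
  have len: "length cs = k" using assms by (metis distinct_card)
  have "\<exists>l. distinct l \<and> set l = set bs \<and> take m l = take m cs \<and> \<omega> l \<noteq> 0" if "m \<le> k" for m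
    using that
  proof (induction m)
    case 0
    then show ?case using assms by auto
  next
    case (Suc m)
    then obtain l where l: "distinct l" "set l = set bs" "take m l = take m cs" "\<omega> l \<noteq> 0" by auto
    have ll: "length l = k" using l assms by (metis distinct_card)
    have "cs ! m \<in> set l" using l assms len Suc.prems by auto
    then obtain j where j: "j < k" "l ! j = cs ! m" using ll by (auto simp: in_set_conv_nth)
    have "\<not> j < m"
    proof
      assume "j < m"
      then have "cs ! j = cs ! m" using l(3) j by (metis nth_take)
      then show False using assms(5) \<open>j < m\<close> len j Suc.prems by (simp add: nth_eq_iff_index_eq)
    qed
    show ?case
    proof (cases "j = m")
      case True
      then show ?thesis using l j ll len Suc.prems
        by (intro exI[of _ l]) (simp add: take_Suc_conv_app_nth)
    next
      case False
      let ?l = "l[m := l ! j, j := l ! m]"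
      have "\<omega> ?l \<noteq> 0" using alternating_swap[OF assms(1) ll, of m j] False j Suc.prems l by simp
      moreover have "take (Suc m) ?l = take (Suc m) cs"
        using l j ll len Suc.prems False \<open>\<not> j < m\<close> by (simp add: take_Suc_conv_app_nth)
      moreover have "distinct ?l" "set ?l = set bs"
        using l(1,2) j(1) ll Suc.prems distinct_swap[of m l j] set_swap[of m l j] by simp_all
      ultimately show ?thesis by blast
    qed
  qed
  from this[of k] obtain l where l: "distinct l" "set l = set bs" "take k l = take k cs" "\<omega> l \<noteq> 0" by auto
  moreover have "length l = k" using l assms by (metis distinct_card)
  ultimately show ?thesis using len by simp
qed

lemma alternating_comp_linear:
  assumes "alternating k \<omega>" "linear A"
  shows "alternating k (\<lambda>us. \<omega> (map A us))"
  unfolding alternating_def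
proof (intro conjI allI impI)
  fix us :: "'b list" and i v w a b
  assume "length us = k \<and> i < k"
  then show "\<omega> (map A (us[i := a *\<^sub>R v + b *\<^sub>R w])) = a * \<omega> (map A (us[i := v])) + b * \<omega> (map A (us[i := w]))"
    by (simp add: map_update linear_add[OF assms(2)] linear_cmul[OF assms(2)] alternating_linear[OF assms(1)])
next
  fix us :: "'b list" and i j
  assume "length us = k \<and> i < j \<and> j < k \<and> us ! i = us ! j"
  then show "\<omega> (map A us) = 0"
    by (intro alternating_repeated[OF assms(1), of _ i j]) auto
qed

lemma alternating_combine:
  assumes "alternating k \<omega>" "alternating k \<eta>"
  shows "alternating k (\<lambda>us. a * \<omega> us + b * \<eta> us)"
  using assms unfolding alternating_def by (auto simp: algebra_simps)

text \<open>Forms of top degree are a one-dimensional space: the combination of \<open>\<omega>\<close> and \<open>\<eta>\<close>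
  that vanishes on one ordering of the axes vanishes on all of them, hence everywhere.\<close>

lemma top_form_scaled:
  fixes \<omega> \<eta> :: "'e::euclidean_space list \<Rightarrow> real"
  assumes "alternating DIM('e) \<omega>" "alternating DIM('e) \<eta>" "length us0 = DIM('e)" "\<omega> us0 \<noteq> 0"
  obtains \<mu> where "\<And>us. length us = DIM('e) \<Longrightarrow> \<eta> us = \<mu> * \<omega> us"
proof -
  obtain bs where bs: "length bs = DIM('e)" "set bs \<subseteq> (Basis :: 'e set)" "distinct bs" "\<omega> bs \<noteq> 0"
    by (rule alternating_nonzero_on_axes[OF assms(1,3,4)])
  let ?\<zeta> = "\<lambda>us. \<omega> bs * \<eta> us + (- \<eta> bs) * \<omega> us"
  have alt: "alternating DIM('e) ?\<zeta>"
    by (rule alternating_combine[OF assms(2,1)])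
  have "?\<zeta> us = 0" if us: "length us = DIM('e)" for us
  proof (rule ccontr)
    assume "?\<zeta> us \<noteq> 0"
    then obtain cs where cs: "length cs = DIM('e)" "set cs \<subseteq> (Basis :: 'e set)" "distinct cs" "?\<zeta> cs \<noteq> 0"
      using alternating_nonzero_on_axes[OF alt us] by blast
    have "set cs = Basis" "set bs = Basis"
      using card_subset_eq[OF finite_Basis cs(2)] card_subset_eq[OF finite_Basis bs(2)]
        distinct_card[OF cs(3)] distinct_card[OF bs(3)] cs(1) bs(1) by simp_all
    then have "?\<zeta> bs \<noteq> 0"
      by (intro alternating_nonzero_permuted[OF alt cs(1,3,4) bs(3)]) argo
    then show False by simp
  qed
  then show ?thesis using bs(4) by (intro that[of "\<eta> bs / \<omega> bs"]) (simp add: field_simps)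
qed

text \<open>For a nonzero form of top degree this says that \<open>\<mu>\<close> is the determinant of \<open>A\<close>.
  Determinants enter the proof in this form only, and they are computed by multiplicativity.\<close>

definition scales_form :: "('e::euclidean_space list \<Rightarrow> real) \<Rightarrow> ('e \<Rightarrow> 'e) \<Rightarrow> real \<Rightarrow> bool" where
  "scales_form \<omega> A \<mu> \<longleftrightarrow> (\<forall>us. length us = DIM('e) \<longrightarrow> \<omega> (map A us) = \<mu> * \<omega> us)"

lemma scales_form_compose:
  "scales_form \<omega> A \<mu> \<Longrightarrow> scales_form \<omega> B \<nu> \<Longrightarrow> scales_form \<omega> (\<lambda>v. A (B v)) (\<mu> * \<nu>)"
  unfolding scales_form_def
  by (auto simp: mult.assoc map_map[unfolded o_def, symmetric] simp del: map_map)

locale top_form =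
  fixes \<omega> :: "'e::euclidean_space list \<Rightarrow> real"
  assumes alt: "alternating DIM('e) \<omega>" and nonzero: "\<exists>us. length us = DIM('e) \<and> \<omega> us \<noteq> 0"
begin

lemma scales_ex: "linear A \<Longrightarrow> \<exists>\<mu>. scales_form \<omega> A \<mu>"
  unfolding scales_form_def using top_form_scaled[OF alt alternating_comp_linear[OF alt]] nonzero by metis

lemma scales_unique: "scales_form \<omega> A \<mu> \<Longrightarrow> scales_form \<omega> A \<nu> \<Longrightarrow> \<mu> = \<nu>"
  unfolding scales_form_def using nonzero by (metis mult_right_cancel)

lemma scales_id: "scales_form \<omega> (\<lambda>v. v) 1"
  unfolding scales_form_def by simp

text \<open>If \<open>D\<close> is the stretching by the factor \<open>2\<close> in the direction of \<open>b\<close>, then conjugation with \<open>D\<close>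
  turns the transvection \<open>T\<close> into \<open>T\<^sup>2\<close>. Hence the determinant \<open>\<tau>\<close> of \<open>T\<close> satisfies \<open>\<tau>\<^sup>2 = \<tau>\<close>, and it is
  not \<open>0\<close> because \<open>T\<close> is invertible.\<close>

lemma scales_transvection:
  assumes \<alpha>: "linear \<alpha>" and b: "\<alpha> b = 0"
  shows "scales_form \<omega> (\<lambda>v. v + \<alpha> v *\<^sub>R b) 1"
proof (cases "b = 0")
  case True
  then show ?thesis using scales_id by simp
next
  case False
  define \<beta> where "\<beta> v = (v \<bullet> b) / (b \<bullet> b)" for v
  define T where "T c v = v + (c * \<alpha> v) *\<^sub>R b" for c v
  define D where "D c v = v + (c * \<beta> v) *\<^sub>R b" for c v
  note lin = linear_add[OF \<alpha>] linear_cmul[OF \<alpha>]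
  have \<beta>: "\<beta> (v + c *\<^sub>R b) = \<beta> v + c" for v c
    using False by (simp add: \<beta>_def inner_add_left add_divide_distrib)
  have "linear (T c)" for c
    by (rule linearI) (auto simp: T_def lin algebra_simps)
  moreover have "linear (D c)" for c
    by (rule linearI) (auto simp: D_def \<beta>_def inner_add_left algebra_simps add_divide_distrib)
  ultimately obtain \<tau> \<tau>' \<delta> \<delta>' where s: "scales_form \<omega> (T 1) \<tau>" "scales_form \<omega> (T (-1)) \<tau>'"
      "scales_form \<omega> (D 1) \<delta>" "scales_form \<omega> (D (-1/2)) \<delta>'"
    using scales_ex by metis
  have "D 1 (D (-1/2) v) = v" for v
  proof -
    have "\<beta> (D (-1/2) v) = \<beta> v / 2" unfolding D_def \<beta> by simp
    then have "D 1 (D (-1/2) v) = v + ((- 1/2) * \<beta> v) *\<^sub>R b + (\<beta> v / 2) *\<^sub>R b"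
      by (simp add: D_def)
    also have "\<dots> = v + ((- 1/2) * \<beta> v + \<beta> v / 2) *\<^sub>R b"
      by (simp only: scaleR_left_distrib add.assoc)
    finally show ?thesis by simp
  qed
  then have 1: "\<delta> * \<delta>' = 1"
    using scales_form_compose[OF s(3,4)] scales_id scales_unique by simp
  have "T 1 (T (-1) v) = v" for v
    by (simp add: T_def lin linear_diff[OF \<alpha>] b)
  then have 2: "\<tau> * \<tau>' = 1"
    using scales_form_compose[OF s(1,2)] scales_id scales_unique by simp
  have "T 1 (T 1 v) = D 1 (T 1 (D (-1/2) v))" for v
  proof -
    have "T 1 (D (-1/2) v) = v + (\<alpha> v - \<beta> v / 2) *\<^sub>R b"
      by (simp add: T_def D_def lin linear_diff[OF \<alpha>] b algebra_simps)
    then have "D 1 (T 1 (D (-1/2) v)) = v + (\<alpha> v - \<beta> v / 2) *\<^sub>R b + (\<beta> v + (\<alpha> v - \<beta> v / 2)) *\<^sub>R b"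
      by (simp add: D_def[of 1] \<beta>)
    also have "\<dots> = v + ((\<alpha> v - \<beta> v / 2) + (\<beta> v + (\<alpha> v - \<beta> v / 2))) *\<^sub>R b"
      by (simp only: scaleR_left_distrib add.assoc)
    also have "\<dots> = v + (2 * \<alpha> v) *\<^sub>R b" by (simp add: algebra_simps)
    finally show ?thesis by (simp add: T_def lin b algebra_simps flip: scaleR_2)
  qed
  then have "(\<lambda>v. T 1 (T 1 v)) = (\<lambda>v. D 1 (T 1 (D (-1/2) v)))" by simp
  then have "\<tau> * \<tau> = \<delta> * (\<tau> * \<delta>')"
    using scales_form_compose[OF s(1,1)] scales_form_compose[OF s(3) scales_form_compose[OF s(1,4)]] scales_unique
    by metis
  also have "\<dots> = \<tau> * (\<delta> * \<delta>')" by (simp add: mult.left_commute)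
  finally have "\<tau> * \<tau> = \<tau>" using 1 by simp
  then have "\<tau> = 1" using 2 by auto
  then show ?thesis using s(1) by (simp add: T_def[abs_def])
qed

lemma scales_stretch:
  assumes e: "e \<in> Basis"
  shows "scales_form \<omega> (\<lambda>v. v + (c * (v \<bullet> e)) *\<^sub>R e) (1 + c)"
proof -
  let ?A = "\<lambda>v. v + (c * (v \<bullet> e)) *\<^sub>R e"
  have "linear ?A" by (rule linearI) (auto simp: inner_add_left algebra_simps)
  then obtain \<mu> where \<mu>: "scales_form \<omega> ?A \<mu>" using scales_ex by blast
  obtain us where "length us = DIM('e)" "\<omega> us \<noteq> 0" using nonzero by blast
  then obtain bs where bs: "length bs = DIM('e)" "set bs \<subseteq> (Basis :: 'e set)" "distinct bs" "\<omega> bs \<noteq> 0"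
    by (rule alternating_nonzero_on_axes[OF alt])
  have "set bs = Basis"
    using card_subset_eq[OF finite_Basis bs(2)] distinct_card[OF bs(3)] bs(1) by simp
  then obtain i where i: "i < DIM('e)" "bs ! i = e" using e bs(1) in_set_conv_nth[of e bs] by auto
  have "map ?A bs = bs[i := (1 + c) *\<^sub>R e]"
  proof (rule nth_equalityI)
    fix j assume "j < length (map ?A bs)"
    then have j: "j < DIM('e)" using bs by simp
    then have "bs ! j \<in> Basis" using bs by auto
    then show "map ?A bs ! j = bs[i := (1 + c) *\<^sub>R e] ! j"
      using j bs i e by (cases "j = i")
        (auto simp: inner_Basis nth_eq_iff_index_eq[symmetric] algebra_simps nth_list_update)
  qed simp
  then have "\<omega> (map ?A bs) = (1 + c) * \<omega> bs"
    using alternating_scale[OF alt bs(1) i(1), of "1 + c" e] i by (metis list_update_id)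
  then have "\<mu> = 1 + c" using \<mu> bs unfolding scales_form_def by (metis mult_right_cancel)
  then show ?thesis using \<mu> by simp
qed

text \<open>The map is a transvection along \<open>e\<close> followed by a stretching in the direction of \<open>e\<close>.\<close>

lemma scales_rank_one:
  assumes e: "e \<in> Basis" and \<alpha>: "linear \<alpha>" and c: "1 + \<alpha> e \<noteq> 0"
  shows "scales_form \<omega> (\<lambda>v. v + \<alpha> v *\<^sub>R e) (1 + \<alpha> e)"
proof -
  define c where "c = 1 + \<alpha> e"
  define \<gamma> where "\<gamma> v = (\<alpha> v - \<alpha> e * (v \<bullet> e)) / c" for v
  have [simp]: "c \<noteq> 0" using assms(3) by (simp add: c_def)
  have "linear \<gamma>"
    by (rule linearI) (auto simp: \<gamma>_def linear_add[OF \<alpha>] linear_cmul[OF \<alpha>] inner_add_left field_simps)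
  moreover have "\<gamma> e = 0" using e by (simp add: \<gamma>_def inner_Basis)
  ultimately have s: "scales_form \<omega> (\<lambda>v. v + \<gamma> v *\<^sub>R e) 1" by (rule scales_transvection)
  have "v + \<gamma> v *\<^sub>R e + (\<alpha> e * ((v + \<gamma> v *\<^sub>R e) \<bullet> e)) *\<^sub>R e = v + \<alpha> v *\<^sub>R e" for v
  proof -
    have "\<gamma> v + \<alpha> e * ((v + \<gamma> v *\<^sub>R e) \<bullet> e) = c * \<gamma> v + \<alpha> e * (v \<bullet> e)"
      using e by (simp add: inner_add_left inner_Basis c_def algebra_simps)
    also have "\<dots> = \<alpha> v" by (simp add: \<gamma>_def)
    finally show ?thesis by (metis add.assoc scaleR_left_distrib)
  qed
  then show ?thesis
    using scales_form_compose[OF scales_stretch[OF e, of "\<alpha> e"] s] by (simp only: mult_1_right)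
qed

end

definition plane_rotation :: "'e::euclidean_space \<Rightarrow> 'e \<Rightarrow> real \<Rightarrow> 'e \<Rightarrow> 'e" where
  "plane_rotation e1 e2 t w =
     w + (cos t * (w \<bullet> e1) - sin t * (w \<bullet> e2) - w \<bullet> e1) *\<^sub>R e1
       + (sin t * (w \<bullet> e1) + cos t * (w \<bullet> e2) - w \<bullet> e2) *\<^sub>R e2"

lemma plane_rotation_linear: "linear (plane_rotation e1 e2 t)"
  by (rule linearI) (auto simp: plane_rotation_def inner_add_left algebra_simps)

lemma plane_rotation_0 [simp]: "plane_rotation e1 e2 0 w = w"
  by (simp add: plane_rotation_def)

locale orthonormal_pair =
  fixes e1 e2 :: "'e::euclidean_space"
  assumes e11 [simp]: "e1 \<bullet> e1 = 1" and e22 [simp]: "e2 \<bullet> e2 = 1" and e12 [simp]: "e1 \<bullet> e2 = 0"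
begin

lemma e21 [simp]: "e2 \<bullet> e1 = 0" by (simp add: inner_commute[of e2 e1])

lemma plane_rotation_inner:
  "plane_rotation e1 e2 t w \<bullet> e1 = cos t * (w \<bullet> e1) - sin t * (w \<bullet> e2)"
  "plane_rotation e1 e2 t w \<bullet> e2 = sin t * (w \<bullet> e1) + cos t * (w \<bullet> e2)"
  by (simp_all add: plane_rotation_def inner_add_left)

lemma plane_rotation_add:
  "plane_rotation e1 e2 s (plane_rotation e1 e2 t w) = plane_rotation e1 e2 (s + t) w"
  unfolding plane_rotation_def[of e1 e2 s "plane_rotation e1 e2 t w"] plane_rotation_inner
  by (simp add: plane_rotation_def sin_add cos_add algebra_simps)

lemma plane_rotation_norm: "plane_rotation e1 e2 t w \<bullet> plane_rotation e1 e2 t w = w \<bullet> w"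
proof -
  define x y where "x = w \<bullet> e1" and "y = w \<bullet> e2"
  define p q where "p = cos t * x - sin t * y" and "q = sin t * x + cos t * y"
  have "p\<^sup>2 + q\<^sup>2 = (sin t ^ 2 + cos t ^ 2) * (x\<^sup>2 + y\<^sup>2)"
    unfolding p_def q_def by algebra
  then have pq: "p\<^sup>2 + q\<^sup>2 = x\<^sup>2 + y\<^sup>2" by simp
  have R: "plane_rotation e1 e2 t w = w + (p - x) *\<^sub>R e1 + (q - y) *\<^sub>R e2"
    by (simp add: plane_rotation_def p_def q_def x_def y_def)
  have "plane_rotation e1 e2 t w \<bullet> plane_rotation e1 e2 t w
      = w \<bullet> w + 2 * (p - x) * x + 2 * (q - y) * y + (p - x)\<^sup>2 + (q - y)\<^sup>2"
    unfolding R by (simp add: inner_add_left inner_add_right x_def y_def inner_commute[of e1 w]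
        inner_commute[of e2 w] power2_eq_square algebra_simps)
  also have "\<dots> = w \<bullet> w" using pq by (simp add: power2_eq_square algebra_simps)
  finally show ?thesis .
qed

lemma plane_rotation_pi: "plane_rotation e1 e2 pi (c *\<^sub>R e1) = - c *\<^sub>R e1"
proof -
  have "plane_rotation e1 e2 pi (c *\<^sub>R e1) = (c + (- c - c)) *\<^sub>R e1"
    unfolding scaleR_left_distrib by (simp add: plane_rotation_def)
  then show ?thesis by simp
qed

end

text \<open>The reflection \<open>S\<close> conjugates each rotation into its inverse, so the determinant of a
  rotation has square one. Applied to the rotation by half the angle, this gives the claim.\<close>

lemma (in top_form) scales_plane_rotation:
  assumes "orthonormal_pair e1 e2"
  shows "scales_form \<omega> (plane_rotation e1 e2 t) 1"
proof -
  interpret orthonormal_pair e1 e2 by fact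
  define S where "S v = v - (2 * (v \<bullet> e2)) *\<^sub>R e2" for v
  have "linear S" by (rule linearI) (auto simp: S_def inner_add_left algebra_simps)
  then obtain \<sigma> where \<sigma>: "scales_form \<omega> S \<sigma>" using scales_ex by blast
  have "S (S v) = v" for v
    by (simp add: S_def inner_diff_left flip: scaleR_left_distrib)
  then have \<sigma>\<sigma>: "\<sigma> * \<sigma> = 1"
    using scales_form_compose[OF \<sigma> \<sigma>] scales_id scales_unique by simp
  have square: "\<mu> * \<mu> = 1" if \<mu>: "scales_form \<omega> (plane_rotation e1 e2 s) \<mu>" for s \<mu>
  proof -
    have "S (plane_rotation e1 e2 s (S v)) = plane_rotation e1 e2 (-s) v" for v
    proof -
      define a b where "a = cos s * (v \<bullet> e1) + sin s * (v \<bullet> e2) - v \<bullet> e1"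
        and "b = sin s * (v \<bullet> e1) - cos s * (v \<bullet> e2) + v \<bullet> e2"
      have "S v \<bullet> e1 = v \<bullet> e1" and Sv: "S v \<bullet> e2 = - (v \<bullet> e2)"
        by (simp_all add: S_def inner_diff_left)
      then have R: "plane_rotation e1 e2 s (S v) = S v + a *\<^sub>R e1 + b *\<^sub>R e2"
        by (simp add: plane_rotation_def a_def b_def)
      have "S (plane_rotation e1 e2 s (S v)) = S v + a *\<^sub>R e1 + b *\<^sub>R e2 - (2 * (b - v \<bullet> e2)) *\<^sub>R e2"
        unfolding R S_def[of "S v + _ + _"] by (simp add: inner_add_left Sv)
      also have "\<dots> = v + a *\<^sub>R e1 + (b - 2 * (v \<bullet> e2) - 2 * (b - v \<bullet> e2)) *\<^sub>R e2"
        unfolding S_def scaleR_left_diff_distrib by (simp only: algebra_simps)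
      also have "\<dots> = v + a *\<^sub>R e1 + (- b) *\<^sub>R e2" by (simp add: algebra_simps)
      also have "\<dots> = plane_rotation e1 e2 (-s) v"
        unfolding plane_rotation_def a_def b_def
        by (intro arg_cong2[where f = "(+)"] arg_cong2[where f = "(*\<^sub>R)"] refl) simp_all
      finally show ?thesis .
    qed
    then have "scales_form \<omega> (plane_rotation e1 e2 (-s)) (\<sigma> * (\<mu> * \<sigma>))"
      using scales_form_compose[OF \<sigma> scales_form_compose[OF \<mu> \<sigma>]] by simp
    then have "scales_form \<omega> (\<lambda>v. plane_rotation e1 e2 (-s) (plane_rotation e1 e2 s v)) (\<sigma> * (\<mu> * \<sigma>) * \<mu>)"
      using scales_form_compose \<mu> by blast
    then have "\<sigma> * (\<mu> * \<sigma>) * \<mu> = 1"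
      using scales_id scales_unique by (simp add: plane_rotation_add)
    then show ?thesis using \<sigma>\<sigma> by (metis mult.assoc mult.commute mult_1)
  qed
  obtain \<mu> where \<mu>: "scales_form \<omega> (plane_rotation e1 e2 (t/2)) \<mu>"
    using scales_ex plane_rotation_linear by blast
  show ?thesis
    using scales_form_compose[OF \<mu> \<mu>] square[OF \<mu>] by (simp add: plane_rotation_add eta_contract_eq)
qed

text \<open>The sum is \<open>a \<and> \<omega>\<close> on \<open>us\<close>, where the vector \<open>a\<close> stands for the covector \<open>v \<mapsto> a \<bullet> v\<close>. The
  vectors \<open>a\<close> that annihilate \<open>\<omega>\<close> in this sense form a subspace, which is proper when \<open>k < n\<close>: if \<open>\<omega>\<close> is not
  zero on certain \<open>k\<close> axes, then any further axis \<open>j\<close> has \<open>j \<and> \<omega> \<noteq> 0\<close>.\<close>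

lemma common_kernel_direction:
  fixes \<omega> :: "'e::euclidean_space list \<Rightarrow> real"
  assumes alt: "alternating k \<omega>" and us: "length us = k" "\<omega> us \<noteq> 0" and k: "k < DIM('e)"
  obtains v where "v \<noteq> 0"
    "\<And>a. (\<And>us. length us = Suc k \<Longrightarrow>
        (\<Sum>i<Suc k. (-1) ^ i * ((a \<bullet> us ! i) * \<omega> (take i us @ drop (Suc i) us))) = 0) \<Longrightarrow> a \<bullet> v = 0"
proof -
  let ?w = "\<lambda>a us. \<Sum>i<Suc k. (-1) ^ i * ((a \<bullet> us ! i) * \<omega> (take i us @ drop (Suc i) us))"
  define V where "V = {a. \<forall>us. length us = Suc k \<longrightarrow> ?w a us = 0}"
  have add: "?w (a + b) us = ?w a us + ?w b us" for a b us
    unfolding sum.distrib[symmetric] by (rule sum.cong) (auto simp: inner_add_left algebra_simps)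
  have cm: "?w (c *\<^sub>R a) us = c * ?w a us" for a c us
    unfolding sum_distrib_left by (rule sum.cong) (auto simp: algebra_simps)
  have sub: "subspace V"
    unfolding subspace_def V_def mem_Collect_eq add cm by simp
  obtain bs where bs: "length bs = k" "set bs \<subseteq> (Basis :: 'e set)" "distinct bs" "\<omega> bs \<noteq> 0"
    by (rule alternating_nonzero_on_axes[OF alt us])
  have "card (set bs) = k" using bs by (simp add: distinct_card)
  then obtain j where j: "j \<in> Basis" "j \<notin> set bs"
    using k by (metis List.finite_set card_mono not_less subsetI)
  have "?w j (j # bs) = \<omega> bs"
  proof -
    have "bs ! i \<noteq> j" "bs ! i \<in> Basis" if "i < k" for i using that bs j by auto
    then have "(\<Sum>i<k. (-1) ^ Suc i * ((j \<bullet> (j # bs) ! Suc i) * \<omega> (take (Suc i) (j # bs) @ drop (Suc (Suc i)) (j # bs)))) = 0"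
      using j by (intro sum.neutral) (auto simp: inner_Basis)
    then show ?thesis using j bs by (subst sum.lessThan_Suc_shift) (simp add: inner_Basis)
  qed
  then have "j \<notin> V" using bs unfolding V_def by (auto intro!: exI[of _ "j # bs"] simp del: sum.lessThan_Suc)
  then have "span V \<noteq> UNIV" using sub by (metis UNIV_I span_eq_iff)
  then have "dim V < DIM('e)"
    using dim_eq_full[of V] dim_subset_UNIV[of V] by linarith
  then obtain v where v: "v \<noteq> 0" "\<And>y. y \<in> span V \<Longrightarrow> orthogonal v y"
    using orthogonal_to_subspace_exists by metis
  show ?thesis
  proof (rule that[OF v(1)])
    fix a
    assume "\<And>us. length us = Suc k \<Longrightarrow> ?w a us = 0"
    then have "a \<in> V" unfolding V_def by blast
    then show "a \<bullet> v = 0" using v(2) span_base unfolding orthogonal_def by (metis inner_commute)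
  qed
qed

section \<open>Closed forms that dilations rescale\<close>

text \<open>Uniqueness for the linear equation \<open>t W' = h W\<close>. It is singular at \<open>0\<close>, so the zero at \<open>1\<close> is
  first carried to all \<open>t\<close> in \<open>(0,1]\<close>, where \<open>h s / s\<close> is bounded on \<open>[t,1]\<close>, and then to \<open>0\<close>
  by continuity.\<close>

lemma zero_along_ray:
  fixes W W' h :: "real \<Rightarrow> real"
  assumes d: "\<And>t. (W has_real_derivative W' t) (at t)"
    and ode: "\<And>t. t * W' t = h t * W t"
    and h: "continuous_on UNIV h" and W1: "W 1 = 0"
  shows "W 0 = 0"
proof -
  have zero: "W t = 0" if t: "0 < t" "t \<le> 1" for t
  proof -
    have "continuous_on {t..1} (\<lambda>s. h s / s)"
      by (rule continuous_on_divide[OF continuous_on_subset[OF h] continuous_on_id]) (use t in auto)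
    then have "bounded ((\<lambda>s. h s / s) ` {t..1})"
      by (intro compact_imp_bounded compact_continuous_image) auto
    then obtain C where "\<forall>x\<in>(\<lambda>s. h s / s) ` {t..1}. norm x \<le> C"
      unfolding bounded_iff by blast
    then have C: "\<bar>h s / s\<bar> \<le> C" if "s \<in> {t..1}" for s using that by auto
    \<comment> \<open>The exponential factor compensates a decay of \<open>W\<^sup>2\<close> at a rate of at most \<open>2 C\<close>.\<close>
    have "(W t)\<^sup>2 * exp (2 * C * t) \<le> (W 1)\<^sup>2 * exp (2 * C * 1)"
    proof (rule DERIV_nonneg_imp_nondecreasing[OF t(2)])
      fix s assume s: "t \<le> s" "s \<le> 1"
      have "W' s = (h s / s) * W s"
        using ode[of s] s t by (simp add: field_simps)
      then have eq: "2 * W s * W' s + 2 * C * (W s)\<^sup>2 = 2 * (h s / s + C) * (W s)\<^sup>2"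
        by (simp add: power2_eq_square algebra_simps)
      have "\<bar>h s / s\<bar> \<le> C" by (rule C) (use s in simp)
      then have "h s / s + C \<ge> 0" using abs_ge_minus_self[of "h s / s"] by linarith
      then have "0 \<le> (2 * W s * W' s + 2 * C * (W s)\<^sup>2) * exp (2 * C * s)"
        unfolding eq by simp
      moreover have "((\<lambda>s. (W s)\<^sup>2 * exp (2 * C * s)) has_real_derivative
          (2 * W s * W' s + 2 * C * (W s)\<^sup>2) * exp (2 * C * s)) (at s)"
        by (rule derivative_eq_intros d refl)+ (simp add: algebra_simps)
      ultimately show "\<exists>y. ((\<lambda>s. (W s)\<^sup>2 * exp (2 * C * s)) has_real_derivative y) (at s) \<and> 0 \<le> y"
        by blast
    qed
    then have "(W t)\<^sup>2 * exp (2 * C * t) \<le> 0" using W1 by simp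
    then show ?thesis by (simp add: mult_le_0_iff)
  qed
  have "continuous_on UNIV W" using d DERIV_isCont continuous_at_imp_continuous_on by metis
  then have "continuous_on (closure {0<..1}) W" by (rule continuous_on_subset) simp
  then show ?thesis
    by (rule continuous_constant_on_closure[where S = "{0<..1}"]) (use zero in auto)
qed

text \<open>The hypothesis \<open>lie\<close> is the equation \<open>L(\<Delta>)\<omega> = F \<omega>\<close> for the dilation field. Two coefficients of \<open>\<omega>\<close>
  satisfy the same linear equation along the ray through \<open>y\<close>, so the combination of them that vanishes at \<open>y\<close>
  vanishes at \<open>0\<close>, too.\<close>

lemma dilation_ray_proportional:
  fixes \<omega> :: "'e::euclidean_space \<Rightarrow> 'e list \<Rightarrow> real"
  assumes smooth: "\<And>us. length us = k \<Longrightarrow> smooth_on UNIV (\<lambda>y. \<omega> y us)"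
    and F: "continuous_on UNIV F"
    and lie: "\<And>y us. length us = k \<Longrightarrow>
       frechet_derivative (\<lambda>z. \<omega> z us) (at y) y + real k * \<omega> y us = F y * \<omega> y us"
    and len: "length us = k" "length us0 = k"
  shows "\<omega> 0 us * \<omega> y us0 = \<omega> y us * \<omega> 0 us0"
proof -
  define D where "D us t = frechet_derivative (\<lambda>z. \<omega> z us) (at (t *\<^sub>R y)) y" for us t
  have der: "((\<lambda>t. \<omega> (t *\<^sub>R y) us) has_real_derivative D us t) (at t)" if "length us = k" for us t
  proof -
    have 1: "((\<lambda>z. \<omega> z us) has_derivative frechet_derivative (\<lambda>z. \<omega> z us) (at (t *\<^sub>R y))) (at (t *\<^sub>R y))"
      by (rule smooth_on_has_derivative[OF smooth[OF that]]) simp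
    have 2: "((\<lambda>t. t *\<^sub>R y) has_derivative (\<lambda>s. s *\<^sub>R y)) (at t)"
      by (auto intro!: derivative_eq_intros)
    have "((\<lambda>t. \<omega> (t *\<^sub>R y) us) has_derivative
        (\<lambda>s. frechet_derivative (\<lambda>z. \<omega> z us) (at (t *\<^sub>R y)) (s *\<^sub>R y))) (at t)"
      using diff_chain_at[OF 2 1] by (simp add: o_def)
    moreover have "frechet_derivative (\<lambda>z. \<omega> z us) (at (t *\<^sub>R y)) (s *\<^sub>R y) = D us t * s" for s
      using linear_cmul[OF has_derivative_linear[OF 1]] by (simp add: D_def)
    ultimately show ?thesis by (simp add: has_field_derivative_def)
  qed
  have ode: "t * D us t = (F (t *\<^sub>R y) - k) * \<omega> (t *\<^sub>R y) us" if "length us = k" for us t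
  proof -
    have "linear (frechet_derivative (\<lambda>z. \<omega> z us) (at (t *\<^sub>R y)))"
      using smooth_on_has_derivative[OF smooth[OF that] UNIV_I] has_derivative_linear by blast
    then have "t * D us t = frechet_derivative (\<lambda>z. \<omega> z us) (at (t *\<^sub>R y)) (t *\<^sub>R y)"
      by (simp add: D_def linear_cmul)
    then show ?thesis using lie[OF that, of "t *\<^sub>R y"] by (simp add: algebra_simps)
  qed
  define W where "W t = \<omega> (t *\<^sub>R y) us * \<omega> y us0 - \<omega> y us * \<omega> (t *\<^sub>R y) us0" for t
  have "W 0 = 0"
  proof (rule zero_along_ray)
    show "(W has_real_derivative D us t * \<omega> y us0 - \<omega> y us * D us0 t) (at t)" for t
      unfolding W_def by (rule derivative_eq_intros der len refl)+ simp
    show "t * (D us t * \<omega> y us0 - \<omega> y us * D us0 t) = (F (t *\<^sub>R y) - k) * W t" for t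
    proof -
      have "t * (D us t * \<omega> y us0 - \<omega> y us * D us0 t) = (t * D us t) * \<omega> y us0 - \<omega> y us * (t * D us0 t)"
        by (simp add: algebra_simps)
      then show ?thesis unfolding ode[OF len(1)] ode[OF len(2)] by (simp add: W_def algebra_simps)
    qed
    show "continuous_on UNIV (\<lambda>t. F (t *\<^sub>R y) - k)"
      by (intro continuous_intros continuous_on_compose2[OF F]) auto
  qed (simp add: W_def)
  then show ?thesis by (simp add: W_def)
qed

text \<open>By the preceding lemma \<open>\<omega> = g \<omega>\<^sub>0\<close>, where \<open>\<omega>\<^sub>0\<close> is the value at \<open>0\<close>, and then \<open>\<omega>\<close> is closed iff
  \<open>dg \<and> \<omega>\<^sub>0 = 0\<close>. The common kernel vector \<open>v\<close> of all such covectors satisfies \<open>dg(v) = 0\<close>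
  everywhere. At a point \<open>s v\<close> the dilation field is parallel to \<open>v\<close>, hence it
  does not change \<open>g\<close>, and only the contribution \<open>k\<close> of the degree is left in \<open>F\<close>.\<close>

lemma factor_constant_on_line:
  fixes \<omega> :: "'e::euclidean_space \<Rightarrow> 'e list \<Rightarrow> real"
  assumes smooth: "\<And>us. length us = k \<Longrightarrow> smooth_on UNIV (\<lambda>y. \<omega> y us)"
    and alt: "alternating k (\<omega> 0)"
    and F: "continuous_on UNIV F"
    and lie: "\<And>y us. length us = k \<Longrightarrow>
       frechet_derivative (\<lambda>z. \<omega> z us) (at y) y + real k * \<omega> y us = F y * \<omega> y us"
    and closed: "\<And>y us. length us = Suc k \<Longrightarrow> euclidean_exterior_derivative \<omega> y us = 0"
    and nonzero: "\<And>y. \<exists>us. length us = k \<and> \<omega> y us \<noteq> 0"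
    and k: "k < DIM('e)"
  obtains v where "v \<noteq> 0" "\<And>s. F (s *\<^sub>R v) = k"
proof -
  obtain us0 where us0: "length us0 = k" "\<omega> 0 us0 \<noteq> 0" using nonzero by blast
  define g where "g y = \<omega> y us0 / \<omega> 0 us0" for y
  have g: "\<omega> y us = g y * \<omega> 0 us" if "length us = k" for y us
  proof -
    have "\<omega> 0 us * \<omega> y us0 = \<omega> y us * \<omega> 0 us0"
      by (rule dilation_ray_proportional[OF smooth F lie that us0(1)])
    then show ?thesis using us0(2) by (simp add: g_def field_simps)
  qed
  have g0: "g y \<noteq> 0" for y
  proof -
    obtain us where us: "length us = k" "\<omega> y us \<noteq> 0" using nonzero by blast
    show ?thesis using g[OF us(1), of y] us(2) by (metis mult_zero_left)
  qed
  define g' where "g' y = frechet_derivative g (at y)" for y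
  have "smooth_on UNIV (\<lambda>y. \<omega> y us0 * (1 / \<omega> 0 us0))"
    by (intro smooth_on_mult smooth us0 smooth_on_const) auto
  then have "smooth_on UNIV g" by (simp add: g_def[abs_def])
  then have Dg: "(g has_derivative g' y) (at y)" for y
    unfolding g'_def by (rule smooth_on_has_derivative) simp
  have D\<omega>: "frechet_derivative (\<lambda>z. \<omega> z us) (at y) = (\<lambda>u. g' y u * \<omega> 0 us)" if "length us = k" for y us
  proof -
    have "((\<lambda>z. g z * \<omega> 0 us) has_derivative (\<lambda>u. g' y u * \<omega> 0 us)) (at y)"
      by (intro has_derivative_mult_left Dg)
    moreover have "(\<lambda>z. g z * \<omega> 0 us) = (\<lambda>z. \<omega> z us)" by (intro ext) (rule g[OF that, symmetric])
    ultimately show ?thesis using frechet_derivative_at by metis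
  qed
  obtain v where v: "v \<noteq> 0" "\<And>a. (\<And>us. length us = Suc k \<Longrightarrow>
        (\<Sum>i<Suc k. (-1) ^ i * ((a \<bullet> us ! i) * \<omega> 0 (take i us @ drop (Suc i) us))) = 0) \<Longrightarrow> a \<bullet> v = 0"
    by (rule common_kernel_direction[OF alt us0 k]) blast
  have g'v: "g' y v = 0" for y
  proof -
    define a where "a = (\<Sum>b\<in>Basis. g' y b *\<^sub>R b)"
    have lin: "linear (g' y)" using Dg has_derivative_linear by blast
    have a: "a \<bullet> u = g' y u" for u
    proof -
      have "g' y u = g' y (\<Sum>b\<in>Basis. (u \<bullet> b) *\<^sub>R b)" by (simp add: euclidean_representation)
      also have "\<dots> = (\<Sum>b\<in>Basis. (u \<bullet> b) * g' y b)" by (simp add: linear_sum[OF lin] linear_cmul[OF lin])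
      finally show ?thesis by (simp add: a_def inner_sum_left inner_commute[of u] mult.commute)
    qed
    have "a \<bullet> v = 0"
    proof (rule v(2))
      fix us :: "'e list" assume us: "length us = Suc k"
      have "(\<Sum>i<Suc k. (-1) ^ i * ((a \<bullet> us ! i) * \<omega> 0 (take i us @ drop (Suc i) us)))
        = (\<Sum>i<Suc k. (-1) ^ i * frechet_derivative (\<lambda>z. \<omega> z (take i us @ drop (Suc i) us)) (at y) (us ! i))"
        by (rule sum.cong) (use us in \<open>auto simp: D\<omega> a\<close>)
      then show "(\<Sum>i<Suc k. (-1) ^ i * ((a \<bullet> us ! i) * \<omega> 0 (take i us @ drop (Suc i) us))) = 0"
        using closed[OF us, of y] us by (simp add: euclidean_exterior_derivative_def)
    qed
    then show ?thesis using a by simp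
  qed
  have "F (s *\<^sub>R v) = k" for s
  proof -
    have "linear (g' (s *\<^sub>R v))" using Dg has_derivative_linear by blast
    then have "g' (s *\<^sub>R v) (s *\<^sub>R v) = 0" by (simp add: linear_cmul g'v)
    then have "real k * \<omega> (s *\<^sub>R v) us0 = F (s *\<^sub>R v) * \<omega> (s *\<^sub>R v) us0"
      using lie[OF us0(1), of "s *\<^sub>R v"] by (simp add: D\<omega>[OF us0(1)])
    moreover have "\<omega> (s *\<^sub>R v) us0 \<noteq> 0" using g[OF us0(1), of "s *\<^sub>R v"] g0 us0(2) by (metis mult_eq_0_iff)
    ultimately show ?thesis by simp
  qed
  then show ?thesis using v(1) that by blast
qed

section \<open>Charts, tangent vectors and forms in coordinates\<close>

locale manifold =
  fixes M :: "('a::t2_space, 'e::euclidean_space) chart set"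
  assumes manifold: "smooth_manifold M"
begin

lemma is_chart: "c \<in> M \<Longrightarrow> is_chart c"
  using manifold unfolding smooth_manifold_def smooth_atlas_def by blast

lemma chart_open:
  assumes "c \<in> M" shows "open (fst c)" "open (chart_image c)"
  using is_chart[OF assms] unfolding is_chart_def by auto

lemma chart_continuous:
  assumes "c \<in> M"
  shows "continuous_on (fst c) (snd c)" "continuous_on (chart_image c) (chart_inv c)"
  using is_chart[OF assms] unfolding is_chart_def homeomorphism_def by auto

lemma chart_inv_right [simp]:
  assumes "c \<in> M" "y \<in> chart_image c"
  shows "chart_inv c y \<in> fst c" "snd c (chart_inv c y) = y"
  using is_chart[OF assms(1)] assms(2) unfolding is_chart_def homeomorphism_def by auto

lemma chart_inv_left [simp]:
  assumes "c \<in> M" "x \<in> fst c"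
  shows "chart_inv c (snd c x) = x" "snd c x \<in> chart_image c"
  using is_chart[OF assms(1)] assms(2) unfolding is_chart_def homeomorphism_def chart_image_def by auto

lemma chart_ex: "\<exists>c\<in>M. x \<in> fst c"
  using manifold unfolding smooth_manifold_def smooth_atlas_def by blast

lemma chart_image_Int:
  assumes "c \<in> M"
  shows "snd c ` (fst c \<inter> S) = chart_image c \<inter> chart_inv c -` S"
  using chart_inv_left[OF assms] chart_inv_right[OF assms] by (force simp: image_iff)

lemma chart_image_open:
  assumes "c \<in> M" "open S"
  shows "open (snd c ` (fst c \<inter> S))"
  unfolding chart_image_Int[OF assms(1)]
  using continuous_open_preimage[OF chart_continuous(2) chart_open(2)] assms by blast

lemma transition_smooth:
  assumes "c \<in> M" "d \<in> M"
  shows "smooth_on (snd c ` (fst c \<inter> fst d)) (snd d \<circ> chart_inv c)"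
  using manifold assms unfolding smooth_manifold_def smooth_atlas_def compatible_charts_def by blast

definition transition where
  "transition c d x = frechet_derivative (snd d \<circ> chart_inv c) (at (snd c x))"

lemma transition_has_derivative:
  assumes "c \<in> M" "d \<in> M" "x \<in> fst c" "x \<in> fst d"
  shows "((snd d \<circ> chart_inv c) has_derivative transition c d x) (at (snd c x))"
  unfolding transition_def
  by (rule smooth_on_has_derivative[OF transition_smooth[OF assms(1,2)]]) (use assms in auto)

lemma transition_linear:
  assumes "c \<in> M" "d \<in> M" "x \<in> fst c" "x \<in> fst d"
  shows "linear (transition c d x)"
  using transition_has_derivative[OF assms] has_derivative_linear by blast

lemma transition_trans:
  assumes "c \<in> M" "d \<in> M" "e \<in> M" "x \<in> fst c" "x \<in> fst d" "x \<in> fst e"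
  shows "transition d e x (transition c d x u) = transition c e x u"
proof -
  have "((snd e \<circ> chart_inv d) has_derivative transition d e x) (at ((snd d \<circ> chart_inv c) (snd c x)))"
    using transition_has_derivative[of d e x] assms by simp
  from diff_chain_at[OF transition_has_derivative[OF assms(1,2,4,5)] this]
  have "((snd e \<circ> chart_inv d) \<circ> (snd d \<circ> chart_inv c) has_derivative transition d e x \<circ> transition c d x) (at (snd c x))" .
  then have "(snd e \<circ> chart_inv c has_derivative transition d e x \<circ> transition c d x) (at (snd c x))"
  proof (rule has_derivative_transform_within_open)
    show "open (snd c ` (fst c \<inter> fst d))" using assms by (simp add: chart_image_open chart_open)
    show "snd c x \<in> snd c ` (fst c \<inter> fst d)" using assms by simp
  qed (use assms in auto)
  then have "transition c e x = transition d e x \<circ> transition c d x"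
    unfolding transition_def[of c e] by (metis frechet_derivative_at)
  then show ?thesis by simp
qed

lemma transition_self [simp]:
  assumes "c \<in> M" "x \<in> fst c"
  shows "transition c c x u = u"
proof -
  have "(id has_derivative id) (at (snd c x))" by (simp add: id_def)
  then have "(snd c \<circ> chart_inv c has_derivative id) (at (snd c x))"
    by (rule has_derivative_transform_within_open[OF _ chart_open(2)[OF assms(1)]])
      (use assms in auto)
  then show ?thesis unfolding transition_def by (metis frechet_derivative_at id_apply)
qed

lemma coord_vector_eq:
  "coord_vector M c x u = (\<lambda>d. if d \<in> M \<and> x \<in> fst d then transition c d x u else 0)"
  by (auto simp: coord_vector_def charts_at_def transition_def)

lemma tangent_space_eq:
  "tangent_space M x = {v. (\<forall>c d. c \<in> M \<and> x \<in> fst c \<and> d \<in> M \<and> x \<in> fst d \<longrightarrow> v d = transition c d x (v c)) \<and>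
     (\<forall>c. \<not> (c \<in> M \<and> x \<in> fst c) \<longrightarrow> v c = 0)}"
  unfolding tangent_space_def charts_at_def transition_def by blast

lemma coord_vector_in [simp]:
  assumes "c \<in> M" "x \<in> fst c"
  shows "coord_vector M c x u \<in> tangent_space M x"
  unfolding tangent_space_eq coord_vector_eq using assms transition_trans[OF assms(1) _ _ assms(2)] by auto

lemma coord_vector_self [simp]:
  assumes "c \<in> M" "x \<in> fst c"
  shows "coord_vector M c x u c = u"
  using assms by (simp add: coord_vector_eq)

lemma coord_vector_component [simp]:
  assumes "c \<in> M" "x \<in> fst c" "v \<in> tangent_space M x"
  shows "coord_vector M c x (v c) = v"
proof
  fix d show "coord_vector M c x (v c) d = v d"
    using assms unfolding tangent_space_eq coord_vector_eq mem_Collect_eq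
    by (cases "d \<in> M \<and> x \<in> fst d") metis+
qed

lemma coord_vector_linear:
  assumes "c \<in> M" "x \<in> fst c"
  shows "coord_vector M c x (a *\<^sub>R u + b *\<^sub>R w)
     = (\<lambda>d. a *\<^sub>R coord_vector M c x u d + b *\<^sub>R coord_vector M c x w d)"
proof
  fix d
  show "coord_vector M c x (a *\<^sub>R u + b *\<^sub>R w) d
     = a *\<^sub>R coord_vector M c x u d + b *\<^sub>R coord_vector M c x w d"
  proof (cases "d \<in> M \<and> x \<in> fst d")
    case True
    then have "linear (transition c d x)" using transition_linear assms by blast
    then show ?thesis by (simp add: coord_vector_eq linear_add linear_cmul)
  qed (auto simp: coord_vector_eq)
qed

lemma form_rep_alternating:
  assumes "differential_form M k \<Omega>" "c \<in> M" "y \<in> chart_image c"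
  shows "alternating k (form_rep M c \<Omega> y)"
proof -
  let ?x = "chart_inv c y" let ?T = "tangent_space M ?x" let ?v = "coord_vector M c ?x"
  have x: "?x \<in> fst c" using assms by simp
  have \<Omega>: "\<Omega> ?x \<in> alternating_forms k ?T"
    using assms(1) by (simp add: differential_form_def)
  have T: "set (map ?v us) \<subseteq> ?T" for us using coord_vector_in[OF assms(2) x] by auto
  have multi: "\<Omega> ?x (vs[i := \<lambda>c. a *\<^sub>R v c + b *\<^sub>R w c]) = a * \<Omega> ?x (vs[i := v]) + b * \<Omega> ?x (vs[i := w])"
    if "length vs = k" "set vs \<subseteq> ?T" "i < k" "v \<in> ?T" "w \<in> ?T" for vs i v w a b
    using \<Omega> that unfolding alternating_forms_def mem_Collect_eq by blast
  have rep: "\<Omega> ?x vs = 0"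
    if "length vs = k" "set vs \<subseteq> ?T" "i < j" "j < k" "vs ! i = vs ! j" for vs i j
    using \<Omega> that unfolding alternating_forms_def mem_Collect_eq by blast
  show ?thesis
    unfolding alternating_def
  proof (intro conjI allI impI)
    fix us :: "'e list" and i v w a b assume "length us = k \<and> i < k"
    then show "form_rep M c \<Omega> y (us[i := a *\<^sub>R v + b *\<^sub>R w])
        = a * form_rep M c \<Omega> y (us[i := v]) + b * form_rep M c \<Omega> y (us[i := w])"
      unfolding form_rep_def map_update coord_vector_linear[OF assms(2) x]
      by (intro multi T) (simp_all add: assms(2) x)
  next
    fix us :: "'e list" and i j assume *: "length us = k \<and> i < j \<and> j < k \<and> us ! i = us ! j"
    show "form_rep M c \<Omega> y us = 0"
      unfolding form_rep_def by (rule rep[of _ i j]) (use * T in auto)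
  qed
qed

lemma form_eq_form_rep:
  assumes "c \<in> M" "x \<in> fst c" "set vs \<subseteq> tangent_space M x"
  shows "\<Omega> x vs = form_rep M c \<Omega> (snd c x) (map (\<lambda>v. v c) vs)"
proof -
  have "map (coord_vector M c x \<circ> (\<lambda>v. v c)) vs = vs"
    by (rule map_idI) (use assms in auto)
  then show ?thesis using assms by (simp add: form_rep_def)
qed

lemma form_rep_nondegenerate:
  assumes "differential_form M k \<Omega>" "one_nondegenerate M \<Omega>" "c \<in> M" "y \<in> chart_image c" "(u :: 'e) \<noteq> 0"
  obtains us where "length us = k" "form_rep M c \<Omega> y us \<noteq> 0"
proof -
  let ?x = "chart_inv c y" let ?T = "tangent_space M ?x" let ?v = "coord_vector M c ?x"
  have x: "?x \<in> fst c" using assms by simp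
  have \<Omega>: "\<Omega> ?x \<in> alternating_forms k ?T"
    using assms(1) by (simp add: differential_form_def)
  have inj: "inj_on (\<lambda>v. interior_product v (\<Omega> ?x)) ?T"
    using assms(2) by (simp add: one_nondegenerate_def)
  have "?v u \<noteq> ?v 0" using coord_vector_self[OF assms(3) x] assms(5) by metis
  then have "interior_product (?v u) (\<Omega> ?x) \<noteq> interior_product (?v 0) (\<Omega> ?x)"
    using inj coord_vector_in[OF assms(3) x] by (meson inj_onD)
  then obtain w vs where "\<Omega> ?x (w # vs) \<noteq> 0"
    unfolding interior_product_def fun_eq_iff by metis
  then have "length (w # vs) = k" "set (w # vs) \<subseteq> ?T" and nz: "\<Omega> ?x (w # vs) \<noteq> 0"
    using \<Omega> unfolding alternating_forms_def mem_Collect_eq by blast+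
  moreover have "\<Omega> ?x (w # vs) = form_rep M c \<Omega> (snd c ?x) (map (\<lambda>v. v c) (w # vs))"
    by (rule form_eq_form_rep[OF assms(3) x]) fact
  ultimately have "form_rep M c \<Omega> y (map (\<lambda>v. v c) (w # vs)) \<noteq> 0" "length (map (\<lambda>v. v c) (w # vs)) = k"
    unfolding length_map chart_inv_right(2)[OF assms(3,4)] by argo+
  then show ?thesis using that by blast
qed

lemma chart_mem:
  assumes "is_chart c" "\<And>d. d \<in> M \<Longrightarrow> compatible_charts c d"
  shows "c \<in> M"
  using manifold assms unfolding smooth_manifold_def by blast

end

section \<open>The degree equals the dimension\<close>

lemma standard_chart_inv [simp]: "chart_inv (UNIV, \<lambda>x. x) = (\<lambda>y. y)"
  unfolding chart_inv_def by (rule ext) (simp add: inv_f_eq)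

lemma frechet_derivative_identity: "frechet_derivative (\<lambda>x. x) (at y) u = u"
  using frechet_derivative_at[OF has_derivative_ident] by metis

lemma (in manifold) tangent_component:
  assumes "v \<in> tangent_space M x" "c \<in> M" "x \<in> fst c" "d \<in> M" "x \<in> fst d"
  shows "v d = transition c d x (v c)"
  using assms unfolding tangent_space_eq by blast

text \<open>The diffeomorphism of an Euler-like field is itself a chart of the maximal atlas.\<close>

lemma (in manifold) euler_chart:
  assumes "local_euler_like M x K \<Delta>"
  obtains c where "c \<in> M" "fst c = interior (field_support \<Delta>)" "x \<in> fst c" "chart_image c = UNIV"
    "\<And>y. field_rep c \<Delta> y = y"
proof -
  let ?W = "interior (field_support \<Delta>)"
  obtain \<phi> :: "'a \<Rightarrow> 'e" where \<phi>: "diffeomorphism M ?W standard_atlas UNIV \<phi>"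
    and push: "pushforward M standard_atlas ?W \<phi> \<Delta> = dilation_field" and x: "x \<in> ?W"
    and \<Delta>: "vector_field M \<Delta>"
    using assms unfolding local_euler_like_def by blast
  define c where "c = (?W, \<phi>)"
  have c [simp]: "fst c = ?W" "snd c = \<phi>" "chart_inv c = inv_into ?W \<phi>"
    by (simp_all add: c_def chart_inv_def)
  have bij: "bij_betw \<phi> ?W UNIV" and sm: "smooth_map M ?W standard_atlas \<phi>"
    and sm': "smooth_map standard_atlas UNIV M (inv_into ?W \<phi>)"
    using \<phi> unfolding diffeomorphism_def by auto
  have inj: "inj_on \<phi> ?W" and im: "\<phi> ` ?W = UNIV" using bij by (auto simp: bij_betw_def)
  have left: "inv_into ?W \<phi> (\<phi> p) = p" if "p \<in> ?W" for p using inj that by simp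
  have right: "\<phi> (inv_into ?W \<phi> y) = y" "inv_into ?W \<phi> y \<in> ?W" for y
    using im by (simp_all add: f_inv_into_f inv_into_into)
  have image: "chart_image c = UNIV" using im by (simp add: chart_image_def)
  have "c \<in> M"
  proof (rule chart_mem)
    have "inv_into ?W \<phi> ` UNIV = ?W"
    proof
      show "inv_into ?W \<phi> ` UNIV \<subseteq> ?W" using right(2) by blast
      show "?W \<subseteq> inv_into ?W \<phi> ` UNIV" using left by (metis rangeI subsetI)
    qed
    moreover have "continuous_on ?W \<phi>" "continuous_on UNIV (inv_into ?W \<phi>)"
      using sm sm' unfolding smooth_map_def by blast+
    ultimately have "homeomorphism ?W UNIV \<phi> (inv_into ?W \<phi>)"
      unfolding homeomorphism_def using left right(1) im by blast
    then show "is_chart c"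
      unfolding is_chart_def image c by simp
  next
    fix d assume d: "d \<in> M"
    have "smooth_on (inv_into ?W \<phi> -` fst d) (snd d \<circ> inv_into ?W \<phi>)"
      using sm' d by (auto simp: smooth_map_def standard_atlas_def o_def)
    moreover have "inv_into ?W \<phi> -` fst d = \<phi> ` (?W \<inter> fst d)"
    proof (intro equalityI subsetI)
      fix y assume "y \<in> inv_into ?W \<phi> -` fst d"
      then show "y \<in> \<phi> ` (?W \<inter> fst d)" using right[of y] by (metis IntI imageI vimageD)
    next
      fix y assume "y \<in> \<phi> ` (?W \<inter> fst d)"
      then show "y \<in> inv_into ?W \<phi> -` fst d" using left by auto
    qed
    moreover have "smooth_on (snd d ` (?W \<inter> fst d)) (\<phi> \<circ> chart_inv d)"
      using sm d by (auto simp: smooth_map_def standard_atlas_def o_def)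
    ultimately show "compatible_charts c d"
      unfolding compatible_charts_def c by simp
  qed
  moreover have "field_rep c \<Delta> y = y" for y
  proof -
    let ?p = "inv_into ?W \<phi> y" and ?s = "(UNIV, \<lambda>x. x) :: ('e, 'e) chart"
    define d where "d = (SOME d. d \<in> charts_at M ?p)"
    have "\<exists>d. d \<in> charts_at M ?p" using chart_ex unfolding charts_at_def by blast
    then have "d \<in> charts_at M ?p" unfolding d_def by (rule someI_ex)
    then have d: "d \<in> M" "?p \<in> fst d" by (auto simp: charts_at_def)
    have s: "?s \<in> charts_at standard_atlas z" for z by (simp add: charts_at_def standard_atlas_def)
    have "\<Delta> ?p \<in> tangent_space M ?p" using \<Delta> by (simp add: vector_field_def)
    then have "\<Delta> ?p c = transition d c ?p (\<Delta> ?p d)"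
      using tangent_component d \<open>c \<in> M\<close> right by simp
    also have "\<dots> = tangent_map M standard_atlas \<phi> ?p (\<Delta> ?p) ?s"
      using s by (simp add: tangent_map_def transition_def o_def flip: d_def)
    also have "\<dots> = dilation_field y ?s"
      using fun_cong[OF push, of y] by (simp add: pushforward_def)
    also have "\<dots> = y"
      using s by (simp add: dilation_field_def coord_vector_def o_def frechet_derivative_identity)
    finally show ?thesis by (simp add: field_rep_def)
  qed
  ultimately show ?thesis using that[of c] x image by simp
qed

text \<open>Near \<open>q\<close> the field vanishes, so its Lie derivative \<open>f \<Omega>\<close> is zero there, but \<open>\<Omega>\<close> has no zeros.\<close>

lemma (in manifold) factor_zero_off_support:
  assumes \<Omega>: "differential_form M k \<Omega>" "one_nondegenerate M \<Omega>"
    and lie: "has_lie_derivative_on M k UNIV \<Delta> \<Omega> (\<lambda>y vs. f y * \<Omega> y vs)"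
    and q: "q \<notin> field_support \<Delta>"
  shows "f q = 0"
proof -
  obtain d where d: "d \<in> M" "q \<in> fst d" using chart_ex by blast
  let ?N = "snd d ` (fst d \<inter> (- field_support \<Delta>))" and ?y = "snd d q"
  have "open ?N" using d by (intro chart_image_open) (auto simp: field_support_def)
  have y: "?y \<in> ?N" "?y \<in> chart_image d" using d q by auto
  have zero: "field_rep d \<Delta> z = 0" if z: "z \<in> ?N" for z
  proof -
    have "chart_inv d z \<notin> field_support \<Delta>" using z d by auto
    then have "chart_inv d z \<notin> {y. \<Delta> y \<noteq> (\<lambda>_. 0)}"
      unfolding field_support_def using closure_subset[of "{y. \<Delta> y \<noteq> (\<lambda>_. 0)}"] by blast
    then have "\<Delta> (chart_inv d z) = (\<lambda>_. 0)" by blast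
    then show ?thesis by (simp add: field_rep_def)
  qed
  have "((\<lambda>z. 0) has_derivative (\<lambda>u. 0)) (at ?y)" by simp
  then have "(field_rep d \<Delta> has_derivative (\<lambda>u. 0)) (at ?y)"
    by (rule has_derivative_transform_within_open[OF _ \<open>open ?N\<close> y(1)]) (simp add: zero)
  then have D: "frechet_derivative (field_rep d \<Delta>) (at ?y) = (\<lambda>u. 0)"
    using frechet_derivative_at by metis
  obtain e :: 'e where "e \<noteq> 0" using nonzero_Basis by (metis SOME_Basis)
  then obtain us where us: "length us = k" "form_rep M d \<Omega> ?y us \<noteq> 0"
    using form_rep_nondegenerate[OF \<Omega> d(1) y(2)] by blast
  have alt: "alternating k (form_rep M d \<Omega> ?y)"
    by (rule form_rep_alternating[OF \<Omega>(1) d(1) y(2)])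
  have "form_rep M d \<Omega> ?y (us[i := 0]) = 0" if "i < k" for i
    using alternating_scale[OF alt us(1) that, of 0 0] by simp
  moreover have "linear (frechet_derivative (\<lambda>z. form_rep M d \<Omega> z us) (at ?y))"
    using \<Omega>(1) us(1) d(1) y(2) has_derivative_linear[OF smooth_on_has_derivative]
    unfolding differential_form_def by blast
  ultimately have "euclidean_lie_derivative (field_rep d \<Delta>) (form_rep M d \<Omega>) ?y us = 0"
    using us(1) by (simp add: euclidean_lie_derivative_def D zero[OF y(1)] linear_0)
  moreover have "euclidean_lie_derivative (field_rep d \<Delta>) (form_rep M d \<Omega>) ?y us
      = form_rep M d (\<lambda>y vs. f y * \<Omega> y vs) ?y us"
    using lie d us(1) unfolding has_lie_derivative_on_def by auto
  moreover have "form_rep M d (\<lambda>y vs. f y * \<Omega> y vs) ?y us = f q * form_rep M d \<Omega> ?y us"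
    using d by (simp add: form_rep_def)
  ultimately show ?thesis using us(2) by simp
qed

text \<open>A degree below the dimension is excluded by the values of \<open>f\<close>: it would be \<open>k\<close> on a line of the
  Euler chart, and it is \<open>0\<close> outside the support of the field, yet the closures of the two sets meet.\<close>

lemma (in manifold) degree_eq_dimension:
  assumes \<Omega>: "differential_form M k \<Omega>" "one_nondegenerate M \<Omega>" "closed_form M k \<Omega>" "k \<ge> 2"
    and hom: "locally_homogeneous M k \<Omega>"
  shows "k = DIM('e)"
proof -
  fix x :: 'a
  obtain K \<Delta> f where euler: "local_euler_like M x K \<Delta>"
      and f: "smooth_map M UNIV (standard_atlas :: (real, real) chart set) f"
      and lie: "has_lie_derivative_on M k UNIV \<Delta> \<Omega> (\<lambda>y vs. f y * \<Omega> y vs)"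
    using hom[unfolded locally_homogeneous_def locally_homogeneous_at_def, rule_format,
        OF conjI[OF open_UNIV UNIV_I], of x] by blast
  obtain c where c: "c \<in> M" "fst c = interior (field_support \<Delta>)" "chart_image c = UNIV"
      and rep: "\<And>y. field_rep c \<Delta> y = y"
    using euler_chart[OF euler] by metis
  let ?w = "form_rep M c \<Omega>" and ?F = "\<lambda>y. f (chart_inv c y)"
  have fcont: "continuous_on UNIV f" using f by (simp add: smooth_map_def)
  have alt: "alternating k (?w y)" for y
    by (rule form_rep_alternating[OF \<Omega>(1) c(1)]) (simp add: c)
  have nonzero: "\<exists>us. length us = k \<and> ?w y us \<noteq> 0" for y
  proof -
    obtain e :: 'e where "e \<noteq> 0" using nonzero_Basis by (metis SOME_Basis)
    moreover have "y \<in> chart_image c" by (simp add: c)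
    ultimately show ?thesis using form_rep_nondegenerate[OF \<Omega>(1,2) c(1)] by metis
  qed
  then have "k \<le> DIM('e)" using alternating_degree_le[OF alt] by blast
  moreover have "\<not> k < DIM('e)"
  proof
    assume less: "k < DIM('e)"
    have smooth: "smooth_on UNIV (\<lambda>y. ?w y us)" if "length us = k" for us
      using \<Omega>(1) c that unfolding differential_form_def by metis
    have Fcont: "continuous_on UNIV ?F"
      using chart_continuous(2)[OF c(1)] c(3) by (intro continuous_on_compose2[OF fcont]) auto
    have Flie: "frechet_derivative (\<lambda>z. ?w z us) (at y) y + real k * ?w y us = ?F y * ?w y us"
      if us: "length us = k" for y us
    proof -
      have "y \<in> snd c ` (fst c \<inter> UNIV)" using c(3) by (simp add: chart_image_def)
      then have "euclidean_lie_derivative (field_rep c \<Delta>) ?w y us = form_rep M c (\<lambda>y vs. f y * \<Omega> y vs) y us"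
        using lie c(1) us unfolding has_lie_derivative_on_def by blast
      moreover have "field_rep c \<Delta> = (\<lambda>y. y)" using rep by blast
      ultimately show ?thesis
        using us by (simp add: euclidean_lie_derivative_def frechet_derivative_identity) (simp add: form_rep_def)
    qed
    have closed: "euclidean_exterior_derivative ?w y us = 0" if "length us = Suc k" for y us
      using \<Omega>(3) c that unfolding closed_form_def has_exterior_derivative_def by (simp add: form_rep_def)
    obtain v where v: "v \<noteq> 0" "\<And>s. ?F (s *\<^sub>R v) = k"
      using factor_constant_on_line[OF smooth alt Fcont Flie closed nonzero less] by blast
    define L where "L = range (\<lambda>s. chart_inv c (s *\<^sub>R v))"
    have LW: "L \<subseteq> interior (field_support \<Delta>)"
      using chart_inv_right(1)[OF c(1)] c by (auto simp: L_def)
    \<comment> \<open>Otherwise the closure would be a compact subset of the domain of the chart, so its image,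
      which contains the whole line, would be bounded.\<close>
    have "\<not> closure L \<subseteq> interior (field_support \<Delta>)"
    proof
      assume W: "closure L \<subseteq> interior (field_support \<Delta>)"
      have "field_support \<Delta> \<subseteq> K" "compact K" using euler unfolding local_euler_like_def by auto
      moreover have "K \<inter> closure L = closure L"
        using W interior_subset[of "field_support \<Delta>"] calculation(1) by blast
      ultimately have "compact (closure L)" using compact_Int_closed[of K "closure L"] by simp
      then have "bounded (snd c ` closure L)"
        using chart_continuous(1)[OF c(1)] W c(2)
        by (intro compact_imp_bounded compact_continuous_image) (auto intro: continuous_on_subset)
      then obtain B where B: "\<And>p. p \<in> closure L \<Longrightarrow> norm (snd c p) \<le> B"
        unfolding bounded_iff by auto
      have "norm (s *\<^sub>R v) \<le> B" for s
      proof -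
        have "chart_inv c (s *\<^sub>R v) \<in> closure L" using closure_subset[of L] by (auto simp: L_def)
        then show ?thesis using B chart_inv_right(2)[OF c(1)] c(3) by (metis UNIV_I)
      qed
      from this[of "(\<bar>B\<bar> + 1) / norm v"] show False using v(1) by simp
    qed
    then obtain p where p: "p \<in> closure L" "p \<notin> interior (field_support \<Delta>)" by blast
    have "f p = k"
      by (rule continuous_constant_on_closure[OF _ _ p(1)])
        (use v(2) fcont in \<open>auto simp: L_def intro: continuous_on_subset\<close>)
    moreover have "f p = 0"
    proof (rule continuous_constant_on_closure[where S = "- field_support \<Delta>"])
      show "p \<in> closure (- field_support \<Delta>)" using p(2) by (simp add: closure_complement)
    qed (use fcont factor_zero_off_support[OF \<Omega>(1,2) lie] in \<open>auto intro: continuous_on_subset\<close>)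
    ultimately show False using \<Omega>(4) by simp
  qed
  ultimately show ?thesis by linarith
qed

section \<open>Charts in which a volume form is constant\<close>

lemma has_derivative_integral_parameter:
  fixes G :: "'e::euclidean_space \<Rightarrow> real \<Rightarrow> real"
  assumes der: "\<And>y t. t \<in> {0..1} \<Longrightarrow> ((\<lambda>y. G y t) has_derivative (\<lambda>v. w y t \<bullet> v)) (at y)"
    and w: "continuous_on (UNIV \<times> {0..1}) (\<lambda>(y, t). w y t)"
    and G: "\<And>y. continuous_on {0..1} (G y)"
  shows "((\<lambda>y. integral {0..1} (G y)) has_derivative (\<lambda>v. integral {0..1} (\<lambda>t. w y t \<bullet> v))) (at y)"
proof -
  let ?fx = "\<lambda>y t. blinfun_inner_right (w y t)"
  have cont: "continuous_on (UNIV \<times> cbox 0 1) (\<lambda>(y, t). ?fx y t)"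
    using bounded_linear.continuous_on[OF bounded_linear_blinfun_inner_right w]
    by (simp add: case_prod_beta)
  have "((\<lambda>y. integral (cbox 0 1) (G y)) has_derivative integral (cbox 0 1) (?fx y)) (at y within UNIV)"
  proof (rule leibniz_rule[OF _ _ cont])
    show "((\<lambda>y. G y t) has_derivative ?fx y t) (at y within UNIV)" if "t \<in> cbox 0 1" for y t
      using der[of t y] that by (simp add: blinfun_inner_right.rep_eq)
    show "G y integrable_on cbox 0 1" for y
      using G by (intro integrable_continuous) simp
  qed auto
  moreover have "?fx y integrable_on {0..1}"
  proof (rule integrable_continuous_real)
    show "continuous_on {0..1} (?fx y)"
      using continuous_on_compose2[OF cont, of "{0..1}" "\<lambda>t. (y, t)"]
      by (simp add: continuous_on_Pair continuous_on_const continuous_on_id image_subset_iff)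
  qed
  then have "blinfun_apply (integral {0..1} (?fx y)) = (\<lambda>v. integral {0..1} (\<lambda>t. w y t \<bullet> v))"
    by (intro ext) (simp add: blinfun_apply_integral)
  ultimately show ?thesis by simp
qed

text \<open>For a unit vector \<open>e\<close>, this multiplies the coordinate of \<open>y\<close> along \<open>e\<close> by \<open>t\<close>.\<close>

definition squeeze :: "'e::euclidean_space \<Rightarrow> real \<Rightarrow> 'e \<Rightarrow> 'e" where
  "squeeze e t y = y - ((1 - t) * (y \<bullet> e)) *\<^sub>R e"

text \<open>The mean of \<open>g\<close> over the segment from \<open>y\<close> to the hyperplane orthogonal to \<open>e\<close>, which gives an
  antiderivative of \<open>g\<close> as an integral over a fixed interval. The weight \<open>p\<close> is there because
  differentiation brings out a factor \<open>1 - t\<close>; with arbitrary weights, the derivatives are again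
  built from such means.\<close>

definition weighted_mean :: "'e::euclidean_space \<Rightarrow> (real \<Rightarrow> real) \<Rightarrow> ('e \<Rightarrow> real) \<Rightarrow> 'e \<Rightarrow> real" where
  "weighted_mean e p g y = integral {0..1} (\<lambda>t. p t * g (squeeze e t y))"

lemma continuous_on_squeeze_Pair: "continuous_on A (\<lambda>(y, t). squeeze e t y)"
  unfolding squeeze_def case_prod_beta by (intro continuous_intros)

lemma continuous_on_along_squeeze:
  assumes "smooth_on UNIV g"
  shows "continuous_on S (\<lambda>t. g (squeeze e t y))"
  by (rule continuous_on_compose2[OF smooth_on_continuous[OF assms]])
    (auto simp: squeeze_def intro!: continuous_intros)

lemma weighted_mean_has_derivative:
  fixes g :: "'e::euclidean_space \<Rightarrow> real"
  assumes g: "smooth_on UNIV g" and p: "continuous_on {0..1} p"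
  shows "(weighted_mean e p g has_derivative
     (\<lambda>v. weighted_mean e p (\<lambda>x. frechet_derivative g (at x) v) y
        - (v \<bullet> e) * weighted_mean e (\<lambda>t. p t * (1 - t)) (\<lambda>x. frechet_derivative g (at x) e) y)) (at y)"
proof -
  let ?D = "\<lambda>x. frechet_derivative g (at x)"
  define w where "w y t = (\<Sum>b\<in>Basis. (p t * ?D (squeeze e t y) (b - ((1 - t) * (b \<bullet> e)) *\<^sub>R e)) *\<^sub>R b)" for y t
  have D: "(g has_derivative ?D x) (at x)" for x
    by (rule smooth_on_has_derivative[OF g UNIV_I])
  have lin: "linear (?D x)" for x using D has_derivative_linear by blast
  have wv: "w y t \<bullet> v = p t * ?D (squeeze e t y) (v - ((1 - t) * (v \<bullet> e)) *\<^sub>R e)" for y t v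
  proof -
    define l where "l v = p t * ?D (squeeze e t y) (v - ((1 - t) * (v \<bullet> e)) *\<^sub>R e)" for v
    have "linear l"
      by (rule linearI) (simp_all add: l_def inner_add_left linear_diff[OF lin] linear_add[OF lin] linear_cmul[OF lin] algebra_simps)
    then have "l (\<Sum>b\<in>Basis. (v \<bullet> b) *\<^sub>R b) = (\<Sum>b\<in>Basis. (v \<bullet> b) * l b)"
      by (simp add: linear_sum linear_cmul)
    then have "l v = (\<Sum>b\<in>Basis. l b * (b \<bullet> v))"
      unfolding euclidean_representation by (simp add: inner_commute[of v] mult.commute)
    moreover have "w y t \<bullet> v = (\<Sum>b\<in>Basis. l b * (b \<bullet> v))"
      by (simp add: w_def l_def inner_sum_left)
    ultimately show ?thesis by (simp add: l_def)
  qed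
  have "((\<lambda>y. integral {0..1} (\<lambda>t. p t * g (squeeze e t y))) has_derivative
      (\<lambda>v. integral {0..1} (\<lambda>t. w y t \<bullet> v))) (at y)"
  proof (rule has_derivative_integral_parameter)
    fix y t
    have "bounded_linear (squeeze e t)"
      unfolding linear_conv_bounded_linear[symmetric]
      by (rule linearI) (simp_all add: squeeze_def inner_add_left algebra_simps)
    then have "((\<lambda>y. g (squeeze e t y)) has_derivative (\<lambda>v. ?D (squeeze e t y) (squeeze e t v))) (at y)"
      using diff_chain_at[OF bounded_linear_imp_has_derivative D] by (simp add: o_def)
    then show "((\<lambda>y. p t * g (squeeze e t y)) has_derivative (\<lambda>v. w y t \<bullet> v)) (at y)"
      unfolding wv by (subst squeeze_def[symmetric]) (rule has_derivative_mult_right)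
  next
    have p2: "continuous_on (UNIV \<times> {0..1}) (\<lambda>z::'e \<times> real. p (snd z))"
      by (rule continuous_on_compose2[OF p continuous_on_snd[OF continuous_on_id]]) auto
    have D2: "continuous_on (UNIV \<times> {0..1}) (\<lambda>z. ?D (squeeze e (snd z) (fst z)) u)" for u
      by (rule continuous_on_compose2[OF smooth_on_continuous[OF smooth_on_derivative[OF g]]
            continuous_on_squeeze_Pair[unfolded case_prod_beta]]) auto
    have eq: "w (fst z) (snd z) = (\<Sum>b\<in>Basis. (p (snd z) * (?D (squeeze e (snd z) (fst z)) b
        - ((1 - snd z) * (b \<bullet> e)) * ?D (squeeze e (snd z) (fst z)) e)) *\<^sub>R b)" for z
      unfolding w_def by (simp add: linear_diff[OF lin] linear_cmul[OF lin])
    show "continuous_on (UNIV \<times> {0..1}) (\<lambda>(y, t). w y t)"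
      unfolding case_prod_beta eq by (intro continuous_intros p2 D2)
    show "continuous_on {0..1} (\<lambda>t. p t * g (squeeze e t y))" for y
      by (intro continuous_on_mult p continuous_on_along_squeeze g)
  qed
  moreover have "integral {0..1} (\<lambda>t. w y t \<bullet> v)
     = weighted_mean e p (\<lambda>x. ?D x v) y - (v \<bullet> e) * weighted_mean e (\<lambda>t. p t * (1 - t)) (\<lambda>x. ?D x e) y" for v
  proof -
    have i1: "(\<lambda>t. p t * ?D (squeeze e t y) v) integrable_on {0..1}"
      by (intro integrable_continuous_real continuous_on_mult p continuous_on_along_squeeze smooth_on_derivative g)
    have "(\<lambda>t. (p t * (1 - t)) * ?D (squeeze e t y) e) integrable_on {0..1}"
      by (intro integrable_continuous_real continuous_on_mult p continuous_on_along_squeeze[OF smooth_on_derivative[OF g]]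
          continuous_on_diff continuous_on_const continuous_on_id)
    then have i2: "(\<lambda>t. (v \<bullet> e) * ((p t * (1 - t)) * ?D (squeeze e t y) e)) integrable_on {0..1}"
      by (rule integrable_on_mult_right)
    have "integral {0..1} (\<lambda>t. w y t \<bullet> v)
      = integral {0..1} (\<lambda>t. p t * ?D (squeeze e t y) v - (v \<bullet> e) * ((p t * (1 - t)) * ?D (squeeze e t y) e))"
      unfolding wv by (simp add: linear_add[OF lin] linear_diff[OF lin] linear_cmul[OF lin] algebra_simps)
    also have "\<dots> = integral {0..1} (\<lambda>t. p t * ?D (squeeze e t y) v)
        - integral {0..1} (\<lambda>t. (v \<bullet> e) * ((p t * (1 - t)) * ?D (squeeze e t y) e))"
      by (rule integral_diff[OF i1 i2])
    finally show ?thesis unfolding weighted_mean_def by simp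
  qed
  ultimately show ?thesis by (simp add: weighted_mean_def[abs_def])
qed

lemma weighted_mean_smooth:
  fixes g :: "'e::euclidean_space \<Rightarrow> real"
  assumes "smooth_on UNIV g" "continuous_on {0..1} p"
  shows "smooth_on UNIV (weighted_mean e p g)"
proof (rule smooth_onI)
  fix k show "k_times_differentiable_on k UNIV (weighted_mean e p g)"
    using assms
  proof (induction k arbitrary: p g)
    case 0
    then show ?case
      using weighted_mean_has_derivative[OF 0] has_derivative_continuous
      unfolding k_times_differentiable_on.simps by (intro continuous_at_imp_continuous_on ballI) blast
  next
    case (Suc k)
    show ?case
    proof (rule Ck_on_SucI[OF open_UNIV weighted_mean_has_derivative[OF Suc.prems]])
      fix v
      let ?D = "\<lambda>v x. frechet_derivative g (at x) v"
      have "k_times_differentiable_on k UNIV (weighted_mean e p (?D v))"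
        by (rule Suc.IH[OF smooth_on_derivative[OF Suc.prems(1)] Suc.prems(2)])
      moreover have "k_times_differentiable_on k UNIV (weighted_mean e (\<lambda>t. p t * (1 - t)) (?D e))"
        by (rule Suc.IH[OF smooth_on_derivative[OF Suc.prems(1)]])
          (intro continuous_on_mult Suc.prems(2) continuous_on_diff continuous_on_const continuous_on_id)
      ultimately have "k_times_differentiable_on k UNIV (\<lambda>y. weighted_mean e p (?D v) y
          + (- (v \<bullet> e)) *\<^sub>R weighted_mean e (\<lambda>t. p t * (1 - t)) (?D e) y)"
        by (intro Ck_on_add Ck_on_scaleR Ck_on_const open_UNIV)
      then show "k_times_differentiable_on k UNIV (\<lambda>y. weighted_mean e p (?D v) y
          - (v \<bullet> e) * weighted_mean e (\<lambda>t. p t * (1 - t)) (?D e) y)"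
        by simp
    qed
  qed
qed

text \<open>The function \<open>(y \<bullet> e) * weighted_mean e 1 g y\<close> is the integral of \<open>g\<close> along \<open>e\<close> from the
  hyperplane to \<open>y\<close>. Its derivative in the direction \<open>e\<close> is the integral over \<open>[0,1]\<close> of the derivative of
  \<open>t g (squeeze e t y)\<close> with respect to \<open>t\<close>.\<close>

lemma smooth_primitive:
  fixes g :: "'e::euclidean_space \<Rightarrow> real"
  assumes g: "smooth_on UNIV g" and e: "e \<bullet> e = 1"
  obtains I where "smooth_on UNIV I" "\<And>y. frechet_derivative I (at y) e = g y"
proof
  let ?H = "weighted_mean e (\<lambda>_. 1) g"
  let ?I = "\<lambda>y. (y \<bullet> e) * ?H y"
  have H: "smooth_on UNIV ?H" by (intro weighted_mean_smooth g continuous_on_const)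
  show "smooth_on UNIV ?I"
    by (intro smooth_on_mult H smooth_on_linear bounded_linear_inner_left) auto
  fix y
  let ?D = "\<lambda>x. frechet_derivative g (at x)"
  have D: "(g has_derivative ?D x) (at x)" for x
    by (rule smooth_on_has_derivative[OF g UNIV_I])
  have lin: "linear (?D x)" for x using D has_derivative_linear by blast
  have sq: "squeeze e t y = (y - (y \<bullet> e) *\<^sub>R e) + (t * (y \<bullet> e)) *\<^sub>R e" for t
    by (simp add: squeeze_def algebra_simps)
  have "((\<lambda>t. t * g (squeeze e t y)) has_real_derivative
      g (squeeze e t y) + t * (y \<bullet> e) * ?D (squeeze e t y) e) (at t)" for t
  proof -
    have "((\<lambda>t. squeeze e t y) has_derivative (\<lambda>s. (s * (y \<bullet> e)) *\<^sub>R e)) (at t)"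
      unfolding sq by (auto intro!: derivative_eq_intros)
    then have "((\<lambda>t. g (squeeze e t y)) has_derivative (\<lambda>s. ?D (squeeze e t y) ((s * (y \<bullet> e)) *\<^sub>R e))) (at t)"
      using diff_chain_at[OF _ D, of "\<lambda>t. squeeze e t y"] by (simp add: o_def)
    then have "((\<lambda>t. g (squeeze e t y)) has_real_derivative (y \<bullet> e) * ?D (squeeze e t y) e) (at t)"
      unfolding has_field_derivative_def
      by (rule has_derivative_eq_rhs) (simp add: fun_eq_iff linear_cmul[OF lin] algebra_simps)
    from DERIV_mult[OF DERIV_ident this] show ?thesis by (simp add: algebra_simps)
  qed
  then have "((\<lambda>t. g (squeeze e t y) + t * (y \<bullet> e) * ?D (squeeze e t y) e) has_integral
      1 * g (squeeze e 1 y) - 0 * g (squeeze e 0 y)) {0..1}"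
    by (intro fundamental_theorem_of_calculus)
      (auto simp: has_real_derivative_iff_has_vector_derivative intro: has_vector_derivative_at_within)
  then have ftc: "integral {0..1} (\<lambda>t. g (squeeze e t y) + t * (y \<bullet> e) * ?D (squeeze e t y) e) = g y"
    by (simp add: integral_unique squeeze_def)
  have c: "continuous_on {0..1} (\<lambda>t. h (squeeze e t y))" if "smooth_on UNIV h" for h :: "'e \<Rightarrow> real"
    by (rule continuous_on_along_squeeze[OF that])
  define J where "J = weighted_mean e (\<lambda>_. 1) (\<lambda>x. ?D x e) y - weighted_mean e (\<lambda>t. 1 * (1 - t)) (\<lambda>x. ?D x e) y"
  have J: "J = integral {0..1} (\<lambda>t. t * ?D (squeeze e t y) e)"
  proof -
    have "J = integral {0..1} (\<lambda>t. 1 * ?D (squeeze e t y) e - (1 * (1 - t)) * ?D (squeeze e t y) e)"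
      unfolding J_def weighted_mean_def
      by (intro integral_diff[symmetric] integrable_continuous_real continuous_on_mult c[OF smooth_on_derivative[OF g]]
          continuous_on_diff continuous_on_const continuous_on_id)
    then show ?thesis by (simp add: algebra_simps)
  qed
  have "(?I has_derivative (\<lambda>v. (y \<bullet> e) * (weighted_mean e (\<lambda>_. 1) (\<lambda>x. ?D x v) y
        - (v \<bullet> e) * weighted_mean e (\<lambda>t. 1 * (1 - t)) (\<lambda>x. ?D x e) y) + (v \<bullet> e) * ?H y)) (at y)"
    by (intro has_derivative_mult has_derivative_inner_left has_derivative_ident
        weighted_mean_has_derivative g continuous_on_const)
  then have "(\<lambda>v. (y \<bullet> e) * (weighted_mean e (\<lambda>_. 1) (\<lambda>x. ?D x v) y
        - (v \<bullet> e) * weighted_mean e (\<lambda>t. 1 * (1 - t)) (\<lambda>x. ?D x e) y) + (v \<bullet> e) * ?H y)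
      = frechet_derivative ?I (at y)"
    by (rule frechet_derivative_at)
  from fun_cong[OF this, of e] have "frechet_derivative ?I (at y) e = (y \<bullet> e) * J + ?H y"
    using e by (simp add: J_def)
  also have "\<dots> = integral {0..1} (\<lambda>t. (y \<bullet> e) * (t * ?D (squeeze e t y) e)) + integral {0..1} (\<lambda>t. g (squeeze e t y))"
    unfolding J by (simp add: weighted_mean_def)
  also have "\<dots> = integral {0..1} (\<lambda>t. (y \<bullet> e) * (t * ?D (squeeze e t y) e) + g (squeeze e t y))"
    by (intro integral_add[symmetric] integrable_continuous_real continuous_on_mult c smooth_on_derivative[OF g] g
          continuous_on_const continuous_on_id)
  also have "\<dots> = g y" using ftc by (simp add: algebra_simps)
  finally show "frechet_derivative ?I (at y) e = g y" .
qed

text \<open>The coordinate along \<open>e\<close> is replaced by an antiderivative \<open>I\<close> of \<open>g\<close>, so that \<open>\<Psi>\<close> has the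
  determinant \<open>g\<close>, as \<open>scales_rank_one\<close> shows. On each line parallel to \<open>e\<close> the map is
  injective by the mean value theorem; its image is open by invariance of domain, and may be a proper subset. The
  derivative of the inverse \<open>\<Phi>\<close> is a smooth expression in \<open>\<Phi>\<close>, whence \<open>\<Phi>\<close> is smooth.\<close>

lemma straighten_density:
  fixes g :: "'e::euclidean_space \<Rightarrow> real"
  assumes g: "smooth_on UNIV g" and e: "e \<in> Basis" and nz: "\<And>y. g y \<noteq> 0"
  obtains \<Psi> \<Phi> :: "'e \<Rightarrow> 'e" and \<alpha> :: "'e \<Rightarrow> 'e \<Rightarrow> real"
  where "open (range \<Psi>)" "homeomorphism UNIV (range \<Psi>) \<Psi> \<Phi>" "smooth_on UNIV \<Psi>" "smooth_on (range \<Psi>) \<Phi>"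
    "\<And>y. (\<Psi> has_derivative (\<lambda>v. v + \<alpha> y v *\<^sub>R e)) (at y)" "\<And>y. linear (\<alpha> y)" "\<And>y. 1 + \<alpha> y e = g y"
proof -
  have ee: "e \<bullet> e = 1" using e by simp
  obtain I where I: "smooth_on UNIV I" "\<And>y. frechet_derivative I (at y) e = g y"
    using smooth_primitive[OF g ee] by blast
  let ?I' = "\<lambda>y. frechet_derivative I (at y)"
  have I': "(I has_derivative ?I' y) (at y)" for y by (rule smooth_on_has_derivative[OF I(1) UNIV_I])
  have lin: "linear (?I' y)" for y using I' has_derivative_linear by blast
  define \<Psi> where "\<Psi> y = y + (I y - y \<bullet> e) *\<^sub>R e" for y
  define \<alpha> where "\<alpha> y v = ?I' y v - v \<bullet> e" for y v
  have \<Psi>': "(\<Psi> has_derivative (\<lambda>v. v + \<alpha> y v *\<^sub>R e)) (at y)" for y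
    unfolding \<Psi>_def[abs_def] \<alpha>_def
    by (intro has_derivative_add has_derivative_ident has_derivative_scaleR_left has_derivative_diff I'
        has_derivative_inner_left)
  have lin\<alpha>: "linear (\<alpha> y)" for y
    by (rule linearI) (simp_all add: \<alpha>_def linear_add[OF lin] linear_cmul[OF lin] inner_add_left algebra_simps)
  have \<alpha>e: "1 + \<alpha> y e = g y" for y using I(2) ee by (simp add: \<alpha>_def)
  have smooth\<Psi>: "smooth_on UNIV \<Psi>"
    unfolding \<Psi>_def[abs_def]
    by (intro smooth_on_add smooth_on_ident smooth_on_scaleR smooth_on_diff I(1) smooth_on_const
        smooth_on_linear bounded_linear_inner_left) auto
  have inj: "inj \<Psi>"
  proof (rule injI)
    fix y z assume eq: "\<Psi> y = \<Psi> z"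
    have "\<Psi> x \<bullet> e = I x" for x using ee by (simp add: \<Psi>_def inner_add_left)
    then have "I y = I z" using eq by metis
    define s where "s = y \<bullet> e - z \<bullet> e"
    have y: "y = z + s *\<^sub>R e" using eq \<open>I y = I z\<close>
      by (simp add: \<Psi>_def s_def algebra_simps)
    have d: "((\<lambda>t. I (z + t *\<^sub>R e)) has_real_derivative g (z + t *\<^sub>R e)) (at t)" for t
    proof -
      have "((\<lambda>t. z + t *\<^sub>R e) has_derivative (\<lambda>t. t *\<^sub>R e)) (at t)"
        by (auto intro!: derivative_eq_intros)
      then have "((\<lambda>t. I (z + t *\<^sub>R e)) has_derivative (\<lambda>s. ?I' (z + t *\<^sub>R e) (s *\<^sub>R e))) (at t)"
        using diff_chain_at[OF _ I', of "\<lambda>t. z + t *\<^sub>R e"] by (simp add: o_def)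
      then show ?thesis
        unfolding has_field_derivative_def
        by (rule has_derivative_eq_rhs) (simp add: fun_eq_iff linear_cmul[OF lin] I(2))
    qed
    have "s = 0"
    proof (rule ccontr)
      assume "s \<noteq> 0"
      then consider "0 < s" | "s < 0" by linarith
      then obtain \<xi> where "I (z + s *\<^sub>R e) - I (z + 0 *\<^sub>R e) = s * g (z + \<xi> *\<^sub>R e)"
      proof cases
        case 1
        then show thesis using that MVT2[OF 1, of "\<lambda>t. I (z + t *\<^sub>R e)" "\<lambda>t. g (z + t *\<^sub>R e)"] d by auto
      next
        case 2
        then obtain \<xi> where "I (z + 0 *\<^sub>R e) - I (z + s *\<^sub>R e) = (0 - s) * g (z + \<xi> *\<^sub>R e)"
          using MVT2[OF 2, of "\<lambda>t. I (z + t *\<^sub>R e)" "\<lambda>t. g (z + t *\<^sub>R e)"] d by blast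
        then show thesis using that[of \<xi>] by simp
      qed
      then show False using \<open>I y = I z\<close> y \<open>s \<noteq> 0\<close> nz by simp
    qed
    then show "y = z" using y by simp
  qed
  have cont: "continuous_on UNIV \<Psi>" by (rule smooth_on_continuous[OF smooth\<Psi>])
  have opn: "open (range \<Psi>)" by (rule invariance_of_domain[OF cont open_UNIV inj])
  obtain \<Phi> where hom: "homeomorphism UNIV (range \<Psi>) \<Psi> \<Phi>"
    using invariance_of_domain_homeomorphism[OF open_UNIV cont _ inj] by blast
  have left: "\<Phi> (\<Psi> y) = y" for y using hom by (simp add: homeomorphism_def)
  define B where "B y u = u - (\<alpha> y u / g y) *\<^sub>R e" for y u
  have \<Phi>': "(\<Phi> has_derivative B (\<Phi> z)) (at z)" if z: "z \<in> range \<Psi>" for z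
  proof -
    obtain y where y: "z = \<Psi> y" using z by blast
    have "(\<Phi> has_derivative B y) (at (\<Psi> y))"
    proof (rule has_derivative_inverse_on[OF open_UNIV \<Psi>' left _ UNIV_I])
      have "B y u + \<alpha> y (B y u) *\<^sub>R e = u" for u
      proof -
        have "\<alpha> y (B y u) = \<alpha> y u - (\<alpha> y u / g y) * \<alpha> y e"
          by (simp add: B_def linear_diff[OF lin\<alpha>] linear_cmul[OF lin\<alpha>])
        also have "\<alpha> y e = g y - 1" using \<alpha>e[of y] by simp
        also have "\<alpha> y u - (\<alpha> y u / g y) * (g y - 1) = \<alpha> y u - (\<alpha> y u / g y) * g y + \<alpha> y u / g y"
          by (simp only: right_diff_distrib mult_1_right)
        also have "\<dots> = \<alpha> y u / g y" using nz[of y] by simp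
        finally show ?thesis by (simp add: B_def)
      qed
      then show "(\<lambda>v. v + \<alpha> y v *\<^sub>R e) \<circ> B y = id" by (simp add: fun_eq_iff)
    qed
    then show ?thesis by (simp add: y left)
  qed
  have "smooth_on (range \<Psi>) \<Phi>"
  proof (rule smooth_onI)
    fix k show "k_times_differentiable_on k (range \<Psi>) \<Phi>"
    proof (induction k)
      case 0
      then show ?case using hom by (simp add: homeomorphism_def)
    next
      case (Suc k)
      show ?case
      proof (rule Ck_on_SucI[OF opn \<Phi>'])
        fix v
        have "smooth_on UNIV (\<lambda>y. v - ((?I' y v - v \<bullet> e) / g y) *\<^sub>R e)"
          by (intro smooth_on_diff smooth_on_const smooth_on_scaleR smooth_on_divide smooth_on_derivative I(1) g nz) auto
        then have "smooth_on UNIV (\<lambda>y. B y v)" by (simp add: B_def \<alpha>_def)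
        then show "k_times_differentiable_on k (range \<Psi>) (\<lambda>z. B (\<Phi> z) v)"
          by (intro Ck_on_compose[OF opn open_UNIV _ Suc] smooth_onD) auto
      qed
    qed
  qed
  then show ?thesis using that[OF opn hom smooth\<Psi> _ \<Psi>' lin\<alpha> \<alpha>e] by blast
qed

context manifold
begin

lemma coord_vector_change:
  assumes "c \<in> M" "d \<in> M" "x \<in> fst c" "x \<in> fst d"
  shows "coord_vector M d x u = coord_vector M c x (transition d c x u)"
proof -
  have "coord_vector M d x u c = transition d c x u"
    using assms by (simp add: coord_vector_eq)
  then show ?thesis using coord_vector_component[OF assms(1,3) coord_vector_in[OF assms(2,4)]] by metis
qed

lemma form_rep_change:
  assumes "c \<in> M" "d \<in> M" "x \<in> fst c" "x \<in> fst d"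
  shows "form_rep M d \<Omega> (snd d x) us = form_rep M c \<Omega> (snd c x) (map (transition d c x) us)"
proof -
  have "map (coord_vector M c x) (map (transition d c x) us) = map (coord_vector M d x) us"
    unfolding map_map o_def coord_vector_change[OF assms, symmetric] ..
  then show ?thesis using assms by (simp add: form_rep_def del: map_map)
qed

lemma reparametrized_chart:
  assumes c: "c \<in> M" and image: "chart_image c = UNIV"
    and opn: "open (range \<Psi>)" and hom: "homeomorphism UNIV (range \<Psi>) \<Psi> \<Phi>"
    and smooth: "smooth_on UNIV \<Psi>" "smooth_on (range \<Psi>) \<Phi>"
  shows "(fst c, \<Psi> \<circ> snd c) \<in> M" "chart_image (fst c, \<Psi> \<circ> snd c) = range \<Psi>"
proof -
  let ?c = "(fst c, \<Psi> \<circ> snd c)"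
  have \<Phi>: "\<Phi> (\<Psi> y) = y" and \<Psi>: "z \<in> range \<Psi> \<Longrightarrow> \<Psi> (\<Phi> z) = z" for y z
    using hom by (auto simp: homeomorphism_def)
  have cont: "continuous_on UNIV \<Psi>" "continuous_on (range \<Psi>) \<Phi>"
    using hom by (auto simp: homeomorphism_def)
  have im: "snd c ` fst c = UNIV" using image by (simp add: chart_image_def)
  show image': "chart_image ?c = range \<Psi>"
    unfolding chart_image_def fst_conv snd_conv image_comp[symmetric] im ..
  have inv: "chart_inv ?c z = chart_inv c (\<Phi> z)" if "z \<in> range \<Psi>" for z
  proof -
    have "inj_on (\<Psi> \<circ> snd c) (fst c)"
    proof (rule inj_onI)
      fix p q assume pq: "p \<in> fst c" "q \<in> fst c" "(\<Psi> \<circ> snd c) p = (\<Psi> \<circ> snd c) q"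
      then have "snd c p = snd c q" by (metis \<Phi> comp_apply)
      then show "p = q" using pq c chart_inv_left(1) by metis
    qed
    moreover have "chart_inv c (\<Phi> z) \<in> fst c" "(\<Psi> \<circ> snd c) (chart_inv c (\<Phi> z)) = z"
      using c image \<Psi>[OF that] by simp_all
    ultimately show ?thesis unfolding chart_inv_def[of ?c] by (simp add: inv_into_f_eq)
  qed
  have "is_chart ?c"
    unfolding is_chart_def image' fst_conv snd_conv homeomorphism_def
  proof (intro conjI ballI)
    show "open (fst c)" by (rule chart_open(1)[OF c])
    show "open (range \<Psi>)" by (rule opn)
    show "chart_inv ?c ((\<Psi> \<circ> snd c) x) = x" if "x \<in> fst c" for x
      using that c by (simp add: inv \<Phi>)
    show "(\<Psi> \<circ> snd c) (chart_inv ?c z) = z" if "z \<in> range \<Psi>" for z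
      using inv[OF that] \<Psi>[OF that] c image by simp
    show "(\<Psi> \<circ> snd c) ` fst c = range \<Psi>" unfolding image_comp[symmetric] im ..
    have "chart_inv ?c ` range \<Psi> = (\<lambda>y. chart_inv c y) ` UNIV"
      unfolding image_image by (simp add: inv \<Phi>)
    also have "\<dots> = fst c" using is_chart[OF c] unfolding is_chart_def homeomorphism_def image by simp
    finally show "chart_inv ?c ` range \<Psi> = fst c" .
    show "continuous_on (fst c) (\<Psi> \<circ> snd c)"
      by (rule continuous_on_compose[OF chart_continuous(1)[OF c] continuous_on_subset[OF cont(1)]]) simp
    have "continuous_on (range \<Psi>) (\<lambda>z. chart_inv c (\<Phi> z))"
      by (rule continuous_on_compose2[OF chart_continuous(2)[OF c] cont(2)]) (simp add: image)
    then show "continuous_on (range \<Psi>) (chart_inv ?c)"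
      by (simp add: inv cong: continuous_on_cong)
  qed
  moreover have "compatible_charts ?c d" if d: "d \<in> M" for d
    unfolding compatible_charts_def fst_conv snd_conv
  proof
    let ?S = "snd c ` (fst c \<inter> fst d)"
    have S: "open ?S" by (rule chart_image_open[OF c chart_open(1)[OF d]])
    have eq: "(\<Psi> \<circ> snd c) ` (fst c \<inter> fst d) = range \<Psi> \<inter> \<Phi> -` ?S"
      unfolding image_comp[symmetric] by (auto simp: \<Phi>)
    have opn': "open (range \<Psi> \<inter> \<Phi> -` ?S)"
      by (rule continuous_open_preimage[OF cont(2) opn S])
    have "smooth_on (range \<Psi> \<inter> \<Phi> -` ?S) (\<lambda>z. (snd d \<circ> chart_inv c) (\<Phi> z))"
      by (rule smooth_on_compose[OF opn' S _ smooth_on_subset[OF smooth(2)] transition_smooth[OF c d]]) auto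
    then show "smooth_on ((\<Psi> \<circ> snd c) ` (fst c \<inter> fst d)) (snd d \<circ> chart_inv ?c)"
      unfolding eq by (rule smooth_on_cong[OF opn', rotated]) (simp add: inv)
    have "smooth_on (snd d ` (fst c \<inter> fst d)) (\<lambda>z. \<Psi> ((snd c \<circ> chart_inv d) z))"
    proof (rule smooth_on_compose[OF _ open_UNIV _ _ smooth(1)])
      show "open (snd d ` (fst c \<inter> fst d))"
        using chart_image_open[OF d chart_open(1)[OF c]] by (simp add: Int_commute)
      show "smooth_on (snd d ` (fst c \<inter> fst d)) (snd c \<circ> chart_inv d)"
        using transition_smooth[OF d c] by (simp add: Int_commute)
    qed simp
    then show "smooth_on (snd d ` (fst c \<inter> fst d)) (\<Psi> \<circ> snd c \<circ> chart_inv d)"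
      by (simp add: o_def)
  qed
  ultimately show "?c \<in> M" by (rule chart_mem)
qed

text \<open>Forms of top degree differ by a density \<open>g\<close>, and the change of coordinates that straightens \<open>g\<close> makes
  the form constant. The hypothesis on the image of \<open>c0\<close> provides all the lines along which \<open>g\<close> is to be
  integrated.\<close>

lemma unimodular_chart:
  assumes \<Omega>: "differential_form M DIM('e) \<Omega>" "one_nondegenerate M \<Omega>"
    and c0: "c0 \<in> M" "chart_image c0 = UNIV" and x: "x \<in> fst c0"
  obtains c \<eta> where "c \<in> M" "x \<in> fst c" "top_form \<eta>"
    "\<And>y us. y \<in> chart_image c \<Longrightarrow> length us = DIM('e) \<Longrightarrow> form_rep M c \<Omega> y us = \<eta> us"
proof -
  let ?w = "form_rep M c0 \<Omega>" and ?n = "DIM('e)"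
  have walt: "alternating ?n (?w y)" for y
    by (rule form_rep_alternating[OF \<Omega>(1) c0(1)]) (simp add: c0)
  obtain e :: 'e where e: "e \<in> Basis" by (metis SOME_Basis)
  have wnonzero: "\<exists>us. length us = ?n \<and> ?w y us \<noteq> 0" for y
  proof -
    have "e \<noteq> 0" using e nonzero_Basis by blast
    moreover have "y \<in> chart_image c0" by (simp add: c0)
    ultimately show ?thesis using form_rep_nondegenerate[OF \<Omega> c0(1)] by metis
  qed
  define \<eta> where "\<eta> = ?w 0"
  have top: "top_form \<eta>" unfolding \<eta>_def by unfold_locales (use walt wnonzero in blast)+
  interpret top_form \<eta> by fact
  obtain us0 where us0: "length us0 = ?n" "\<eta> us0 \<noteq> 0" using wnonzero \<eta>_def by blast
  define g where "g y = ?w y us0 / \<eta> us0" for y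
  have g: "?w y us = g y * \<eta> us" if "length us = ?n" for y us
  proof -
    obtain \<mu> where \<mu>: "\<And>us. length us = ?n \<Longrightarrow> ?w y us = \<mu> * \<eta> us"
      using top_form_scaled[OF walt[of 0, folded \<eta>_def] walt[of y] us0] by blast
    have "g y = \<mu>" using \<mu>[OF us0(1)] us0(2) by (simp add: g_def)
    then show ?thesis using \<mu>[OF that] by simp
  qed
  have g0: "g y \<noteq> 0" for y
  proof -
    obtain us where us: "length us = ?n" "?w y us \<noteq> 0" using wnonzero by blast
    show ?thesis using g[OF us(1), where y = y] us(2) by (metis mult_zero_left)
  qed
  have "smooth_on UNIV (\<lambda>y. ?w y us0)"
    using \<Omega>(1) c0 us0(1) unfolding differential_form_def by metis
  then have "smooth_on UNIV (\<lambda>y. ?w y us0 / \<eta> us0)"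
    by (intro smooth_on_divide smooth_on_const us0(2)) auto
  then have gs: "smooth_on UNIV g" unfolding g_def[abs_def] .
  obtain \<Psi> \<Phi> :: "'e \<Rightarrow> 'e" and \<alpha>
    where opn: "open (range \<Psi>)" and hom: "homeomorphism UNIV (range \<Psi>) \<Psi> \<Phi>"
      and sm: "smooth_on UNIV \<Psi>" "smooth_on (range \<Psi>) \<Phi>"
      and D: "\<And>y. (\<Psi> has_derivative (\<lambda>v. v + \<alpha> y v *\<^sub>R e)) (at y)"
      and \<alpha>: "\<And>y. linear (\<alpha> y)" "\<And>y. 1 + \<alpha> y e = g y"
    using straighten_density[OF gs e g0] by blast
  define c where "c = (fst c0, \<Psi> \<circ> snd c0)"
  have c: "c \<in> M" "chart_image c = range \<Psi>" "fst c = fst c0"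
    unfolding c_def using reparametrized_chart[OF c0 opn hom sm] by auto
  have const: "form_rep M c \<Omega> z us = \<eta> us" if z: "z \<in> chart_image c" and us: "length us = ?n" for z us
  proof -
    define p where "p = chart_inv c z"
    define y where "y = snd c0 p"
    have p: "p \<in> fst c" "p \<in> fst c0" "snd c p = z" using z c by (auto simp: p_def)
    have "((snd c \<circ> chart_inv c0) has_derivative (\<lambda>v. v + \<alpha> y v *\<^sub>R e)) (at y)"
      by (rule has_derivative_transform_within_open[OF D open_UNIV UNIV_I]) (simp add: c_def c0)
    then have A: "transition c0 c p = (\<lambda>v. v + \<alpha> y v *\<^sub>R e)"
      unfolding transition_def y_def by (metis frechet_derivative_at)
    have "scales_form \<eta> (transition c0 c p) (g y)"
      unfolding A \<alpha>(2)[symmetric] by (rule scales_rank_one[OF e \<alpha>(1)]) (simp add: \<alpha>(2) g0)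
    then have "\<eta> (map (transition c0 c p) (map (transition c c0 p) us)) = g y * \<eta> (map (transition c c0 p) us)"
      using us unfolding scales_form_def by (simp del: map_map)
    moreover have "map (transition c0 c p) (map (transition c c0 p) us) = us"
      unfolding map_map o_def
      by (rule map_idI) (use transition_trans[of c c0 c p] p c(1) c0(1) in simp)
    moreover have "form_rep M c \<Omega> z us = ?w y (map (transition c c0 p) us)"
      using form_rep_change[of c0 c p \<Omega> us] p c(1) c0(1) by (simp add: y_def)
    ultimately show ?thesis using g[where us = "map (transition c c0 p) us" and y = y] us by simp
  qed
  show ?thesis by (rule that[OF c(1) _ top const]) (simp_all add: c x)
qed

end

section \<open>Volume-preserving half turns with compact support\<close>

lemma smooth_on_inner:
  fixes f g :: "'a::real_normed_vector \<Rightarrow> 'e::euclidean_space"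
  assumes S: "open S" and f: "smooth_on S f" and g: "smooth_on S g"
  shows "smooth_on S (\<lambda>x. f x \<bullet> g x)"
proof -
  have "smooth_on S (\<lambda>x. \<Sum>b\<in>Basis. (f x \<bullet> b) * (g x \<bullet> b))"
    by (intro smooth_on_sum S smooth_on_mult smooth_on_linear_comp[OF S bounded_linear_inner_left] f g)
  then show ?thesis by (simp flip: euclidean_inner)
qed

text \<open>The rotation about \<open>m\<close> in the plane of \<open>e1\<close> and \<open>e2\<close> by an angle that depends on the squared distance
  from \<open>m\<close>; the square makes the map smooth at \<open>m\<close>.\<close>

definition twist :: "'e::euclidean_space \<Rightarrow> 'e \<Rightarrow> 'e \<Rightarrow> (real \<Rightarrow> real) \<Rightarrow> 'e \<Rightarrow> 'e" where
  "twist m e1 e2 \<theta> y = m + plane_rotation e1 e2 (\<theta> ((y - m) \<bullet> (y - m))) (y - m)"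

lemma twist_smooth:
  assumes \<theta>: "smooth_on UNIV \<theta>"
  shows "smooth_on UNIV (twist m e1 e2 \<theta>)"
proof -
  have w: "smooth_on UNIV (\<lambda>y. y - m)" by (intro smooth_on_diff smooth_on_ident smooth_on_const) auto
  have i: "smooth_on UNIV (\<lambda>y. (y - m) \<bullet> e)" for e
    by (rule smooth_on_inner[OF open_UNIV w smooth_on_const])
  have t: "smooth_on UNIV (\<lambda>y. \<theta> ((y - m) \<bullet> (y - m)))"
    by (rule smooth_on_compose[OF open_UNIV open_UNIV _ smooth_on_inner[OF open_UNIV w w] \<theta>]) simp
  have c: "smooth_on UNIV (\<lambda>y. cos (\<theta> ((y - m) \<bullet> (y - m))))"
    by (rule smooth_on_compose[OF open_UNIV open_UNIV _ t smooth_on_cos]) simp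
  have s: "smooth_on UNIV (\<lambda>y. sin (\<theta> ((y - m) \<bullet> (y - m))))"
    by (rule smooth_on_compose[OF open_UNIV open_UNIV _ t smooth_on_sin]) simp
  show ?thesis
    unfolding twist_def[abs_def] plane_rotation_def
    by (intro smooth_on_add smooth_on_diff smooth_on_scaleR smooth_on_mult smooth_on_const w i c s open_UNIV)
qed

text \<open>The variation of the angle contributes a multiple of \<open>b\<close>, the vector \<open>y - m\<close> projected to the plane and
  turned by a right angle. The multiple \<open>\<alpha> v\<close> depends on the derivative of the distance from \<open>m\<close>, which is \<open>0\<close> in
  the direction of \<open>b\<close>; so \<open>v \<mapsto> v + \<alpha> v b\<close> is a transvection.\<close>

lemma (in orthonormal_pair) twist_has_derivative:
  assumes \<theta>: "smooth_on UNIV \<theta>"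
  obtains \<alpha> b where "linear \<alpha>" "\<alpha> b = 0"
    "(twist m e1 e2 \<theta> has_derivative
      (\<lambda>v. plane_rotation e1 e2 (\<theta> ((y - m) \<bullet> (y - m))) (v + \<alpha> v *\<^sub>R b))) (at y)"
proof -
  define w where "w = y - m"
  define t where "t = \<theta> (w \<bullet> w)"
  define b where "b = (w \<bullet> e1) *\<^sub>R e2 - (w \<bullet> e2) *\<^sub>R e1"
  define \<alpha> where "\<alpha> v = frechet_derivative \<theta> (at (w \<bullet> w)) (2 * (w \<bullet> v))" for v
  have D: "(\<theta> has_derivative frechet_derivative \<theta> (at s)) (at s)" for s
    by (rule smooth_on_has_derivative[OF \<theta> UNIV_I])
  have lin: "linear (frechet_derivative \<theta> (at s))" for s using D has_derivative_linear by blast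
  have \<alpha>: "linear \<alpha>"
    by (rule linearI) (simp_all add: \<alpha>_def inner_add_right distrib_left linear_add[OF lin]
        linear_cmul[OF lin, unfolded real_scaleR_def] mult.left_commute[of 2])
  have "w \<bullet> b = 0" by (simp add: b_def inner_diff_right mult.commute)
  then have b: "\<alpha> b = 0" by (simp add: \<alpha>_def linear_0[OF lin])
  have "((\<lambda>y. (y - m) \<bullet> (y - m)) has_derivative (\<lambda>v. 2 * (w \<bullet> v))) (at y)"
    by (rule derivative_eq_intros refl)+ (simp add: fun_eq_iff w_def inner_commute)
  then have t': "((\<lambda>y. \<theta> ((y - m) \<bullet> (y - m))) has_derivative \<alpha>) (at y)"
    using diff_chain_at[OF _ D, of "\<lambda>y. (y - m) \<bullet> (y - m)"] by (simp add: o_def \<alpha>_def[abs_def] w_def)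
  have i': "((\<lambda>y. (y - m) \<bullet> e) has_derivative (\<lambda>v. v \<bullet> e)) (at y)" for e
    by (rule derivative_eq_intros refl)+ simp
  have A: "((\<lambda>y. cos (\<theta> ((y - m) \<bullet> (y - m))) * ((y - m) \<bullet> e1) - sin (\<theta> ((y - m) \<bullet> (y - m))) * ((y - m) \<bullet> e2)
        - (y - m) \<bullet> e1) has_derivative
      (\<lambda>v. cos t * (v \<bullet> e1) - sin t * (v \<bullet> e2) - v \<bullet> e1 + \<alpha> v * (- sin t * (w \<bullet> e1) - cos t * (w \<bullet> e2)))) (at y)"
    by (rule has_derivative_eq_rhs,
        (rule has_derivative_diff has_derivative_mult has_derivative_cos has_derivative_sin t' i')+)
      (simp add: fun_eq_iff t_def w_def algebra_simps)
  have B: "((\<lambda>y. sin (\<theta> ((y - m) \<bullet> (y - m))) * ((y - m) \<bullet> e1) + cos (\<theta> ((y - m) \<bullet> (y - m))) * ((y - m) \<bullet> e2)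
        - (y - m) \<bullet> e2) has_derivative
      (\<lambda>v. sin t * (v \<bullet> e1) + cos t * (v \<bullet> e2) - v \<bullet> e2 + \<alpha> v * (cos t * (w \<bullet> e1) - sin t * (w \<bullet> e2)))) (at y)"
    by (rule has_derivative_eq_rhs,
        (rule has_derivative_diff has_derivative_add has_derivative_mult has_derivative_cos has_derivative_sin t' i')+)
      (simp add: fun_eq_iff t_def w_def algebra_simps)
  have id: "((\<lambda>y. y - m) has_derivative (\<lambda>v. v)) (at y)"
    by (rule derivative_eq_intros refl)+ simp
  have "(twist m e1 e2 \<theta> has_derivative (\<lambda>v. 0 + (v
      + (cos t * (v \<bullet> e1) - sin t * (v \<bullet> e2) - v \<bullet> e1 + \<alpha> v * (- sin t * (w \<bullet> e1) - cos t * (w \<bullet> e2))) *\<^sub>R e1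
      + (sin t * (v \<bullet> e1) + cos t * (v \<bullet> e2) - v \<bullet> e2 + \<alpha> v * (cos t * (w \<bullet> e1) - sin t * (w \<bullet> e2))) *\<^sub>R e2))) (at y)"
    unfolding twist_def[abs_def] plane_rotation_def
    by (intro has_derivative_add has_derivative_const has_derivative_scaleR_left A B id)
  moreover have "0 + (v
      + (cos t * (v \<bullet> e1) - sin t * (v \<bullet> e2) - v \<bullet> e1 + \<alpha> v * (- sin t * (w \<bullet> e1) - cos t * (w \<bullet> e2))) *\<^sub>R e1
      + (sin t * (v \<bullet> e1) + cos t * (v \<bullet> e2) - v \<bullet> e2 + \<alpha> v * (cos t * (w \<bullet> e1) - sin t * (w \<bullet> e2))) *\<^sub>R e2)
      = plane_rotation e1 e2 t (v + \<alpha> v *\<^sub>R b)" for v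
    by (simp add: plane_rotation_def b_def inner_add_left inner_diff_left algebra_simps)
  ultimately have "(twist m e1 e2 \<theta> has_derivative (\<lambda>v. plane_rotation e1 e2 t (v + \<alpha> v *\<^sub>R b))) (at y)"
    by simp
  then show ?thesis using that[OF \<alpha> b] by (simp add: t_def w_def)
qed

lemma (in orthonormal_pair) twist_isometric:
  "(twist m e1 e2 \<theta> y - m) \<bullet> (twist m e1 e2 \<theta> y - m) = (y - m) \<bullet> (y - m)"
  by (simp add: twist_def plane_rotation_norm)

lemma (in orthonormal_pair) twist_inverse:
  "twist m e1 e2 (\<lambda>s. - \<theta> s) (twist m e1 e2 \<theta> y) = y"
  unfolding twist_def[of m e1 e2 "\<lambda>s. - \<theta> s"] twist_isometric
  by (simp add: twist_def plane_rotation_add)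

lemma (in orthonormal_pair) twist_unimodular:
  assumes "smooth_on UNIV \<theta>" "top_form \<omega>"
  shows "scales_form \<omega> (frechet_derivative (twist m e1 e2 \<theta>) (at y)) 1"
proof -
  interpret top_form \<omega> by fact
  obtain \<alpha> b where "linear \<alpha>" "\<alpha> b = 0"
    and d: "(twist m e1 e2 \<theta> has_derivative
      (\<lambda>v. plane_rotation e1 e2 (\<theta> ((y - m) \<bullet> (y - m))) (v + \<alpha> v *\<^sub>R b))) (at y)"
    using twist_has_derivative[OF assms(1)] by blast
  then have "scales_form \<omega> (\<lambda>v. plane_rotation e1 e2 (\<theta> ((y - m) \<bullet> (y - m))) (v + \<alpha> v *\<^sub>R b)) (1 * 1)"
    by (intro scales_form_compose scales_plane_rotation scales_transvection orthonormal_pair_axioms)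
  then show ?thesis unfolding frechet_derivative_at[OF d, symmetric] by simp
qed

text \<open>The distance from \<open>m\<close> is kept so that the map preserves every set which contains the closed
  ball of radius \<open>r\<close>, in particular the image of a chart. The inverse appears as a parameter because
  its smoothness is the same property with the two maps exchanged.\<close>

definition unimodular_diffeo :: "('e::euclidean_space \<Rightarrow> 'e) \<Rightarrow> ('e \<Rightarrow> 'e) \<Rightarrow> 'e \<Rightarrow> real \<Rightarrow> bool" where
  "unimodular_diffeo \<Theta> \<Theta>' m r \<longleftrightarrow>
     smooth_on UNIV \<Theta> \<and> (\<forall>y. \<Theta>' (\<Theta> y) = y) \<and> (\<forall>y. r \<le> dist m y \<longrightarrow> \<Theta> y = y) \<and>
     (\<forall>y. dist m (\<Theta> y) = dist m y) \<and>
     (\<forall>\<omega> y. top_form \<omega> \<longrightarrow> scales_form \<omega> (frechet_derivative \<Theta> (at y)) 1)"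

text \<open>The plane contains the line through \<open>p\<close> and \<open>q\<close>, and the angle is \<open>\<pi>\<close> at their distance from
  the midpoint and \<open>0\<close> from the distance \<open>r\<close> on. The opposite angle gives the inverse.\<close>

lemma unimodular_half_turn:
  fixes p q :: "'e::euclidean_space"
  assumes n: "2 \<le> DIM('e)" and r: "dist p q / 2 < r"
  obtains \<Theta> \<Theta>' where "unimodular_diffeo \<Theta> \<Theta>' (midpoint p q) r" "unimodular_diffeo \<Theta>' \<Theta> (midpoint p q) r" "\<Theta> p = q"
proof (cases "p = q")
  case True
  have "unimodular_diffeo (\<lambda>y. y) (\<lambda>y. y) (midpoint p q) r"
    unfolding unimodular_diffeo_def
    by (auto intro: smooth_on_ident simp: scales_form_def frechet_derivative_identity[abs_def])
  then show ?thesis using that True by blast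
next
  case False
  define m where "m = midpoint p q"
  define a where "a = p - m"
  have "p = (1/2) *\<^sub>R p + (1/2) *\<^sub>R p" by (simp flip: scaleR_left_distrib)
  then have half: "a = (1/2) *\<^sub>R (p - q)"
    unfolding a_def m_def midpoint_def by (simp add: algebra_simps)
  then have a: "a \<noteq> 0" "norm a < r" using False r by (simp_all add: dist_norm)
  have "q = p - 2 *\<^sub>R a" unfolding half by simp
  then have q: "q = m - a" by (simp add: a_def algebra_simps scaleR_2)
  obtain x where x: "x \<noteq> 0" "orthogonal a x" using orthogonal_to_vector_exists[OF n] by blast
  define e1 e2 where "e1 = a /\<^sub>R norm a" and "e2 = x /\<^sub>R norm x"
  interpret orthonormal_pair e1 e2
    by unfold_locales (use a x in \<open>simp_all add: e1_def e2_def orthogonal_def dot_square_norm power2_eq_square\<close>)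
  have "(norm a)\<^sup>2 < r\<^sup>2" using a by (intro power_strict_mono) auto
  then obtain \<theta> where \<theta>: "smooth_on UNIV \<theta>" "\<theta> ((norm a)\<^sup>2) = pi" "\<And>s. s \<ge> r\<^sup>2 \<Longrightarrow> \<theta> s = 0"
    using smooth_cutoff[of "(norm a)\<^sup>2" "r\<^sup>2" pi] by blast
  have \<theta>': "smooth_on UNIV (\<lambda>s. - \<theta> s)"
    by (rule smooth_on_linear_comp[OF open_UNIV bounded_linear_minus[OF bounded_linear_ident] \<theta>(1)])
  have r0: "0 < r" using a norm_ge_zero[of a] by linarith
  have sq: "(y - m) \<bullet> (y - m) = (dist m y)\<^sup>2" for y
    by (simp add: dist_norm dot_square_norm norm_minus_commute)
  have fixed: "twist m e1 e2 \<theta> y = y" if "\<theta> ((dist m y)\<^sup>2) = 0" for \<theta> y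
    using that by (simp add: twist_def sq)
  have iso: "dist m (twist m e1 e2 \<theta> y) = dist m y" for \<theta> y
    using twist_isometric[of m \<theta> y] unfolding sq by (simp add: power2_eq_iff_nonneg)
  have big: "(dist m y)\<^sup>2 \<ge> r\<^sup>2" if "r \<le> dist m y" for y
    using that r0 by (intro power_mono) auto
  have 1: "unimodular_diffeo (twist m e1 e2 \<theta>) (twist m e1 e2 (\<lambda>s. - \<theta> s)) m r"
    unfolding unimodular_diffeo_def
    using twist_smooth[OF \<theta>(1)] twist_inverse fixed iso big \<theta>(3) twist_unimodular[OF \<theta>(1)] by simp
  have 2: "unimodular_diffeo (twist m e1 e2 (\<lambda>s. - \<theta> s)) (twist m e1 e2 \<theta>) m r"
    unfolding unimodular_diffeo_def
    using twist_smooth[OF \<theta>'] twist_inverse[of m "\<lambda>s. - \<theta> s"] fixed iso big \<theta>(3) twist_unimodular[OF \<theta>'] by simp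
  have "a = norm a *\<^sub>R e1" using a by (simp add: e1_def)
  then have "plane_rotation e1 e2 pi a = - a" using plane_rotation_pi[of "norm a"] by simp
  then have "twist m e1 e2 \<theta> p = q"
    using \<theta>(2) by (simp add: twist_def q dot_square_norm flip: a_def)
  then show ?thesis using that 1 2 unfolding m_def by blast
qed

section \<open>Automorphisms of a form\<close>

context manifold
begin

lemma representative_has_derivative:
  assumes \<phi>: "smooth_map M UNIV M \<phi>" and c: "c \<in> M" "x \<in> fst c" and d: "d \<in> M" "\<phi> x \<in> fst d"
  shows "((snd d \<circ> \<phi> \<circ> chart_inv c) has_derivative frechet_derivative (snd d \<circ> \<phi> \<circ> chart_inv c) (at (snd c x)))
    (at (snd c x))"
proof (rule smooth_on_has_derivative)
  show "smooth_on (snd c ` (UNIV \<inter> fst c \<inter> \<phi> -` fst d)) (snd d \<circ> \<phi> \<circ> chart_inv c)"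
    using \<phi> c(1) d(1) unfolding smooth_map_def by blast
  show "snd c x \<in> snd c ` (UNIV \<inter> fst c \<inter> \<phi> -` fst d)" using c d by blast
qed

lemma smooth_map_vimage_open:
  assumes "smooth_map M UNIV M \<phi>" "open S"
  shows "open (\<phi> -` S)"
  using assms unfolding smooth_map_def by (simp add: open_vimage)

text \<open>The definition of \<open>tangent_map\<close> uses a chart that is chosen arbitrarily; here both charts are free.\<close>

lemma tangent_map_eq:
  assumes \<phi>: "smooth_map M UNIV M \<phi>" and c: "c \<in> M" "x \<in> fst c" and d: "d \<in> M" "\<phi> x \<in> fst d"
    and v: "v \<in> tangent_space M x"
  shows "tangent_map M M \<phi> x v
    = coord_vector M d (\<phi> x) (frechet_derivative (snd d \<circ> \<phi> \<circ> chart_inv c) (at (snd c x)) (v c))"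
proof
  fix e
  let ?D = "\<lambda>d c. frechet_derivative (snd d \<circ> \<phi> \<circ> chart_inv c) (at (snd c x))"
  define b where "b = (SOME b. b \<in> charts_at M x)"
  have "\<exists>b. b \<in> charts_at M x" using chart_ex unfolding charts_at_def by blast
  then have "b \<in> charts_at M x" unfolding b_def by (rule someI_ex)
  then have b: "b \<in> M" "x \<in> fst b" by (auto simp: charts_at_def)
  show "tangent_map M M \<phi> x v e = coord_vector M d (\<phi> x) (?D d c (v c)) e"
  proof (cases "e \<in> M \<and> \<phi> x \<in> fst e")
    case False
    then show ?thesis by (auto simp: tangent_map_def coord_vector_def charts_at_def Let_def)
  next
    case True
    then have e: "e \<in> M" "\<phi> x \<in> fst e" by auto
    have 1: "((snd c \<circ> chart_inv b) has_derivative transition b c x) (at (snd b x))"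
      by (rule transition_has_derivative[OF b(1) c(1) b(2) c(2)])
    have "((snd d \<circ> \<phi> \<circ> chart_inv c) has_derivative ?D d c) (at ((snd c \<circ> chart_inv b) (snd b x)))"
      using representative_has_derivative[OF \<phi> c d] b by simp
    from diff_chain_at[OF 1 this]
    have 2: "((snd d \<circ> \<phi> \<circ> chart_inv c) \<circ> (snd c \<circ> chart_inv b) has_derivative ?D d c \<circ> transition b c x) (at (snd b x))" .
    have "((snd e \<circ> chart_inv d) has_derivative transition d e (\<phi> x))
        (at (((snd d \<circ> \<phi> \<circ> chart_inv c) \<circ> (snd c \<circ> chart_inv b)) (snd b x)))"
      using transition_has_derivative[OF d(1) e(1) d(2) e(2)] b c by simp
    from diff_chain_at[OF 2 this]
    have "((snd e \<circ> chart_inv d) \<circ> ((snd d \<circ> \<phi> \<circ> chart_inv c) \<circ> (snd c \<circ> chart_inv b)) has_derivative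
        transition d e (\<phi> x) \<circ> (?D d c \<circ> transition b c x)) (at (snd b x))" .
    then have "((snd e \<circ> \<phi> \<circ> chart_inv b) has_derivative
        transition d e (\<phi> x) \<circ> (?D d c \<circ> transition b c x)) (at (snd b x))"
    proof (rule has_derivative_transform_within_open)
      show "open (snd b ` (fst b \<inter> (fst c \<inter> \<phi> -` fst d)))"
        by (intro chart_image_open b(1) open_Int chart_open(1)[OF c(1)] smooth_map_vimage_open[OF \<phi>] chart_open(1)[OF d(1)])
      show "snd b x \<in> snd b ` (fst b \<inter> (fst c \<inter> \<phi> -` fst d))" using b c d by blast
    qed (use b(1) c(1) d(1) in auto)
    then have "?D e b = transition d e (\<phi> x) \<circ> (?D d c \<circ> transition b c x)"
      using frechet_derivative_at by metis
    moreover have "v c = transition b c x (v b)" by (rule tangent_component[OF v b c])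
    ultimately have "?D e b (v b) = transition d e (\<phi> x) (?D d c (v c))" by simp
    moreover have "tangent_map M M \<phi> x v e = ?D e b (v b)"
      using e by (simp add: tangent_map_def charts_at_def Let_def b_def)
    ultimately show ?thesis using e by (simp add: coord_vector_eq)
  qed
qed

lemma tangent_map_in:
  assumes "smooth_map M UNIV M \<phi>" "v \<in> tangent_space M x"
  shows "tangent_map M M \<phi> x v \<in> tangent_space M (\<phi> x)"
proof -
  obtain c d where cd: "c \<in> M" "x \<in> fst c" "d \<in> M" "\<phi> x \<in> fst d" using chart_ex by metis
  show ?thesis unfolding tangent_map_eq[OF assms(1) cd assms(2)] using cd by simp
qed

lemma smooth_map_compose:
  assumes \<phi>: "smooth_map M UNIV M \<phi>" and \<psi>: "smooth_map M UNIV M \<psi>"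
  shows "smooth_map M UNIV M (\<psi> \<circ> \<phi>)"
  unfolding smooth_map_def
proof (intro conjI ballI)
  show "continuous_on UNIV (\<psi> \<circ> \<phi>)"
    using \<phi> \<psi> unfolding smooth_map_def by (intro continuous_on_compose) (auto intro: continuous_on_subset)
next
  fix c e assume c: "c \<in> M" and e: "e \<in> M"
  show "smooth_on (snd c ` (UNIV \<inter> fst c \<inter> (\<psi> \<circ> \<phi>) -` fst e)) (snd e \<circ> (\<psi> \<circ> \<phi>) \<circ> chart_inv c)"
  proof (rule smooth_on_local)
    fix z assume "z \<in> snd c ` (UNIV \<inter> fst c \<inter> (\<psi> \<circ> \<phi>) -` fst e)"
    then obtain x where x: "z = snd c x" "x \<in> fst c" "\<psi> (\<phi> x) \<in> fst e" by auto
    obtain d where d: "d \<in> M" "\<phi> x \<in> fst d" using chart_ex by blast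
    let ?S = "snd d ` (fst d \<inter> \<psi> -` fst e)"
    let ?T = "snd c ` (fst c \<inter> \<phi> -` (fst d \<inter> \<psi> -` fst e))"
    have S: "open ?S"
      by (intro chart_image_open d(1) smooth_map_vimage_open[OF \<psi>] chart_open(1)[OF e])
    have T: "open ?T"
      by (intro chart_image_open c smooth_map_vimage_open[OF \<phi>] open_Int chart_open(1)[OF d(1)]
          smooth_map_vimage_open[OF \<psi>] chart_open(1)[OF e])
    have "smooth_on (snd c ` (UNIV \<inter> fst c \<inter> \<phi> -` fst d)) (snd d \<circ> \<phi> \<circ> chart_inv c)"
      using \<phi> c d(1) unfolding smooth_map_def by blast
    then have s1: "smooth_on ?T (snd d \<circ> \<phi> \<circ> chart_inv c)" by (rule smooth_on_subset) blast
    have "smooth_on (snd d ` (UNIV \<inter> fst d \<inter> \<psi> -` fst e)) (snd e \<circ> \<psi> \<circ> chart_inv d)"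
      using \<psi> d(1) e unfolding smooth_map_def by blast
    then have s2: "smooth_on ?S (snd e \<circ> \<psi> \<circ> chart_inv d)" by (rule smooth_on_subset) blast
    have "smooth_on ?T (\<lambda>z. (snd e \<circ> \<psi> \<circ> chart_inv d) ((snd d \<circ> \<phi> \<circ> chart_inv c) z))"
      by (rule smooth_on_compose[OF T S _ s1 s2]) (use c in auto)
    then have "smooth_on ?T (snd e \<circ> (\<psi> \<circ> \<phi>) \<circ> chart_inv c)"
      by (rule smooth_on_cong[OF T, rotated]) (use c d(1) in auto)
    moreover have "z \<in> ?T" using x d by blast
    ultimately show "\<exists>T. open T \<and> z \<in> T \<and> smooth_on T (snd e \<circ> (\<psi> \<circ> \<phi>) \<circ> chart_inv c)" using T by blast
  qed
qed

lemma tangent_map_identity_near: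
  assumes "smooth_map M UNIV M \<phi>" "open U" "x \<in> U" "\<And>z. z \<in> U \<Longrightarrow> \<phi> z = z" "v \<in> tangent_space M x"
  shows "tangent_map M M \<phi> x v = v"
proof -
  obtain c where c: "c \<in> M" "x \<in> fst c" using chart_ex by blast
  have x: "\<phi> x = x" using assms by simp
  have "(id has_derivative id) (at (snd c x))" by (simp add: id_def)
  then have "((snd c \<circ> \<phi> \<circ> chart_inv c) has_derivative id) (at (snd c x))"
  proof (rule has_derivative_transform_within_open)
    show "open (snd c ` (fst c \<inter> U))" by (rule chart_image_open[OF c(1) assms(2)])
    show "snd c x \<in> snd c ` (fst c \<inter> U)" using c assms by blast
  qed (use c assms(4) in auto)
  then have "frechet_derivative (snd c \<circ> \<phi> \<circ> chart_inv c) (at (snd c x)) = id"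
    using frechet_derivative_at by metis
  then show ?thesis
    using tangent_map_eq[OF assms(1) c, of c v] c assms(5) x by simp
qed

lemma multisymplectic_compose:
  assumes "\<phi> \<in> multisymplectic_diffeos M \<Omega>" "\<psi> \<in> multisymplectic_diffeos M \<Omega>"
  shows "\<psi> \<circ> \<phi> \<in> multisymplectic_diffeos M \<Omega>"
proof -
  have \<phi>: "bij \<phi>" "smooth_map M UNIV M \<phi>" "smooth_map M UNIV M (inv \<phi>)" "pullback M M \<phi> \<Omega> = \<Omega>"
    and \<psi>: "bij \<psi>" "smooth_map M UNIV M \<psi>" "smooth_map M UNIV M (inv \<psi>)" "pullback M M \<psi> \<Omega> = \<Omega>"
    using assms by (auto simp: multisymplectic_diffeos_def diffeomorphism_def)
  have chain: "tangent_map M M (\<psi> \<circ> \<phi>) x v = tangent_map M M \<psi> (\<phi> x) (tangent_map M M \<phi> x v)"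
    if v: "v \<in> tangent_space M x" for x v
  proof -
    obtain c d e where c: "c \<in> M" "x \<in> fst c" and d: "d \<in> M" "\<phi> x \<in> fst d" and e: "e \<in> M" "\<psi> (\<phi> x) \<in> fst e"
      using chart_ex by metis
    let ?D\<phi> = "frechet_derivative (snd d \<circ> \<phi> \<circ> chart_inv c) (at (snd c x))"
    let ?D\<psi> = "frechet_derivative (snd e \<circ> \<psi> \<circ> chart_inv d) (at (snd d (\<phi> x)))"
    have "((snd e \<circ> \<psi> \<circ> chart_inv d) has_derivative ?D\<psi>) (at ((snd d \<circ> \<phi> \<circ> chart_inv c) (snd c x)))"
      using representative_has_derivative[OF \<psi>(2) d e] c by simp
    from diff_chain_at[OF representative_has_derivative[OF \<phi>(2) c d] this]
    have "((snd e \<circ> \<psi> \<circ> chart_inv d) \<circ> (snd d \<circ> \<phi> \<circ> chart_inv c) has_derivative ?D\<psi> \<circ> ?D\<phi>) (at (snd c x))" .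
    then have "((snd e \<circ> (\<psi> \<circ> \<phi>) \<circ> chart_inv c) has_derivative ?D\<psi> \<circ> ?D\<phi>) (at (snd c x))"
    proof (rule has_derivative_transform_within_open)
      show "open (snd c ` (fst c \<inter> \<phi> -` fst d))"
        by (intro chart_image_open c(1) smooth_map_vimage_open[OF \<phi>(2)] chart_open(1)[OF d(1)])
      show "snd c x \<in> snd c ` (fst c \<inter> \<phi> -` fst d)" using c d by blast
    qed (use c(1) d(1) in auto)
    then have D: "frechet_derivative (snd e \<circ> (\<psi> \<circ> \<phi>) \<circ> chart_inv c) (at (snd c x)) = ?D\<psi> \<circ> ?D\<phi>"
      using frechet_derivative_at by metis
    have t: "tangent_map M M \<phi> x v = coord_vector M d (\<phi> x) (?D\<phi> (v c))"
      by (rule tangent_map_eq[OF \<phi>(2) c d v])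
    have "tangent_map M M (\<psi> \<circ> \<phi>) x v = coord_vector M e (\<psi> (\<phi> x)) (?D\<psi> (?D\<phi> (v c)))"
      using tangent_map_eq[OF smooth_map_compose[OF \<phi>(2) \<psi>(2)] c e(1) _ v] e(2) by (simp add: D)
    moreover have "tangent_map M M \<psi> (\<phi> x) (tangent_map M M \<phi> x v)
        = coord_vector M e (\<psi> (\<phi> x)) (?D\<psi> (tangent_map M M \<phi> x v d))"
      by (rule tangent_map_eq[OF \<psi>(2) d e tangent_map_in[OF \<phi>(2) v]])
    moreover have "tangent_map M M \<phi> x v d = ?D\<phi> (v c)" unfolding t using d by simp
    ultimately show ?thesis by simp
  qed
  have "pullback M M (\<psi> \<circ> \<phi>) \<Omega> x vs = \<Omega> x vs" for x vs
  proof (cases "set vs \<subseteq> tangent_space M x")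
    case False
    then show ?thesis using fun_cong[OF fun_cong[OF \<phi>(4), of x], of vs] by (simp add: pullback_def)
  next
    case True
    let ?ws = "map (tangent_map M M \<phi> x) vs"
    have ws: "set ?ws \<subseteq> tangent_space M (\<phi> x)" using True tangent_map_in[OF \<phi>(2)] by auto
    have "map (tangent_map M M (\<psi> \<circ> \<phi>) x) vs = map (tangent_map M M \<psi> (\<phi> x)) ?ws"
      using True chain by auto
    then have "pullback M M (\<psi> \<circ> \<phi>) \<Omega> x vs = pullback M M \<psi> \<Omega> (\<phi> x) ?ws"
      using True ws by (simp add: pullback_def del: map_map)
    also have "\<dots> = pullback M M \<phi> \<Omega> x vs" using True \<psi>(4) by (simp add: pullback_def)
    finally show ?thesis using \<phi>(4) by simp
  qed
  then have "pullback M M (\<psi> \<circ> \<phi>) \<Omega> = \<Omega>" by blast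
  moreover have "inv (\<psi> \<circ> \<phi>) = inv \<phi> \<circ> inv \<psi>" using \<phi>(1) \<psi>(1) by (simp add: o_inv_distrib)
  ultimately show ?thesis
    using bij_comp[OF \<phi>(1) \<psi>(1)] smooth_map_compose \<phi> \<psi>
    by (simp add: multisymplectic_diffeos_def diffeomorphism_def)
qed

section \<open>Extension of local maps by the identity\<close>

definition extend_by_identity :: "('a, 'e) chart \<Rightarrow> ('e \<Rightarrow> 'e) \<Rightarrow> 'a \<Rightarrow> 'a" where
  "extend_by_identity c \<Theta> x = (if x \<in> fst c then chart_inv c (\<Theta> (snd c x)) else x)"

context
  fixes c :: "('a, 'e) chart" and \<Theta> \<Theta>' :: "'e \<Rightarrow> 'e" and m r
  assumes c: "c \<in> M" and ball: "cball m r \<subseteq> chart_image c" and \<Theta>: "unimodular_diffeo \<Theta> \<Theta>' m r"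
begin

lemma unimodular_preserves_image:
  assumes "y \<in> chart_image c" shows "\<Theta> y \<in> chart_image c"
proof (cases "r \<le> dist m y")
  case True then show ?thesis using \<Theta> assms by (simp add: unimodular_diffeo_def)
next
  case False
  then have "\<Theta> y \<in> cball m r" using \<Theta> by (simp add: unimodular_diffeo_def)
  then show ?thesis using ball by blast
qed

lemma extend_in_chart:
  assumes "x \<in> fst c"
  shows "extend_by_identity c \<Theta> x \<in> fst c" "snd c (extend_by_identity c \<Theta> x) = \<Theta> (snd c x)"
  using assms c unimodular_preserves_image by (simp_all add: extend_by_identity_def)

lemma extend_off_ball:
  assumes "x \<notin> chart_inv c ` cball m r"
  shows "extend_by_identity c \<Theta> x = x"
proof (cases "x \<in> fst c")
  case True
  then have "snd c x \<notin> cball m r" using assms c by (metis chart_inv_left(1) imageI)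
  then have "\<Theta> (snd c x) = snd c x" using \<Theta> by (simp add: unimodular_diffeo_def)
  then show ?thesis using True c by (simp add: extend_by_identity_def)
qed (simp add: extend_by_identity_def)

lemma extend_left_inverse: "extend_by_identity c \<Theta>' (extend_by_identity c \<Theta> x) = x"
proof (cases "x \<in> fst c")
  case True
  then show ?thesis
    using extend_in_chart[OF True] \<Theta> c unfolding extend_by_identity_def[of c \<Theta>'] unimodular_diffeo_def by simp
qed (simp add: extend_by_identity_def)

text \<open>The ball is compact and the space is Hausdorff, so the support is closed in the whole manifold.\<close>

lemma open_off_ball: "open (- (chart_inv c ` cball m r))"
proof -
  have "compact (chart_inv c ` cball m r)"
    using chart_continuous(2)[OF c] ball by (intro compact_continuous_image) (auto intro: continuous_on_subset)
  then show ?thesis using compact_imp_closed by blast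
qed

lemma extend_smooth: "smooth_map M UNIV M (extend_by_identity c \<Theta>)"
proof -
  let ?\<phi> = "extend_by_identity c \<Theta>" and ?V = "- (chart_inv c ` cball m r)"
  have smooth: "smooth_on UNIV \<Theta>" using \<Theta> by (simp add: unimodular_diffeo_def)
  have "continuous_on (fst c) (\<lambda>x. chart_inv c (\<Theta> (snd c x)))"
  proof (rule continuous_on_compose2[OF chart_continuous(2)[OF c]])
    show "continuous_on (fst c) (\<lambda>x. \<Theta> (snd c x))"
      by (rule continuous_on_compose2[OF smooth_on_continuous[OF smooth] chart_continuous(1)[OF c]]) simp
    show "(\<lambda>x. \<Theta> (snd c x)) ` fst c \<subseteq> chart_image c"
      using unimodular_preserves_image c by auto
  qed
  then have "continuous_on (fst c) ?\<phi>"
    by (rule continuous_on_eq) (simp add: extend_by_identity_def)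
  moreover have "continuous_on ?V ?\<phi>"
    by (rule continuous_on_eq[OF continuous_on_id]) (simp add: extend_off_ball)
  ultimately have "continuous_on (fst c \<union> ?V) ?\<phi>"
    using continuous_on_open_Un[OF chart_open(1)[OF c] open_off_ball] by blast
  moreover have cover: "x \<in> fst c \<or> x \<in> ?V" for x
    using ball chart_inv_right(1)[OF c] by auto
  then have "fst c \<union> ?V = UNIV" by blast
  ultimately have cont: "continuous_on UNIV ?\<phi>" by simp
  show ?thesis
    unfolding smooth_map_def
  proof (intro conjI ballI cont)
    fix d d' assume d: "d \<in> M" and d': "d' \<in> M"
    let ?f = "snd d' \<circ> ?\<phi> \<circ> chart_inv d"
    have pre: "open (?\<phi> -` fst d')" using cont chart_open(1)[OF d'] by (simp add: open_vimage)
    show "smooth_on (snd d ` (UNIV \<inter> fst d \<inter> ?\<phi> -` fst d')) ?f"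
    proof (rule smooth_on_local)
      fix z assume "z \<in> snd d ` (UNIV \<inter> fst d \<inter> ?\<phi> -` fst d')"
      then obtain x where x: "z = snd d x" "x \<in> fst d" "?\<phi> x \<in> fst d'" by auto
      consider "x \<in> fst c" | "x \<in> ?V" using cover by blast
      then show "\<exists>T. open T \<and> z \<in> T \<and> smooth_on T ?f"
      proof cases
        case 1
        let ?T = "snd d ` (fst d \<inter> (fst c \<inter> ?\<phi> -` fst d'))"
        let ?S = "snd c ` (fst c \<inter> fst d')"
        have T: "open ?T" by (intro chart_image_open d open_Int pre chart_open(1)[OF c])
        have S: "open ?S" by (intro chart_image_open c chart_open(1)[OF d'])
        have "smooth_on ?T (snd c \<circ> chart_inv d)"
          by (rule smooth_on_subset[OF transition_smooth[OF d c]]) blast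
        then have s: "smooth_on ?T (\<lambda>z. \<Theta> ((snd c \<circ> chart_inv d) z))"
          by (rule smooth_on_compose[OF T open_UNIV _ _ smooth, rotated]) simp
        have "\<Theta> ((snd c \<circ> chart_inv d) z) \<in> ?S" if "z \<in> ?T" for z
        proof -
          obtain x' where x': "z = snd d x'" "x' \<in> fst d" "x' \<in> fst c" "?\<phi> x' \<in> fst d'" using \<open>z \<in> ?T\<close> by auto
          have "\<Theta> ((snd c \<circ> chart_inv d) z) = snd c (?\<phi> x')"
            using x' d extend_in_chart(2) by simp
          then show ?thesis using x' extend_in_chart(1) by auto
        qed
        then have "smooth_on ?T (\<lambda>z. (snd d' \<circ> chart_inv c) (\<Theta> ((snd c \<circ> chart_inv d) z)))"
          by (intro smooth_on_compose[OF T S _ s transition_smooth[OF c d']]) blast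
        then have "smooth_on ?T ?f"
          by (rule smooth_on_cong[OF T, rotated]) (use d in \<open>auto simp: extend_by_identity_def\<close>)
        moreover have "z \<in> ?T" using x 1 by blast
        ultimately show ?thesis using T by blast
      next
        case 2
        let ?T = "snd d ` (fst d \<inter> (?V \<inter> ?\<phi> -` fst d'))"
        have T: "open ?T" by (intro chart_image_open d open_Int pre open_off_ball)
        have "?T \<subseteq> snd d ` (fst d \<inter> fst d')" using extend_off_ball by auto
        then have "smooth_on ?T (snd d' \<circ> chart_inv d)"
          using smooth_on_subset[OF transition_smooth[OF d d']] by blast
        then have "smooth_on ?T ?f"
          by (rule smooth_on_cong[OF T, rotated]) (use d extend_off_ball in auto)
        moreover have "z \<in> ?T" using x 2 by blast
        ultimately show ?thesis using T by blast
      qed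
    qed
  qed
qed

text \<open>In the chart \<open>c\<close> the form has the constant value \<open>\<eta>\<close>, which the derivative of \<open>\<Theta>\<close> preserves; off the
  ball the map is the identity near each point.\<close>

lemma extend_pullback:
  assumes \<Omega>: "differential_form M DIM('e) \<Omega>" and \<eta>: "top_form \<eta>"
    and const: "\<And>y us. y \<in> chart_image c \<Longrightarrow> length us = DIM('e) \<Longrightarrow> form_rep M c \<Omega> y us = \<eta> us"
  shows "pullback M M (extend_by_identity c \<Theta>) \<Omega> = \<Omega>"
proof (intro ext)
  fix x vs
  let ?\<phi> = "extend_by_identity c \<Theta>"
  have zero: "\<Omega> x vs = 0" if "\<not> (length vs = DIM('e) \<and> set vs \<subseteq> tangent_space M x)" for x vs
    using \<Omega> that unfolding differential_form_def alternating_forms_def by blast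
  show "pullback M M ?\<phi> \<Omega> x vs = \<Omega> x vs"
  proof (cases "length vs = DIM('e) \<and> set vs \<subseteq> tangent_space M x")
    case False
    then have "pullback M M ?\<phi> \<Omega> x vs = 0"
      using zero[of "map (tangent_map M M ?\<phi> x) vs" "?\<phi> x"] by (auto simp: pullback_def)
    then show ?thesis using zero[OF False] by simp
  next
    case True
    show ?thesis
    proof (cases "x \<in> fst c")
      case x: True
      let ?y = "snd c x" and ?D = "frechet_derivative \<Theta> (at (snd c x))"
      define us where "us = map (\<lambda>v. v c) vs"
      have \<phi>x: "?\<phi> x \<in> fst c" "snd c (?\<phi> x) = \<Theta> ?y" by (rule extend_in_chart[OF x])+
      have "(\<Theta> has_derivative ?D) (at ?y)"
        using \<Theta> smooth_on_has_derivative unfolding unimodular_diffeo_def by blast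
      then have "((snd c \<circ> ?\<phi> \<circ> chart_inv c) has_derivative ?D) (at ?y)"
        by (rule has_derivative_transform_within_open[OF _ chart_open(2)[OF c]])
          (use c x in \<open>simp_all add: extend_in_chart\<close>)
      then have D: "frechet_derivative (snd c \<circ> ?\<phi> \<circ> chart_inv c) (at ?y) = ?D"
        using frechet_derivative_at by metis
      have "tangent_map M M ?\<phi> x v = coord_vector M c (?\<phi> x) (?D (v c))" if "v \<in> set vs" for v
        using tangent_map_eq[OF extend_smooth c x c \<phi>x(1), of v] True that D by auto
      then have "map (tangent_map M M ?\<phi> x) vs = map (coord_vector M c (?\<phi> x)) (map ?D us)"
        by (simp add: us_def)
      then have "pullback M M ?\<phi> \<Omega> x vs = \<Omega> (?\<phi> x) (map (coord_vector M c (?\<phi> x)) (map ?D us))"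
        using True by (simp add: pullback_def)
      also have "\<dots> = form_rep M c \<Omega> (snd c (?\<phi> x)) (map ?D us)"
        unfolding form_rep_def chart_inv_left(1)[OF c \<phi>x(1)] ..
      also have "\<dots> = \<eta> (map ?D us)"
        using const[OF chart_inv_left(2)[OF c \<phi>x(1)]] True by (simp add: us_def)
      also have "\<dots> = \<eta> us"
      proof -
        have "length us = DIM('e)" using True by (simp add: us_def)
        then show ?thesis using \<Theta> \<eta> unfolding unimodular_diffeo_def scales_form_def by simp
      qed
      also have "\<dots> = form_rep M c \<Omega> ?y us"
        using const[OF chart_inv_left(2)[OF c x]] True by (simp add: us_def)
      also have "\<dots> = \<Omega> x vs"
        using form_eq_form_rep[OF c x] True by (simp add: us_def)
      finally show ?thesis .
    next
      case False
      then have xV: "x \<in> - (chart_inv c ` cball m r)" using ball chart_inv_right(1)[OF c] by blast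
      have "tangent_map M M ?\<phi> x v = v" if "v \<in> set vs" for v
        by (rule tangent_map_identity_near[OF extend_smooth open_off_ball xV])
          (use extend_off_ball True that in auto)
      then have "map (tangent_map M M ?\<phi> x) vs = vs" by (intro map_idI) 
      then show ?thesis using True False by (simp add: pullback_def extend_by_identity_def)
    qed
  qed
qed

end

lemma extend_in_group:
  assumes c: "c \<in> M" and ball: "cball m r \<subseteq> chart_image c"
    and \<Theta>: "unimodular_diffeo \<Theta> \<Theta>' m r" "unimodular_diffeo \<Theta>' \<Theta> m r"
    and \<Omega>: "differential_form M DIM('e) \<Omega>" and \<eta>: "top_form \<eta>"
    and const: "\<And>y us. y \<in> chart_image c \<Longrightarrow> length us = DIM('e) \<Longrightarrow> form_rep M c \<Omega> y us = \<eta> us"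
  shows "extend_by_identity c \<Theta> \<in> multisymplectic_diffeos M \<Omega>"
proof -
  let ?\<phi> = "extend_by_identity c \<Theta>" and ?\<psi> = "extend_by_identity c \<Theta>'"
  have "?\<psi> (?\<phi> x) = x" "?\<phi> (?\<psi> x) = x" for x
    by (rule extend_left_inverse[OF c ball \<Theta>(1)], rule extend_left_inverse[OF c ball \<Theta>(2)])
  then have "bij ?\<phi>" "inv ?\<phi> = ?\<psi>" by (metis bijI', metis inv_equality)
  then show ?thesis
    using extend_smooth[OF c ball \<Theta>(1)] extend_smooth[OF c ball \<Theta>(2)] extend_pullback[OF c ball \<Theta>(1) \<Omega> \<eta> const]
    by (simp add: multisymplectic_diffeos_def diffeomorphism_def)
qed

lemma identity_in_group:
  assumes "differential_form M k \<Omega>"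
  shows "(\<lambda>x. x) \<in> multisymplectic_diffeos M \<Omega>"
proof -
  have s: "smooth_map M UNIV M (\<lambda>x. x)"
    unfolding smooth_map_def
  proof (intro conjI ballI continuous_on_id)
    fix c d assume "c \<in> M" "d \<in> M"
    then show "smooth_on (snd c ` (UNIV \<inter> fst c \<inter> (\<lambda>x. x) -` fst d)) (snd d \<circ> (\<lambda>x. x) \<circ> chart_inv c)"
      using transition_smooth[of c d] by (simp add: o_def)
  qed
  have "pullback M M (\<lambda>x. x) \<Omega> x vs = \<Omega> x vs" for x vs
  proof (cases "set vs \<subseteq> tangent_space M x")
    case True
    then have "map (tangent_map M M (\<lambda>x. x) x) vs = vs"
      by (intro map_idI tangent_map_identity_near[OF s open_UNIV]) auto
    then show ?thesis using True by (simp add: pullback_def)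
  next
    case False
    then show ?thesis
      using assms unfolding differential_form_def alternating_forms_def pullback_def by auto
  qed
  then have "pullback M M (\<lambda>x. x) \<Omega> = \<Omega>" by blast
  moreover have "inv (\<lambda>x. x) = (\<lambda>x::'a. x)" using inv_id by (simp add: id_def)
  ultimately show ?thesis using s bij_id by (simp add: multisymplectic_diffeos_def diffeomorphism_def id_def)
qed

end

section \<open>Transitivity\<close>

context manifold
begin

lemma chart_ball:
  assumes "c \<in> M" "z \<in> fst c" "open V" "z \<in> V"
  obtains \<rho> where "\<rho> > 0" "ball (snd c z) \<rho> \<subseteq> snd c ` (fst c \<inter> V)"
  using chart_image_open[OF assms(1,3)] assms(2,4) open_contains_ball by blast

lemma chart_inv_ball_open:
  assumes "c \<in> M" "ball y \<rho> \<subseteq> chart_image c"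
  shows "open (chart_inv c ` ball y \<rho>)"
proof -
  have "chart_inv c ` ball y \<rho> = fst c \<inter> snd c -` ball y \<rho>"
  proof (intro equalityI subsetI)
    fix x assume "x \<in> chart_inv c ` ball y \<rho>"
    then show "x \<in> fst c \<inter> snd c -` ball y \<rho>" using assms chart_inv_right by auto
  next
    fix x assume "x \<in> fst c \<inter> snd c -` ball y \<rho>"
    then show "x \<in> chart_inv c ` ball y \<rho>" using assms(1) chart_inv_left(1) by (metis IntE imageI vimageE)
  qed
  then show ?thesis
    using continuous_open_preimage[OF chart_continuous(1) chart_open(1) open_ball] assms(1) by metis
qed

text \<open>A coordinate ball around \<open>p\<close> stays connected without \<open>p\<close>, so it meets only one part of a separation
  of \<open>S - {p}\<close>. Adding it to that part gives a separation of \<open>S\<close>.\<close>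

lemma connected_delete_point:
  assumes n: "2 \<le> DIM('e)" and S: "open S" "connected S" and p: "(p :: 'a) \<in> S"
  shows "connected (S - {p})"
proof (rule connectedI)
  obtain c where c: "c \<in> M" "p \<in> fst c" using chart_ex by blast
  obtain \<rho> where \<rho>: "\<rho> > 0" "ball (snd c p) \<rho> \<subseteq> snd c ` (fst c \<inter> S)"
    by (rule chart_ball[OF c S(1) p])
  have image: "ball (snd c p) \<rho> \<subseteq> chart_image c" using \<rho>(2) unfolding chart_image_def by blast
  define V where "V = chart_inv c ` ball (snd c p) \<rho>"
  have V: "open V" unfolding V_def by (rule chart_inv_ball_open[OF c(1) image])
  have "p = chart_inv c (snd c p)" using c by simp
  then have pV: "p \<in> V" unfolding V_def using \<rho>(1) by (metis centre_in_ball imageI)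
  have VS: "V \<subseteq> S" using \<rho>(2) c(1) unfolding V_def by fastforce
  have "V - {p} = chart_inv c ` (ball (snd c p) \<rho> - {snd c p})"
  proof (intro equalityI subsetI)
    fix x assume "x \<in> V - {p}"
    then show "x \<in> chart_inv c ` (ball (snd c p) \<rho> - {snd c p})" using c by (auto simp: V_def)
  next
    fix x assume "x \<in> chart_inv c ` (ball (snd c p) \<rho> - {snd c p})"
    then obtain y where y: "x = chart_inv c y" "y \<in> ball (snd c p) \<rho>" "y \<noteq> snd c p" by blast
    then have "snd c x = y" using image c(1) chart_inv_right(2) by blast
    then show "x \<in> V - {p}" using y by (auto simp: V_def)
  qed
  moreover have "connected (ball (snd c p) \<rho> - {snd c p})"
    by (rule connected_open_delete[OF open_ball convex_connected[OF convex_ball] n])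
  ultimately have Vp: "connected (V - {p})"
    using image by (simp add: connected_continuous_image[OF continuous_on_subset[OF chart_continuous(2)[OF c(1)]]] subset_iff)
  have one: False if A: "open A" "open B" "B \<inter> (S - {p}) \<noteq> {}" "A \<inter> B \<inter> (S - {p}) = {}"
      "S - {p} \<subseteq> A \<union> B" "B \<inter> (V - {p}) = {}" for A B
  proof -
    let ?A = "(A \<inter> (S - {p})) \<union> V" and ?B = "B \<inter> (S - {p})"
    have "open (S - {p})" using S(1) by (rule open_delete)
    then have "open ?A" "open ?B" using A(1,2) V by (simp_all only: open_Un open_Int)
    moreover have "?A \<inter> ?B \<inter> S = {}" using A(4,6) by blast
    moreover have "S \<subseteq> ?A \<union> ?B" using A(5) pV by blast
    ultimately have "?A \<inter> S = {} \<or> ?B \<inter> S = {}" by (rule connectedD[OF S(2)])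
    then show False using A(3) pV p by blast
  qed
  fix A B
  assume *: "open A" "open B" "A \<inter> (S - {p}) \<noteq> {}" "B \<inter> (S - {p}) \<noteq> {}" "A \<inter> B \<inter> (S - {p}) = {}"
    "S - {p} \<subseteq> A \<union> B"
  have "A \<inter> (V - {p}) = {} \<or> B \<inter> (V - {p}) = {}"
    by (rule connectedD[OF Vp]) (use * VS in blast)+
  moreover have "B \<inter> A \<inter> (S - {p}) = {}" "S - {p} \<subseteq> B \<union> A" using *(5,6) by blast+
  ultimately show False using one[of A B] one[of B A] * by blast
qed

lemma connected_complement_finite:
  assumes n: "2 \<le> DIM('e)" and "finite F"
  shows "connected (- F :: 'a set)"
  using assms(2)
proof induction
  case empty
  then show ?case using manifold by (simp add: smooth_manifold_def)
next
  case (insert p F)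
  have "connected (- F - {p})"
    by (rule connected_delete_point[OF n _ insert.IH])
      (use insert.hyps in \<open>auto intro: finite_imp_closed\<close>)
  moreover have "- F - {p} = - insert p F" by blast
  ultimately show ?case by simp
qed

text \<open>The radii are such that points at distance less than \<open>\<rho>/4\<close> from the centre are at distance less
  than \<open>\<rho>/4\<close>, hence less than \<open>\<rho>/3\<close>, from their midpoint, and the ball of radius \<open>\<rho>/3\<close> about
  the midpoint lies in the ball of radius \<open>\<rho>\<close> about the centre.\<close>

lemma local_moves:
  assumes n: "2 \<le> DIM('e)" and \<Omega>: "differential_form M DIM('e) \<Omega>" and V: "open V" "z \<in> V"
    and c: "c \<in> M" "z \<in> fst c" and \<eta>: "top_form \<eta>"
    and const: "\<And>y us. y \<in> chart_image c \<Longrightarrow> length us = DIM('e) \<Longrightarrow> form_rep M c \<Omega> y us = \<eta> us"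
  obtains N where "open N" "z \<in> N" "N \<subseteq> V"
    "\<And>p q. p \<in> N \<Longrightarrow> q \<in> N \<Longrightarrow> \<exists>\<phi>\<in>multisymplectic_diffeos M \<Omega>. \<phi> p = q \<and> (\<forall>x. x \<notin> V \<longrightarrow> \<phi> x = x)"
proof -
  obtain \<rho> where \<rho>: "\<rho> > 0" "ball (snd c z) \<rho> \<subseteq> snd c ` (fst c \<inter> V)"
    by (rule chart_ball[OF c V])
  have image: "ball (snd c z) \<rho> \<subseteq> chart_image c" using \<rho>(2) unfolding chart_image_def by blast
  let ?B = "ball (snd c z) (\<rho>/4)"
  define N where "N = chart_inv c ` ?B"
  have B: "?B \<subseteq> ball (snd c z) \<rho>" using \<rho>(1) by (intro subset_ball) simp
  have "open N" unfolding N_def by (rule chart_inv_ball_open[OF c(1)]) (use B image in blast)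
  moreover have "z \<in> N"
  proof -
    have "z = chart_inv c (snd c z)" using c by simp
    then show ?thesis unfolding N_def using \<rho>(1) by (metis centre_in_ball imageI zero_less_divide_iff zero_less_numeral)
  qed
  moreover have "N \<subseteq> V"
  proof
    fix x assume "x \<in> N"
    then obtain y where "x = chart_inv c y" "y \<in> snd c ` (fst c \<inter> V)" using B \<rho>(2) unfolding N_def by blast
    then show "x \<in> V" using c(1) by auto
  qed
  moreover have "\<exists>\<phi>\<in>multisymplectic_diffeos M \<Omega>. \<phi> p = q \<and> (\<forall>x. x \<notin> V \<longrightarrow> \<phi> x = x)"
    if pq: "p \<in> N" "q \<in> N" for p q
  proof -
    obtain P where P: "p = chart_inv c P" "P \<in> ?B" using pq(1) unfolding N_def by blast
    obtain Q where Q: "q = chart_inv c Q" "Q \<in> ?B" using pq(2) unfolding N_def by blast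
    have PQ: "P \<in> chart_image c" using P(2) B image by blast
    have "dist P Q \<le> dist (snd c z) P + dist (snd c z) Q" by (metis dist_commute dist_triangle)
    then have "dist P Q / 2 < \<rho>/3" using P(2) Q(2) \<rho>(1) by simp
    then obtain \<Theta> \<Theta>' where \<Theta>: "unimodular_diffeo \<Theta> \<Theta>' (midpoint P Q) (\<rho>/3)"
        "unimodular_diffeo \<Theta>' \<Theta> (midpoint P Q) (\<rho>/3)" "\<Theta> P = Q"
      using unimodular_half_turn[OF n] by blast
    have "midpoint P Q \<in> closed_segment P Q" by (rule midpoint_in_closed_segment)
    then have mid: "midpoint P Q \<in> ?B" using P(2) Q(2) closed_segment_subset[OF _ _ convex_ball] by blast
    have ballV: "cball (midpoint P Q) (\<rho>/3) \<subseteq> snd c ` (fst c \<inter> V)"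
    proof -
      have "dist (snd c z) y < \<rho>" if "dist (midpoint P Q) y \<le> \<rho>/3" for y
        using mid that \<rho>(1) dist_triangle[of "snd c z" y "midpoint P Q"] by simp
      then have "cball (midpoint P Q) (\<rho>/3) \<subseteq> ball (snd c z) \<rho>" by auto
      then show ?thesis using \<rho>(2) by blast
    qed
    then have ball: "cball (midpoint P Q) (\<rho>/3) \<subseteq> chart_image c" unfolding chart_image_def by blast
    let ?\<phi> = "extend_by_identity c \<Theta>"
    have "?\<phi> \<in> multisymplectic_diffeos M \<Omega>"
      by (rule extend_in_group[OF c(1) ball \<Theta>(1,2) \<Omega> \<eta> const])
    moreover have "?\<phi> p = q"
      using P(1) Q(1) PQ c(1) \<Theta>(3) by (simp add: extend_by_identity_def)
    moreover have "?\<phi> x = x" if "x \<notin> V" for x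
    proof (rule extend_off_ball[OF c(1) ball \<Theta>(1)])
      show "x \<notin> chart_inv c ` cball (midpoint P Q) (\<rho>/3)"
      proof
        assume "x \<in> chart_inv c ` cball (midpoint P Q) (\<rho>/3)"
        then obtain x' where "x = chart_inv c (snd c x')" "x' \<in> fst c" "x' \<in> V" using ballV by blast
        then show False using c(1) that by simp
      qed
    qed
    ultimately show ?thesis by blast
  qed
  ultimately show ?thesis using that by blast
qed

text \<open>The points that \<open>x\<close> can be moved to form an open set, and so do the remaining points outside
  \<open>F\<close>, because every point has a neighbourhood in which any point can be moved to any other.\<close>

lemma move_fixing_finite:
  assumes n: "2 \<le> DIM('e)" and \<Omega>: "differential_form M DIM('e) \<Omega>"
    and unimodular: "\<And>z. \<exists>c \<eta>. c \<in> M \<and> z \<in> fst c \<and> top_form \<eta> \<and>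
      (\<forall>y us. y \<in> chart_image c \<longrightarrow> length us = DIM('e) \<longrightarrow> form_rep M c \<Omega> y us = \<eta> us)"
    and F: "finite F" "x \<notin> F" "y \<notin> F"
  shows "\<exists>\<phi>\<in>multisymplectic_diffeos M \<Omega>. \<phi> x = y \<and> (\<forall>u\<in>F. \<phi> u = u)"
proof -
  let ?G = "multisymplectic_diffeos M \<Omega>"
  have opn: "open (- F)" using F(1) finite_imp_closed by blast
  have nbhd: "\<exists>N. open N \<and> z \<in> N \<and> N \<subseteq> - F \<and> (\<forall>p\<in>N. \<forall>q\<in>N. \<exists>\<phi>\<in>?G. \<phi> p = q \<and> (\<forall>u\<in>F. \<phi> u = u))"
    if z: "z \<in> - F" for z
  proof -
    obtain c \<eta> where c: "c \<in> M" "z \<in> fst c" and \<eta>: "top_form \<eta>"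
      and const: "\<And>y us. y \<in> chart_image c \<Longrightarrow> length us = DIM('e) \<Longrightarrow> form_rep M c \<Omega> y us = \<eta> us"
      using unimodular[of z] by blast
    show ?thesis
    proof (rule local_moves[OF n \<Omega> opn z c \<eta> const])
      fix N assume N: "open N" "z \<in> N" "N \<subseteq> - F"
        "\<And>p q. p \<in> N \<Longrightarrow> q \<in> N \<Longrightarrow> \<exists>\<phi>\<in>?G. \<phi> p = q \<and> (\<forall>x. x \<notin> - F \<longrightarrow> \<phi> x = x)"
      have "\<exists>\<phi>\<in>?G. \<phi> p = q \<and> (\<forall>u\<in>F. \<phi> u = u)" if "p \<in> N" "q \<in> N" for p q
        using N(4)[OF that] by blast
      then show ?thesis using N(1-3) by blast
    qed
  qed
  define orbit where "orbit = {z \<in> - F. \<exists>\<phi>\<in>?G. \<phi> x = z \<and> (\<forall>u\<in>F. \<phi> u = u)}"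
  have step: "q \<in> orbit" if N: "N \<subseteq> - F" "\<forall>p\<in>N. \<forall>q\<in>N. \<exists>\<phi>\<in>?G. \<phi> p = q \<and> (\<forall>u\<in>F. \<phi> u = u)"
    and p: "p \<in> orbit" "p \<in> N" and q: "q \<in> N" for N p q
  proof -
    obtain \<phi> where \<phi>: "\<phi> \<in> ?G" "\<phi> x = p" "\<forall>u\<in>F. \<phi> u = u" using p(1) unfolding orbit_def by blast
    obtain \<psi> where \<psi>: "\<psi> \<in> ?G" "\<psi> p = q" "\<forall>u\<in>F. \<psi> u = u" using N(2) p(2) q by blast
    have "\<psi> \<circ> \<phi> \<in> ?G" by (rule multisymplectic_compose[OF \<phi>(1) \<psi>(1)])
    moreover have "(\<psi> \<circ> \<phi>) x = q" "\<forall>u\<in>F. (\<psi> \<circ> \<phi>) u = u" using \<phi> \<psi> by simp_all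
    ultimately show ?thesis using q N(1) unfolding orbit_def by blast
  qed
  have "open orbit"
  proof (subst open_subopen, rule ballI)
    fix z assume z: "z \<in> orbit"
    then have "z \<in> - F" by (simp add: orbit_def)
    from nbhd[OF this] obtain N where N: "open N" "z \<in> N" "N \<subseteq> - F"
        "\<forall>p\<in>N. \<forall>q\<in>N. \<exists>\<phi>\<in>?G. \<phi> p = q \<and> (\<forall>u\<in>F. \<phi> u = u)"
      by (elim exE conjE)
    have "N \<subseteq> orbit" by (rule subsetI) (rule step[OF N(3,4) z N(2)])
    with N(1,2) show "\<exists>T. open T \<and> z \<in> T \<and> T \<subseteq> orbit" by (intro exI[of _ N] conjI)
  qed
  moreover have "open (- F - orbit)"
  proof (subst open_subopen, rule ballI)
    fix z assume z: "z \<in> - F - orbit"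
    then have "z \<in> - F" by simp
    from nbhd[OF this] obtain N where N: "open N" "z \<in> N" "N \<subseteq> - F"
        "\<forall>p\<in>N. \<forall>q\<in>N. \<exists>\<phi>\<in>?G. \<phi> p = q \<and> (\<forall>u\<in>F. \<phi> u = u)"
      by (elim exE conjE)
    have "q \<notin> orbit" if "q \<in> N" for q
      using step[OF N(3,4) _ that N(2)] z by (meson DiffD2)
    with N(3) have "N \<subseteq> - F - orbit" by (simp add: subset_iff)
    with N(1,2) show "\<exists>T. open T \<and> z \<in> T \<and> T \<subseteq> - F - orbit" by (intro exI[of _ N] conjI)
  qed
  moreover have "orbit \<inter> (- F - orbit) \<inter> - F = {}" "- F \<subseteq> orbit \<union> (- F - orbit)" by blast+
  ultimately have "orbit \<inter> - F = {} \<or> (- F - orbit) \<inter> - F = {}"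
    by (rule connectedD[OF connected_complement_finite[OF n F(1)]])
  moreover have "x \<in> orbit" using identity_in_group[OF \<Omega>] F(2) unfolding orbit_def
    by (auto intro!: bexI[of _ "\<lambda>x. x"])
  ultimately have "y \<in> orbit" using F by blast
  then show ?thesis unfolding orbit_def by blast
qed

end

theorem corollary1:
  fixes M :: "('a::t2_space, real ^ 'n) chart set"
    and k :: nat
    and \<Omega> :: "('a, real ^ 'n) form"
  assumes "multisymplectic_manifold M k \<Omega>"
    and "locally_homogeneous M k \<Omega>"
  shows "\<forall>r\<ge>1. acts_transitively r (multisymplectic_diffeos M \<Omega>)"
proof -
  let ?n = "DIM(real ^ 'n)" and ?G = "multisymplectic_diffeos M \<Omega>"
  have \<Omega>: "differential_form M k \<Omega>" "one_nondegenerate M \<Omega>" "closed_form M k \<Omega>" "k \<ge> 2"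
    and "smooth_manifold M"
    using assms(1) unfolding multisymplectic_manifold_def by blast+
  then interpret manifold M by unfold_locales
  have k: "k = ?n" by (rule degree_eq_dimension[OF \<Omega> assms(2)])
  have n: "2 \<le> ?n" using \<Omega>(4) k by simp
  have \<Omega>n: "differential_form M ?n \<Omega>" using \<Omega>(1) k by simp
  have unimodular: "\<exists>c \<eta>. c \<in> M \<and> z \<in> fst c \<and> top_form \<eta> \<and>
      (\<forall>y us. y \<in> chart_image c \<longrightarrow> length us = ?n \<longrightarrow> form_rep M c \<Omega> y us = \<eta> us)" for z
  proof -
    obtain K \<Delta> where "local_euler_like M z K \<Delta>"
      using assms(2)[unfolded locally_homogeneous_def locally_homogeneous_at_def, rule_format,
          OF conjI[OF open_UNIV UNIV_I], of z] by blast
    then obtain c0 where c0: "c0 \<in> M" "z \<in> fst c0" "chart_image c0 = UNIV"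
      using euler_chart by metis
    show ?thesis
      by (rule unimodular_chart[OF \<Omega>n \<Omega>(2) c0(1,3,2)]) blast
  qed
  have "\<exists>\<phi>\<in>?G. \<forall>i<r. \<phi> (xs ! i) = ys ! i"
    if "length xs = r" "distinct xs" "length ys = r" "distinct ys" for r xs ys
    using that
  proof (induction r arbitrary: xs ys)
    case 0
    then show ?case using identity_in_group[OF \<Omega>(1)] by blast
  next
    case (Suc r)
    obtain \<phi> where \<phi>: "\<phi> \<in> ?G" "\<And>i. i < r \<Longrightarrow> \<phi> (xs ! i) = ys ! i"
      using Suc.IH[of "take r xs" "take r ys"] Suc.prems by auto
    \<comment> \<open>The first \<open>r\<close> points are in place; the last one is moved with those targets fixed.\<close>
    have inj: "inj \<phi>" using \<phi>(1) by (auto simp: multisymplectic_diffeos_def diffeomorphism_def bij_betw_def)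
    define F where "F = (\<lambda>i. ys ! i) ` {..<r}"
    have "\<phi> (xs ! r) \<notin> F"
    proof
      assume "\<phi> (xs ! r) \<in> F"
      then obtain i where i: "i < r" "\<phi> (xs ! r) = \<phi> (xs ! i)" using \<phi>(2) by (auto simp: F_def)
      then show False using inj Suc.prems by (simp add: inj_eq nth_eq_iff_index_eq)
    qed
    moreover have "ys ! r \<notin> F" using Suc.prems by (auto simp: F_def nth_eq_iff_index_eq)
    moreover have "finite F" by (simp add: F_def)
    ultimately obtain \<psi> where \<psi>: "\<psi> \<in> ?G" "\<psi> (\<phi> (xs ! r)) = ys ! r" "\<forall>u\<in>F. \<psi> u = u"
      using move_fixing_finite[OF n \<Omega>n unimodular] by blast
    have "(\<psi> \<circ> \<phi>) (xs ! i) = ys ! i" if "i < Suc r" for i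
      using that \<psi> \<phi>(2) by (cases "i = r") (auto simp: F_def less_Suc_eq)
    then show ?case using multisymplectic_compose[OF \<phi>(1) \<psi>(1)] by blast
  qed
  then show ?thesis unfolding acts_transitively_def by blast
qed

end
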